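(* Let $H(X,Y,q)$ be the mirror curve polynomial described in the context. There is $\epsilon>0$ such that for every $q\in(\mathbb{R}^* )^p$ with $|q_k|<\epsilon$ for all $k$, $a_i(q)<0$ whenever $m_i,n_i$ are both odd, and $a_i(q)>0$ whenever $m_i$ or $n_i$ is even, the following holds: if $l_i$ is the axis of $\mathbb{R}X_P$ corresponding to a side $r_i$ of $P$ of integer length $d_i$, then there exists an arc of the unbounded component $W$ which intersects $l_i$ in $d_i$ points and does not intersect any other axis.
   Context: Let $P\subset\mathbb{R}^2$ be a convex lattice polygon with a unimodular triangulation $T_\Sigma$ (triangles with lattice vertices and area $1/2$; vertex set $P\cap\mathbb{Z}^2$), encoding a smooth toric Calabi–Yau 3-fold. Write $P\cap\mathbb{Z}^2=\{b_1,\dots,b_{p+3}\}$, $b_i=(m_i,n_i)$, with $b_1=(1,0)$, $b_2=(0,1)$, $b_3=(0,0)$ and $\sigma_1=\{b_1,b_2,b_3\}$ a triangle of $T_\Sigma$. Let $L=\ker(\mathbb{Z}^{p+3}\to\mathbb{Z}^3,\ e_i\mapsto(m_i,n_i,1))$, $D_i\in L^\vee$ the restriction of the $i$-th coordinate functional; for a triangle $\sigma$ with vertex index set $I'_\sigma$, $\{D_j:j\notin I'_\sigma\}$ is a basis of $L^\vee\otimes\mathbb{Q}$. Fix $H_1,\dots,H_p\in L^\vee\otimes\mathbb{Q}$ with $H_k=\sum_{j\notin I'_\sigma}s^\sigma_{k,j}D_j$, $s^\sigma_{k,j}\in\mathbb{Z}_{\ge0}$, $(s^\sigma_{k,j})$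 nondegenerate, for every triangle $\sigma$. Set $a_i(q)=1$ ($i=1,2,3$), $a_i(q)=\prod_k q_k^{s^{\sigma_1}_{k,i}}$ ($i\ge4$), and $H(X,Y,q)=\sum_{i=1}^{p+3}a_i(q)X^{m_i}Y^{n_i}$. Let $X_P$ be the projective toric surface of $P$, $\mathbb{R}X_P$ the closure of $(\mathbb{R}^* )^2$ in $X_P$; for each side $r_i$ of $P$ the axis $l_i$ is the real part of the torus-invariant boundary divisor of $X_P$ corresponding to $r_i$. The integer length $d_i$ of $r_i$ is the number of lattice points on $r_i$ minus one. The real mirror curve is $\{(x,y)\in(\mathbb{R}^* )^2:H(x,y,q)=0\}$; the unbounded component $W$ is the connected component of its closure in $\mathbb{R}X_P$ that meets the union of the axes (in this setting there is exactly one such component). *)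

theory Defs
  imports "HOL-Analysis.Analysis"
begin

definition proj_pt :: "real^'n \<Rightarrow> (real^'n) set" where
  "proj_pt v = {c *\<^sub>R v | c. c \<noteq> 0}"

definition RP_open :: "(real^'n) set set \<Rightarrow> bool" where
  "RP_open U \<longleftrightarrow> U \<subseteq> proj_pt ` (UNIV - {0}) \<and> open {v. v \<noteq> 0 \<and> proj_pt v \<in> U}"

lemma istopology_RP_open: "istopology RP_open"
  unfolding istopology_def
proof (intro conjI allI impI)
  fix S T :: "(real^'n) set set"
  assume "RP_open S" "RP_open T"
  then show "RP_open (S \<inter> T)"
  proof -
    have eq: "{v. v \<noteq> 0 \<and> proj_pt v \<in> S \<inter> T}
        = {v. v \<noteq> 0 \<and> proj_pt v \<in> S} \<inter> {v. v \<noteq> 0 \<and> proj_pt v \<in> T}" by auto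
    show ?thesis using \<open>RP_open S\<close> \<open>RP_open T\<close> unfolding RP_open_def eq by auto
  qed
next
  fix K :: "(real^'n) set set set"
  assume K: "\<forall>U\<in>K. RP_open U"
  have eq: "{v. v \<noteq> 0 \<and> proj_pt v \<in> \<Union>K} = (\<Union>U\<in>K. {v. v \<noteq> 0 \<and> proj_pt v \<in> U})" by auto
  show "RP_open (\<Union>K)"
    using K unfolding RP_open_def eq by auto
qed

definition RP_topology :: "(real^'n) set topology" where
  "RP_topology = topology RP_open"

text \<open>b enumerates the lattice points of P; the index type 'n has p+3 elements.\<close>

definition lpt :: "int \<times> int \<Rightarrow> real \<times> real" where
  "lpt z = (real_of_int (fst z), real_of_int (snd z))"

definition polygon :: "('n \<Rightarrow> int \<times> int) \<Rightarrow> (real \<times> real) set" where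
  "polygon b = convex hull (range (lpt \<circ> b))"

definition toric_map :: "('n::finite \<Rightarrow> int \<times> int) \<Rightarrow> real \<times> real \<Rightarrow> (real^'n) set" where
  "toric_map b xy = proj_pt (\<chi> i. fst xy powi fst (b i) * snd xy powi snd (b i))"

definition real_torus :: "(real \<times> real) set" where
  "real_torus = {(x, y). x \<noteq> 0 \<and> y \<noteq> 0}"

definition real_toric_surface :: "('n::finite \<Rightarrow> int \<times> int) \<Rightarrow> (real^'n) set set" where
  "real_toric_surface b = RP_topology closure_of (toric_map b ` real_torus)"

definition is_side :: "('n \<Rightarrow> int \<times> int) \<Rightarrow> 'n set \<Rightarrow> bool" where
  "is_side b E \<longleftrightarrow> (\<exists>u c. u \<noteq> (0::real \<times> real) \<and> (\<forall>i. inner u (lpt (b i)) \<le> c)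
      \<and> E = {i. inner u (lpt (b i)) = c} \<and> card E \<ge> 2)"

definition int_length :: "'n set \<Rightarrow> nat" where
  "int_length E = card E - 1"

text \<open>Axis: real part of the torus-invariant divisor of the side E (all coordinates off E vanish).\<close>
definition axis :: "('n::finite \<Rightarrow> int \<times> int) \<Rightarrow> 'n set \<Rightarrow> (real^'n) set set" where
  "axis b E = {z \<in> real_toric_surface b. \<forall>v\<in>z. \<forall>i. i \<notin> E \<longrightarrow> v $ i = 0}"

definition lattice_points_enum :: "('n \<Rightarrow> int \<times> int) \<Rightarrow> bool" where
  "lattice_points_enum b \<longleftrightarrow> inj b \<and> (\<forall>z. lpt z \<in> polygon b \<longrightarrow> z \<in> range b)"

definition det2 :: "int \<times> int \<Rightarrow> int \<times> int \<Rightarrow> int \<times> int \<Rightarrow> int" where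
  "det2 u v w = (fst v - fst u) * (snd w - snd u) - (fst w - fst u) * (snd v - snd u)"

definition unimodular_triangulation :: "('n \<Rightarrow> int \<times> int) \<Rightarrow> 'n set set \<Rightarrow> bool" where
  "unimodular_triangulation b T \<longleftrightarrow>
     (\<forall>\<sigma>\<in>T. \<exists>i j k. \<sigma> = {i, j, k} \<and> \<bar>det2 (b i) (b j) (b k)\<bar> = 1)
   \<and> \<Union>T = UNIV
   \<and> (\<Union>\<sigma>\<in>T. convex hull ((lpt \<circ> b) ` \<sigma>)) = polygon b
   \<and> (\<forall>\<sigma>\<in>T. \<forall>\<tau>\<in>T. convex hull ((lpt \<circ> b) ` \<sigma>) \<inter> convex hull ((lpt \<circ> b) ` \<tau>)
                     = convex hull ((lpt \<circ> b) ` (\<sigma> \<inter> \<tau>)))"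

definition charge_lattice :: "('n::finite \<Rightarrow> int \<times> int) \<Rightarrow> ('n \<Rightarrow> int) set" where
  "charge_lattice b = {v. (\<Sum>i\<in>UNIV. v i * fst (b i)) = 0 \<and> (\<Sum>i\<in>UNIV. v i * snd (b i)) = 0
                          \<and> (\<Sum>i\<in>UNIV. v i) = 0}"

text \<open>H_k (given by a lift h k \<in> Q^(p+3), restricted to L) equals \<Sum>_{j \<notin> \<sigma>} s \<sigma> k j D_j on L,
  with s \<sigma> nondegenerate (square p x p matrix indexed by k < p and j \<notin> \<sigma>).\<close>
definition kahler_data :: "('n::finite \<Rightarrow> int \<times> int) \<Rightarrow> 'n set set \<Rightarrow> nat
      \<Rightarrow> (nat \<Rightarrow> 'n \<Rightarrow> rat) \<Rightarrow> ('n set \<Rightarrow> nat \<Rightarrow> 'n \<Rightarrow> nat) \<Rightarrow> bool" where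
  "kahler_data b T p h s \<longleftrightarrow>
     (\<forall>\<sigma>\<in>T. \<forall>k<p. \<forall>v\<in>charge_lattice b.
        (\<Sum>i\<in>UNIV. h k i * of_int (v i)) = (\<Sum>j\<in>UNIV - \<sigma>. of_nat (s \<sigma> k j) * of_int (v j)))
   \<and> (\<forall>\<sigma>\<in>T. \<forall>c :: nat \<Rightarrow> real. (\<forall>j. j \<notin> \<sigma> \<longrightarrow> (\<Sum>k<p. c k * real (s \<sigma> k j)) = 0)
                \<longrightarrow> (\<forall>k<p. c k = 0))"

definition mirror_coeff :: "'n set \<Rightarrow> nat \<Rightarrow> ('n set \<Rightarrow> nat \<Rightarrow> 'n \<Rightarrow> nat) \<Rightarrow> (nat \<Rightarrow> real) \<Rightarrow> 'n \<Rightarrow> real" where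
  "mirror_coeff \<sigma>1 p s q i = (if i \<in> \<sigma>1 then 1 else (\<Prod>k<p. q k ^ s \<sigma>1 k i))"

definition mirror_poly :: "('n::finite \<Rightarrow> int \<times> int) \<Rightarrow> 'n set \<Rightarrow> nat \<Rightarrow> ('n set \<Rightarrow> nat \<Rightarrow> 'n \<Rightarrow> nat)
      \<Rightarrow> real \<Rightarrow> real \<Rightarrow> (nat \<Rightarrow> real) \<Rightarrow> real" where
  "mirror_poly b \<sigma>1 p s X Y q = (\<Sum>i\<in>UNIV. mirror_coeff \<sigma>1 p s q i * X powi fst (b i) * Y powi snd (b i))"

definition mirror_curve_closure :: "('n::finite \<Rightarrow> int \<times> int) \<Rightarrow> 'n set \<Rightarrow> nat
      \<Rightarrow> ('n set \<Rightarrow> nat \<Rightarrow> 'n \<Rightarrow> nat) \<Rightarrow> (nat \<Rightarrow> real) \<Rightarrow> (real^'n) set set" where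
  "mirror_curve_closure b \<sigma>1 p s q =
     RP_topology closure_of (toric_map b ` {(x, y) \<in> real_torus. mirror_poly b \<sigma>1 p s x y q = 0})"

definition is_arc :: "'a topology \<Rightarrow> 'a set \<Rightarrow> bool" where
  "is_arc X A \<longleftrightarrow> (\<exists>g. pathin X g \<and> inj_on g {0..1} \<and> g ` {0..1} = A)"

end

theory Submission
  imports Defs
begin

text \<open>In each quadrant the terms of \<open>H\<close> whose exponents lie in one residue class modulo 2 have one sign
  and all other terms have the opposite sign (Harnack's sign rule). Near a term \<open>v\<close> of that class the
  Kaehler condition makes every other term of the class smaller by a factor \<open>\<epsilon>\<close> than a monomial in the
  terms of opposite sign, namely those at the two other vertices of the triangle at \<open>v\<close> whose cone contains
  the exponent. Hence, in coordinates \<open>(z, y)\<close> with \<open>x = \<plusminus>exp z\<close> along a side and \<open>y\<close> transverse to it,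
  \<open>H\<close> normalised by its \<open>v\<close>-term is strictly monotone in \<open>\<bar>y\<bar>\<close> as long as the terms of opposite sign are
  bounded, and for every \<open>z\<close> there is exactly one such root \<open>y\<close>, where \<open>v\<close> ranges over the lattice points
  of the side. These roots form the graph of a continuous function of \<open>z\<close>, whose zeros are the roots of the
  side polynomial; there are as many as its degree, by log-concavity of its coefficients. The arc is a piece
  of this graph. The graphs of two sides with a common vertex meet, and every point of the closed curve
  on an axis lies on the graph of that side, so all the graphs lie in \<open>W\<close>.\<close>

section \<open>The curve in the chart of a side\<close>

text \<open>The triangle at \<open>v\<close> has odd determinant, so a term \<open>w\<close>
  congruent to \<open>v\<close> has even coordinates \<open>m\<close>, \<open>n\<close> in its cone.
  Hence \<open>w\<close> is no vertex of that triangle, and the affine relation between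
  \<open>w\<close>, \<open>v\<close> and the two other vertices has a positive coordinate off the
  triangle; there the Kaehler condition yields the factor \<epsilon>. The obstacle is that the
  comparison is with a monomial of degree up to \<open>D\<close>, so it controls the congruent terms
  only while the terms of opposite sign are bounded. The estimates therefore carry the hypothesis
  \<open>S v z t \<le> K\<close>, which also separates the branch from other roots of
  \<open>H\<close> over the same \<open>z\<close>. The constant \<open>K\<close> exceeds 2, so that
  the terms of opposite sign win once their sum reaches \<open>K\<close>, and it is at least the
  square of the number of terms, so that the base term may be exchanged for a comparable one. The
  bound on \<epsilon> is then chosen against \<open>K ^ (D + 1)\<close>.\<close>

lemma log_concave_dominating_points:
  fixes a :: "nat \<Rightarrow> real"
  assumes a: "\<And>j. j \<le> d \<Longrightarrow> a j > 0"
    and lc: "\<And>j. j + 2 \<le> d \<Longrightarrow> a j * a (j + 2) \<le> \<theta> ^ 2 * a (j + 1) ^ 2"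
    and \<theta>: "0 < \<theta>" "\<theta> < 1" and d: "d \<ge> 1"
  obtains x where "\<And>j. j \<le> d \<Longrightarrow> x j > 0" "\<And>j. j < d \<Longrightarrow> x j < x (Suc j)"
    "\<And>i j. i \<le> d \<Longrightarrow> j \<le> d \<Longrightarrow> i \<noteq> j \<Longrightarrow> a i * x j ^ i \<le> \<theta> * (a j * x j ^ j)"
proof -
  define r where "r j = a (Suc j) / a j" for j
  have r0: "r j > 0" if "j < d" for j using a that by (simp add: r_def)
  have \<theta>2: "\<theta> ^ 2 < 1" using \<theta> by (simp add: power_less_one_iff)
  have r_step: "r (Suc j) \<le> \<theta> ^ 2 * r j" if "Suc j < d" for j
    using lc[of j] a[of j] a[of "Suc j"] that by (simp add: r_def field_simps power2_eq_square)
  have r_less: "r (Suc j) < r j" if "Suc j < d" for j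
  proof -
    have "\<theta> ^ 2 * r j < 1 * r j" using \<theta>2 r0 that by (intro mult_strict_right_mono) auto
    then show ?thesis using r_step[OF that] by simp
  qed
  have r_mono: "r i \<le> r j" if "j \<le> i" "i < d" for i j
    using that by (induction i rule: dec_induct) (auto dest: r_less)
  \<comment> \<open>At \<open>x j\<close> the ratio of term \<open>i + 1\<close> to term
    \<open>i\<close> is \<open>r i * x j\<close>. Domination by term \<open>j\<close> asks for
    ratios at least 1 / \<theta> below \<open>j\<close> and at most \<theta> from \<open>j\<close>
    on, so \<open>x j\<close> may lie between 1 / (\<theta> r_{j-1}) and \<theta> / r_j, an interval
    that is nonempty by log-concavity. The left end is taken, except for \<open>j = 0\<close>, which
    has only a right end.\<close>
  define x where "x j = (case j of 0 \<Rightarrow> \<theta> / r 0 | Suc i \<Rightarrow> 1 / (\<theta> * r i))" for j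
  have x0: "x j > 0" if "j \<le> d" for j
    using r0[of 0] r0[of "j - 1"] \<theta> d that by (auto simp: x_def split: nat.split)
  have up: "r i * x j \<le> \<theta>" if "j \<le> i" "i < d" for i j
  proof (cases j)
    case 0
    then show ?thesis using r_mono[of 0 i] r0[of 0] \<theta> that by (simp add: x_def field_simps)
  next
    case (Suc m)
    have "r i \<le> \<theta> ^ 2 * r m" using r_mono[of j i] r_step[of m] that Suc by simp
    then show ?thesis using Suc r0[of m] that \<theta> by (simp add: x_def field_simps power2_eq_square)
  qed
  have down: "1 \<le> \<theta> * (r i * x j)" if "i < j" "j \<le> d" for i j
  proof -
    obtain m where m: "j = Suc m" using \<open>i < j\<close> by (cases j) auto
    then show ?thesis using r_mono[of i m] r0[of m] that \<theta> by (simp add: x_def)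
  qed
  have step: "a (Suc i) * x j ^ Suc i = (r i * x j) * (a i * x j ^ i)" if "i < d" for i j
    using a[of i] that by (simp add: r_def)
  have T0: "a i * x j ^ i > 0" if "i \<le> d" "j \<le> d" for i j using a x0 that by simp
  have right: "a i * x j ^ i \<le> \<theta> * (a j * x j ^ j)" if "Suc j \<le> i" "i \<le> d" for i j
    using that
  proof (induction i rule: dec_induct)
    case base
    then show ?case unfolding step[of j j, OF Suc_le_lessD[OF base]]
      using up[of j j] T0[of j j] by (intro mult_right_mono) auto
  next
    case (step i)
    have "a (Suc i) * x j ^ Suc i = (r i * x j) * (a i * x j ^ i)"
      using a[of i] step by (simp add: r_def)
    also have "\<dots> \<le> 1 * (a i * x j ^ i)"
      using up[of j i] \<theta> T0[of i j] step by (intro mult_right_mono) auto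
    finally show ?case using step by simp
  qed
  have left: "a i * x j ^ i \<le> \<theta> * (a j * x j ^ j)" if "i < j" "j \<le> d" for i j
  proof -
    have le: "a i * x j ^ i \<le> \<theta> * (a (Suc i) * x j ^ Suc i)" if "i < j" for i
    proof -
      have "1 * (a i * x j ^ i) \<le> (\<theta> * (r i * x j)) * (a i * x j ^ i)"
        using down[of i j] T0[of i j] that \<open>j \<le> d\<close> by (intro mult_right_mono) auto
      moreover have "i < d" using that \<open>j \<le> d\<close> by simp
      ultimately show ?thesis unfolding step[of i j, OF \<open>i < d\<close>] by (simp only: mult_1 mult.assoc)
    qed
    have le1: "a i * x j ^ i \<le> a j * x j ^ j" if "i \<le> j" for i
      using that
    proof (induction i rule: inc_induct)
      case base
      then show ?case by simp
    next
      case (step i)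
      have "\<theta> * (a (Suc i) * x j ^ Suc i) \<le> 1 * (a (Suc i) * x j ^ Suc i)"
        using \<theta> T0[of "Suc i" j] step \<open>j \<le> d\<close> by (intro mult_right_mono) auto
      then show ?case using le[of i] step by simp
    qed
    have "\<theta> * (a (Suc i) * x j ^ Suc i) \<le> \<theta> * (a j * x j ^ j)"
      using le1[of "Suc i"] that \<theta> by (intro mult_left_mono) auto
    then show ?thesis using le[OF that(1)] by linarith
  qed
  have "x j < x (Suc j)" if "j < d" for j
  proof (cases j)
    case 0
    have "\<theta> * \<theta> < 1" using \<theta>2 by (simp add: power2_eq_square)
    then show ?thesis using 0 r0[of 0] d \<theta> by (simp add: x_def field_simps)
  next
    case (Suc m)
    then show ?thesis using r_less[of m] r0[of m] r0[of j] that \<theta> by (simp add: x_def field_simps)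
  qed
  moreover have "a i * x j ^ i \<le> \<theta> * (a j * x j ^ j)" if "i \<le> d" "j \<le> d" "i \<noteq> j" for i j
    using left[of i j] right[of j i] that by (cases "i < j") auto
  ultimately show ?thesis using that x0 by blast
qed

text \<open>Telescoping changes one factor at a time, by at most \<Delta>, while the others stay
  below \<open>K\<close>; \<open>1 \<le> K\<close> allows the exponent \<open>D\<close> throughout.
  It turns increments of \<open>S\<close> into bounds for increments of the congruent terms.\<close>

lemma power_product_lipschitz:
  fixes A A' B B' K \<Delta> :: real
  assumes "0 \<le> A" "A \<le> A'" "A' \<le> K" "0 \<le> B" "B \<le> B'" "B' \<le> K" "1 \<le> K"
    and "A' - A \<le> \<Delta>" "B' - B \<le> \<Delta>" "a + b \<le> D"
  shows "A' ^ a * B' ^ b - A ^ a * B ^ b \<le> real D * K ^ D * \<Delta>"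
  using assms(10)
proof (induction a arbitrary: b D)
  case 0
  have K: "K ^ m \<le> K ^ n" if "m \<le> n" for m n :: nat
    using assms(7) that by (rule power_increasing[rotated])
  have \<Delta>0: "0 \<le> \<Delta>" using assms by linarith
  have "B' ^ b - B ^ b \<le> real b * K ^ b * \<Delta>"
  proof (induction b)
    case 0
    show ?case by simp
  next
    case (Suc b)
    have "B' ^ Suc b - B ^ Suc b = B' * (B' ^ b - B ^ b) + (B' - B) * B ^ b"
      by (simp add: algebra_simps)
    also have "\<dots> \<le> K * (real b * K ^ b * \<Delta>) + \<Delta> * K ^ b"
    proof (rule add_mono)
      have "0 \<le> B' ^ b - B ^ b" using assms by (simp add: power_mono)
      then show "B' * (B' ^ b - B ^ b) \<le> K * (real b * K ^ b * \<Delta>)"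
        using Suc assms by (intro mult_mono) auto
      show "(B' - B) * B ^ b \<le> \<Delta> * K ^ b"
        using assms by (intro mult_mono power_mono) auto
    qed
    also have "\<dots> \<le> real (Suc b) * K ^ Suc b * \<Delta>"
      using mult_right_mono[OF K[of b "Suc b"] \<Delta>0] by (simp add: algebra_simps)
    finally show ?case .
  qed
  also have "\<dots> \<le> real D * K ^ D * \<Delta>"
    using 0 K[of b D] \<Delta>0 assms by (intro mult_right_mono mult_mono) auto
  finally show ?case by simp
next
  case (Suc a)
  have K: "K ^ m \<le> K ^ n" if "m \<le> n" for m n :: nat
    using assms(7) that by (rule power_increasing[rotated])
  have \<Delta>0: "0 \<le> \<Delta>" using assms by linarith
  obtain D' where D': "D = Suc D'" "a + b \<le> D'"
    using Suc.prems by (cases D) auto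
  have "A' ^ Suc a * B' ^ b - A ^ Suc a * B ^ b
      = A' * (A' ^ a * B' ^ b - A ^ a * B ^ b) + (A' - A) * (A ^ a * B ^ b)"
    by (simp add: algebra_simps)
  also have "\<dots> \<le> K * (real D' * K ^ D' * \<Delta>) + \<Delta> * (K ^ a * K ^ b)"
  proof (rule add_mono)
    have "0 \<le> A' ^ a * B' ^ b - A ^ a * B ^ b"
      using assms by (simp add: power_mono mult_mono)
    then show "A' * (A' ^ a * B' ^ b - A ^ a * B ^ b) \<le> K * (real D' * K ^ D' * \<Delta>)"
      using Suc.IH[OF D'(2)] assms by (intro mult_mono) auto
    show "(A' - A) * (A ^ a * B ^ b) \<le> \<Delta> * (K ^ a * K ^ b)"
      using assms by (intro mult_mono power_mono) auto
  qed
  also have "\<Delta> * (K ^ a * K ^ b) \<le> \<Delta> * K ^ D"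
    unfolding power_add[symmetric] using \<Delta>0 K Suc.prems by (intro mult_left_mono) auto
  finally show ?case by (simp add: D'(1) algebra_simps)
qed

text \<open>The polynomial \<open>\<Sum>i. c i x^(k i) y^(l i)\<close> on \<open>x = exp z > 0\<close>; the points \<open>ev 0, \<dots>, ev d\<close> of the side are
  those with \<open>l i = 0\<close>. The signs of \<open>x\<close> and \<open>y\<close> are normalised such that exactly the coefficients with
  \<open>k i\<close> odd and \<open>l i\<close> even are negative.\<close>

locale side_chart =
  fixes k :: "'n::finite \<Rightarrow> int" and l :: "'n \<Rightarrow> nat" and c :: "'n \<Rightarrow> real"
    and d :: nat and ev :: "nat \<Rightarrow> 'n" and D :: nat and \<delta> :: real and K :: real
  assumes n2: "CARD('n) \<ge> 2" and K: "K = real CARD('n) ^ 2 + 2"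
    and \<delta>: "0 \<le> \<delta>" "4 * real CARD('n) * real D * K ^ (D + 1) * \<delta> \<le> 1" and D: "D \<ge> 1"
    and d: "d \<ge> 1"
    and ev: "\<And>j. j \<le> d \<Longrightarrow> k (ev j) = int j" "\<And>j. j \<le> d \<Longrightarrow> l (ev j) = 0"
      "\<And>i. l i = 0 \<Longrightarrow> \<exists>j\<le>d. i = ev j"
    and c_neg: "\<And>i. odd (k i) \<Longrightarrow> even (l i) \<Longrightarrow> c i < 0"
    and c_pos: "\<And>i. even (k i) \<or> odd (l i) \<Longrightarrow> c i > 0"
    and off_side: "\<And>v. l v = 0 \<Longrightarrow> \<exists>u. l u > 0 \<and> (odd (k u - k v) \<or> odd (l u))"
    and edge_dominated: "\<And>j. j + 2 \<le> d \<Longrightarrow> \<bar>c (ev j)\<bar> * \<bar>c (ev (j + 2))\<bar> \<le> \<delta> * c (ev (j + 1)) ^ 2"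
    and dominated: "\<And>v w. l v = 0 \<Longrightarrow> even (k w - k v) \<Longrightarrow> even (l w) \<Longrightarrow> w \<noteq> v \<Longrightarrow>
      \<exists>u1 u2 a b. (odd (k u1 - k v) \<or> odd (l u1)) \<and> (odd (k u2 - k v) \<or> odd (l u2))
        \<and> 1 \<le> a + b \<and> a + b \<le> D
        \<and> k w - k v = int a * (k u1 - k v) + int b * (k u2 - k v) \<and> l w = a * l u1 + b * l u2
        \<and> \<bar>c w / c v\<bar> \<le> \<delta> * \<bar>c u1 / c v\<bar> ^ a * \<bar>c u2 / c v\<bar> ^ b"
begin

section \<open>Sizes of terms relative to a side term\<close>

definition cong :: "'n \<Rightarrow> 'n \<Rightarrow> bool" where
  "cong i v \<longleftrightarrow> even (k i - k v) \<and> even (l i)"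

text \<open>For a side point \<open>v\<close>, where \<open>l v = 0\<close>, this is the absolute
  value of the quotient of the \<open>i\<close>-term by the \<open>v\<close>-term at
  \<open>x = exp z\<close> and \<open>\<bar>y\<bar> = t\<close>.\<close>

definition rel :: "'n \<Rightarrow> 'n \<Rightarrow> real \<Rightarrow> real \<Rightarrow> real" where
  "rel v i z t = \<bar>c i / c v\<bar> * exp (of_int (k i - k v) * z) * t ^ l i"

definition S :: "'n \<Rightarrow> real \<Rightarrow> real \<Rightarrow> real" where
  "S v z t = (\<Sum>i | \<not> cong i v. rel v i z t)"

definition N :: "'n \<Rightarrow> real \<Rightarrow> real \<Rightarrow> real" where
  "N v z t = (\<Sum>i | cong i v \<and> i \<noteq> v. rel v i z t)"

text \<open>The half-plane \<open>y = \<sigma> v * t\<close>, \<open>t \<ge> 0\<close>, is the one in which all terms not congruent to \<open>v\<close> modulo 2 have the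
  sign opposite to the \<open>v\<close>-term, so that \<open>S v\<close> and \<open>N v\<close> are the negative and positive parts there.\<close>

definition \<sigma> :: "'n \<Rightarrow> real" where
  "\<sigma> v = (if even (k v) then -1 else 1)"

definition G :: "real \<Rightarrow> real \<Rightarrow> real" where
  "G z y = (\<Sum>i\<in>UNIV. c i * exp (of_int (k i) * z) * y ^ l i)"

lemma c_nz: "c i \<noteq> 0"
  using c_neg[of i] c_pos[of i] by (metis less_irrefl)

lemma K_bounds: "K \<ge> 1" "K > 2" "real CARD('n) ^ 2 \<le> K"
  using n2 by (auto simp: K add_pos_pos)

lemma rel_nonneg: "t \<ge> 0 \<Longrightarrow> rel v i z t \<ge> 0"
  by (simp add: rel_def)

lemma rel_mono: "0 \<le> t \<Longrightarrow> t \<le> t' \<Longrightarrow> rel v i z t \<le> rel v i z t'"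
  unfolding rel_def by (intro mult_left_mono power_mono) auto

lemma rel_le_S: "t \<ge> 0 \<Longrightarrow> \<not> cong i v \<Longrightarrow> rel v i z t \<le> S v z t"
  unfolding S_def by (intro member_le_sum) (auto simp: rel_nonneg)

lemma S_nonneg: "t \<ge> 0 \<Longrightarrow> S v z t \<ge> 0"
  unfolding S_def by (intro sum_nonneg) (auto simp: rel_nonneg)

lemma N_nonneg: "t \<ge> 0 \<Longrightarrow> N v z t \<ge> 0"
  unfolding N_def by (intro sum_nonneg) (auto simp: rel_nonneg)

lemma rel_diff_le_S_diff:
  assumes "0 \<le> t" "t \<le> t'" "\<not> cong i v"
  shows "rel v i z t' - rel v i z t \<le> S v z t' - S v z t"
  unfolding S_def sum_subtractf[symmetric]
  using assms by (intro member_le_sum) (auto simp: rel_mono)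

lemma S_mono: "0 \<le> t \<Longrightarrow> t \<le> t' \<Longrightarrow> S v z t \<le> S v z t'"
  unfolding S_def by (intro sum_mono) (auto simp: rel_mono)

text \<open>The relation between the exponents matches all powers of \<open>exp z\<close> and
  \<open>t\<close>, so the bound on the coefficients passes to the terms with a factor
  \<open>r\<close> independent of \<open>z\<close> and \<open>t\<close>.\<close>

lemma rel_dominated:
  assumes v: "l v = 0" and w: "cong w v" "w \<noteq> v"
  obtains u1 u2 a b r where "\<not> cong u1 v" "\<not> cong u2 v" "1 \<le> a + b" "a + b \<le> D" "0 \<le> r" "r \<le> \<delta>"
    "\<And>z t. rel v w z t = r * (rel v u1 z t ^ a * rel v u2 z t ^ b)"
proof -
  obtain u1 u2 a b where u: "odd (k u1 - k v) \<or> odd (l u1)" "odd (k u2 - k v) \<or> odd (l u2)"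
        "1 \<le> a + b" "a + b \<le> D"
        and kk: "k w - k v = int a * (k u1 - k v) + int b * (k u2 - k v)" and ll: "l w = a * l u1 + b * l u2"
        and cc: "\<bar>c w / c v\<bar> \<le> \<delta> * \<bar>c u1 / c v\<bar> ^ a * \<bar>c u2 / c v\<bar> ^ b"
    using dominated[OF v, of w] w unfolding cong_def by blast
  define M where "M = \<bar>c u1 / c v\<bar> ^ a * \<bar>c u2 / c v\<bar> ^ b"
  have M: "M > 0" unfolding M_def using c_nz by (intro mult_pos_pos zero_less_power) auto
  define r where "r = \<bar>c w / c v\<bar> / M"
  have ex: "exp (of_int (k w - k v) * z)
      = exp (of_int (k u1 - k v) * z) ^ a * exp (of_int (k u2 - k v) * z) ^ b" for z :: real
    unfolding kk by (simp add: exp_of_nat_mult[symmetric] exp_add[symmetric] algebra_simps)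
  have "rel v w z t = r * (rel v u1 z t ^ a * rel v u2 z t ^ b)" for z t
  proof -
    have cw: "\<bar>c w / c v\<bar> = r * M" using M by (simp add: r_def)
    have distr: "(C1 * X1 * T1) ^ a * (C2 * X2 * T2) ^ b = (C1 ^ a * C2 ^ b) * (X1 ^ a * X2 ^ b) * (T1 ^ a * T2 ^ b)"
      for C1 C2 X1 X2 T1 T2 :: real
      by (simp only: power_mult_distrib ac_simps)
    have tw: "t ^ l w = (t ^ l u1) ^ a * (t ^ l u2) ^ b"
      unfolding ll by (simp add: power_add power_mult mult.commute flip: power_mult)
    show ?thesis
      unfolding rel_def distr ex cw M_def tw by (simp only: ac_simps)
  qed
  moreover have "\<bar>c w / c v\<bar> \<le> \<delta> * M"
    using cc by (simp only: M_def mult.assoc)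
  then have "r \<le> \<delta>" unfolding r_def using M by (simp only: pos_divide_le_eq)
  moreover have "0 \<le> r" using M unfolding r_def by simp
  ultimately show ?thesis using that u unfolding cong_def by blast
qed

text \<open>These serve three purposes: \<open>N\<close> grows at most half as fast as
  \<open>S\<close>; no other term congruent to \<open>v\<close> reaches the \<open>v\<close>-term at
  \<open>t = 0\<close> while \<open>S \<le> K\<close>; and \<open>sqrt \<delta>\<close> stays below
  \<open>1 / CARD('n)\<close>, which leaves room for \<theta> in
  \<open>dominating_points\<close>.\<close>

lemma \<delta>_small: "2 * real D * K ^ D * \<delta> * real CARD('n) \<le> 1 / 2"
    "real D * K ^ D * \<delta> * K < 1" "\<delta> * real CARD('n) ^ 2 < 1"
proof -
  let ?n = "real CARD('n)"
  have n: "?n \<ge> 2" using n2 by simp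
  define q where "q = real D * K ^ D * \<delta>"
  have q0: "q \<ge> 0" unfolding q_def using K_bounds \<delta> by simp
  have q: "4 * ?n * (q * K) \<le> 1" using \<delta>(2) by (simp add: q_def algebra_simps)
  have "q \<le> q * K" using K_bounds q0 by (simp add: mult_le_cancel_left1)
  then have "4 * ?n * q \<le> 1" using q n by (meson mult_left_mono order_trans mult_nonneg_nonneg of_nat_0_le_iff zero_le_numeral)
  then show "2 * real D * K ^ D * \<delta> * ?n \<le> 1 / 2" by (simp add: q_def algebra_simps)
  have "2 * (q * K) \<le> 4 * ?n * (q * K)" using n q0 K_bounds by (intro mult_right_mono) auto
  then have qK: "q * K < 1" using q by linarith
  then show "real D * K ^ D * \<delta> * K < 1" by (simp add: q_def)
  have "1 * 1 \<le> real D * K ^ D" using D K_bounds by (intro mult_mono) auto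
  then have "\<delta> \<le> q" unfolding q_def using \<delta>(1) mult_right_mono by fastforce
  then have "\<delta> * ?n ^ 2 \<le> q * K" using K_bounds q0 by (intro mult_mono) auto
  then show "\<delta> * ?n ^ 2 < 1" using qK by linarith
qed

text \<open>A congruent term is a small multiple of a monomial in two non-congruent terms. Each of
  these is at most \<open>S\<close>, hence at most \<open>K\<close>, and grows by no more than
  \<open>S\<close> does, so the Lipschitz bound applies.\<close>

lemma rel_cong_diff:
  assumes v: "l v = 0" and w: "cong w v" "w \<noteq> v" and t: "0 \<le> t" "t \<le> t'" and S: "S v z t' \<le> K"
  shows "rel v w z t' - rel v w z t \<le> real D * K ^ D * \<delta> * (S v z t' - S v z t)"
proof -
  obtain u1 u2 a b r where u: "\<not> cong u1 v" "\<not> cong u2 v" "1 \<le> a + b" "a + b \<le> D" "0 \<le> r" "r \<le> \<delta>"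
    and r: "\<And>z t. rel v w z t = r * (rel v u1 z t ^ a * rel v u2 z t ^ b)"
    using rel_dominated[OF v w] by metis
  have "rel v u1 z t' ^ a * rel v u2 z t' ^ b - rel v u1 z t ^ a * rel v u2 z t ^ b
      \<le> real D * K ^ D * (S v z t' - S v z t)"
    using u(1,2,4) t S K_bounds rel_le_S[of t' u1 v z] rel_le_S[of t' u2 v z]
    by (intro power_product_lipschitz rel_nonneg rel_mono rel_diff_le_S_diff) auto
  then have "r * (rel v u1 z t' ^ a * rel v u2 z t' ^ b - rel v u1 z t ^ a * rel v u2 z t ^ b)
      \<le> \<delta> * (real D * K ^ D * (S v z t' - S v z t))"
    using u(5,6) t \<delta>(1)
    by (rule_tac mult_mono) (auto simp: rel_nonneg rel_mono power_mono mult_mono)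
  then show ?thesis unfolding r by (simp add: algebra_simps)
qed

lemma rel_cong_le:
  assumes v: "l v = 0" and w: "cong w v" "w \<noteq> v" and t: "0 \<le> t" and S: "S v z t \<le> K"
  shows "rel v w z t \<le> real D * K ^ D * \<delta> * S v z t"
proof -
  obtain u1 u2 a b r where u: "\<not> cong u1 v" "\<not> cong u2 v" "1 \<le> a + b" "a + b \<le> D" "0 \<le> r" "r \<le> \<delta>"
    and r: "\<And>z t. rel v w z t = r * (rel v u1 z t ^ a * rel v u2 z t ^ b)"
    using rel_dominated[OF v w] by metis
  \<comment> \<open>The Lipschitz bound is taken from the point (0, 0), where the monomial vanishes
    because its degree \<open>a + b\<close> is positive.\<close>
  have "rel v u1 z t ^ a * rel v u2 z t ^ b - 0 ^ a * 0 ^ b \<le> real D * K ^ D * S v z t"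
    using u(1,2,4) t S K_bounds rel_le_S[of t u1 v z] rel_le_S[of t u2 v z]
    by (intro power_product_lipschitz rel_nonneg) auto
  moreover have "(0::real) ^ a * 0 ^ b = 0" using u(3) by (auto simp: power_0_left)
  ultimately have "r * (rel v u1 z t ^ a * rel v u2 z t ^ b) \<le> \<delta> * (real D * K ^ D * S v z t)"
    using u(5,6) t \<delta>(1) by (rule_tac mult_mono) (auto simp: rel_nonneg)
  then show ?thesis unfolding r by (simp add: algebra_simps)
qed

lemma card_cong_le: "real (card {i. cong i v \<and> i \<noteq> v}) \<le> real CARD('n)"
  by (simp add: card_mono)

lemma N_diff:
  assumes v: "l v = 0" and t: "0 \<le> t" "t \<le> t'" and S: "S v z t' \<le> K"
  shows "N v z t' - N v z t \<le> (S v z t' - S v z t) / 2"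
proof -
  have "N v z t' - N v z t = (\<Sum>i | cong i v \<and> i \<noteq> v. rel v i z t' - rel v i z t)"
    by (simp add: N_def sum_subtractf)
  also have "\<dots> \<le> (\<Sum>i | cong i v \<and> i \<noteq> v. real D * K ^ D * \<delta> * (S v z t' - S v z t))"
    using rel_cong_diff[OF v _ _ t S] by (intro sum_mono) auto
  also have "\<dots> = real (card {i. cong i v \<and> i \<noteq> v}) * (real D * K ^ D * \<delta>) * (S v z t' - S v z t)"
    by simp
  also have "\<dots> \<le> 1 / 2 * (S v z t' - S v z t)"
  proof (rule mult_right_mono)
    have 1: "0 \<le> real D * K ^ D * \<delta>" using K_bounds \<delta> by simp
    have "real (card {i. cong i v \<and> i \<noteq> v}) * (real D * K ^ D * \<delta>) \<le> real CARD('n) * (real D * K ^ D * \<delta>)"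
      using card_cong_le 1 by (rule mult_right_mono)
    also have "\<dots> \<le> 1 / 2" using \<delta>_small(1) 1 by (simp add: algebra_simps)
    finally show "real (card {i. cong i v \<and> i \<noteq> v}) * (real D * K ^ D * \<delta>) \<le> 1 / 2" .
  qed (use S_mono t in auto)
  finally show ?thesis by simp
qed

lemma N_le:
  assumes v: "l v = 0" and t: "0 \<le> t" and S: "S v z t \<le> K"
  shows "N v z t \<le> S v z t / 2"
proof -
  have "N v z t \<le> (\<Sum>i | cong i v \<and> i \<noteq> v. real D * K ^ D * \<delta> * S v z t)"
    unfolding N_def using rel_cong_le[OF v _ _ t S] by (intro sum_mono) auto
  also have "\<dots> = real (card {i. cong i v \<and> i \<noteq> v}) * (real D * K ^ D * \<delta>) * S v z t"
    by simp
  also have "\<dots> \<le> 1 / 2 * S v z t"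
  proof (rule mult_right_mono)
    have 1: "0 \<le> real D * K ^ D * \<delta>" using K_bounds \<delta> by simp
    have "real (card {i. cong i v \<and> i \<noteq> v}) * (real D * K ^ D * \<delta>) \<le> real CARD('n) * (real D * K ^ D * \<delta>)"
      using card_cong_le 1 by (rule mult_right_mono)
    also have "\<dots> \<le> 1 / 2" using \<delta>_small(1) 1 by (simp add: algebra_simps)
    finally show "real (card {i. cong i v \<and> i \<noteq> v}) * (real D * K ^ D * \<delta>) \<le> 1 / 2" .
  qed (use S_nonneg t in auto)
  finally show ?thesis by simp
qed

lemma S_strict_mono:
  assumes v: "l v = 0" and t: "0 \<le> t" "t < t'"
  shows "S v z t < S v z t'"
proof -
  obtain u where u: "l u > 0" "\<not> cong u v" using off_side[OF v] unfolding cong_def by blast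
  have "rel v u z t < rel v u z t'"
    unfolding rel_def using u(1) t c_nz by (intro mult_strict_left_mono power_strict_mono) auto
  then show ?thesis using rel_diff_le_S_diff[of t t' u v z] u t by simp
qed

text \<open>\<open>S\<close> grows strictly and \<open>N\<close> by at most half as much, a bound
  available as long as \<open>S\<close> stays at most \<open>K\<close>.\<close>

lemma \<phi>_strict_mono:
  assumes "l v = 0" "0 \<le> t" "t < t'" "S v z t' \<le> K"
  shows "S v z t - N v z t < S v z t' - N v z t'"
  using N_diff[of v t t' z] S_strict_mono[of v t t' z] assms by simp

lemma continuous_S: "continuous_on A (\<lambda>t. S v z t)" and continuous_N: "continuous_on A (\<lambda>t. N v z t)"
  unfolding S_def N_def rel_def by (intro continuous_intros)+

text \<open>An off-side term makes \<open>S\<close> unbounded, so \<open>S\<close> attains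
  \<open>K\<close> at some \<open>r\<close>. There \<open>N \<le> S / 2\<close> leaves
  \<open>S - N\<close> above 1, so the value 1 is attained on the way to \<open>r\<close>, where
  \<open>S\<close> is still at most \<open>K\<close>.\<close>

lemma ex_root:
  assumes v: "l v = 0" and 0: "S v z 0 \<le> K" "S v z 0 - N v z 0 \<le> 1"
  shows "\<exists>t\<ge>0. S v z t \<le> K \<and> S v z t - N v z t = 1"
proof -
  obtain u where u: "l u > 0" "\<not> cong u v" using off_side[OF v] unfolding cong_def by blast
  define C where "C = \<bar>c u / c v\<bar> * exp (of_int (k u - k v) * z)"
  have C: "C > 0" unfolding C_def using c_nz by simp
  \<comment> \<open>Large enough for \<open>C * s \<ge> K\<close>, while \<open>s \<ge> 1\<close>
    makes \<open>s ^ l u\<close> at least \<open>s\<close>.\<close>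
  define s where "s = max 1 (K / C)"
  have s: "s \<ge> 1" "K \<le> C * s" using C by (auto simp: s_def field_simps max_def)
  have "s \<le> s ^ l u" using s u by (metis power_increasing power_one_right Suc_leI One_nat_def)
  then have "C * s \<le> C * s ^ l u" using C by simp
  then have "K \<le> S v z s" using rel_le_S[of s u v z] u s by (simp add: rel_def C_def)
  then obtain r where r: "0 \<le> r" "S v z r = K"
    using IVT'[of "S v z" 0 K s] 0 s continuous_S by auto
  have "S v z r - N v z r \<ge> 1" using N_le[OF v r(1), of z] r K_bounds by simp
  then obtain t where t: "0 \<le> t" "t \<le> r" "S v z t - N v z t = 1"
    using IVT'[of "\<lambda>t. S v z t - N v z t" 0 1 r] 0 r
      continuous_on_diff[OF continuous_S continuous_N] by auto
  then show ?thesis using S_mono[of t r v z] r by auto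
qed

section \<open>Signs of \<open>G\<close> on a half-plane and its bounded root over each
  \<open>z\<close>\<close>

lemma \<sigma>_cases: "\<sigma> v = 1 \<or> \<sigma> v = -1" by (simp add: \<sigma>_def)

text \<open>A case distinction on parities: the sign rule for \<open>c\<close> and the choice of
  \<open>\<sigma> v\<close> make the quotient of a term by the \<open>v\<close>-term equal to
  \<open>rel v i z t\<close> for \<open>i\<close> congruent to \<open>v\<close> and to its negative
  otherwise.\<close>

lemma G_eq:
  assumes v: "l v = 0"
  shows "G z (\<sigma> v * t) = c v * exp (of_int (k v) * z) * (1 + N v z t - S v z t)"
proof -
  have term_eq: "c i * exp (of_int (k i) * z) * (\<sigma> v * t) ^ l i
      = c v * exp (of_int (k v) * z) * (if cong i v then rel v i z t else - rel v i z t)" for i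
  proof -
    have "c i * \<sigma> v ^ l i = c v * (if cong i v then \<bar>c i / c v\<bar> else - \<bar>c i / c v\<bar>)"
      using c_neg[of i] c_pos[of i] c_neg[of v] c_pos[of v] v
      by (cases "odd (k i)"; cases "odd (l i)"; cases "odd (k v)")
        (auto simp: \<sigma>_def cong_def abs_if divide_less_0_iff)
    moreover have "exp (of_int (k i) * z) = exp (of_int (k v) * z) * exp (of_int (k i - k v) * z)"
      by (simp add: exp_add[symmetric] algebra_simps)
    ultimately have "c i * exp (of_int (k i) * z) * (\<sigma> v * t) ^ l i
        = (c v * (if cong i v then \<bar>c i / c v\<bar> else - \<bar>c i / c v\<bar>))
          * (exp (of_int (k v) * z) * exp (of_int (k i - k v) * z)) * t ^ l i"
    proof -
      assume 1: "c i * \<sigma> v ^ l i = c v * (if cong i v then \<bar>c i / c v\<bar> else - \<bar>c i / c v\<bar>)"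
        and 2: "exp (of_int (k i) * z) = exp (of_int (k v) * z) * exp (of_int (k i - k v) * z)"
      have "c i * exp (of_int (k i) * z) * (\<sigma> v * t) ^ l i
        = (c i * \<sigma> v ^ l i) * exp (of_int (k i) * z) * t ^ l i"
        by (simp only: power_mult_distrib ac_simps)
      then show ?thesis unfolding 1 2 .
    qed
    then show ?thesis unfolding rel_def by (cases "cong i v") (simp_all only: if_True if_False mult_minus_left mult_minus_right ac_simps)
  qed
  have "G z (\<sigma> v * t) = c v * exp (of_int (k v) * z) * (\<Sum>i\<in>UNIV. if cong i v then rel v i z t else - rel v i z t)"
    unfolding G_def term_eq by (simp add: sum_distrib_left)
  also have "(\<Sum>i\<in>UNIV. if cong i v then rel v i z t else - rel v i z t)
      = (\<Sum>i | cong i v. rel v i z t) - S v z t"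
    by (simp add: sum.If_cases S_def sum_negf Collect_neg_eq)
  also have "{i. cong i v} = insert v {i. cong i v \<and> i \<noteq> v}" using v by (auto simp: cong_def)
  also have "(\<Sum>i\<in>insert v {i. cong i v \<and> i \<noteq> v}. rel v i z t) = 1 + N v z t"
    using v c_nz by (subst sum.insert) (auto simp: N_def rel_def)
  finally show ?thesis .
qed

lemma sgn_c: "l v = 0 \<Longrightarrow> sgn (c v) = - \<sigma> v"
  using c_neg[of v] c_pos[of v] by (auto simp: \<sigma>_def)

text \<open>The \<open>v\<close>-coefficient has the sign \<open>- \<sigma> v\<close>, so the sign
  of \<open>G\<close> at a point of the half-plane tells on which side of 1 the quantity
  \<open>S - N\<close> lies.\<close>

lemma \<phi>_le_iff:
  assumes v: "l v = 0"
  shows "S v z t - N v z t \<le> 1 \<longleftrightarrow> \<sigma> v * G z (\<sigma> v * t) \<le> 0"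
    and "S v z t - N v z t = 1 \<longleftrightarrow> G z (\<sigma> v * t) = 0"
proof -
  have "\<sigma> v * G z (\<sigma> v * t) = - (\<bar>c v\<bar> * exp (of_int (k v) * z)) * (1 + N v z t - S v z t)"
    unfolding G_eq[OF v] using sgn_c[OF v] abs_sgn[of "c v"] by (simp add: algebra_simps)
  moreover have "\<bar>c v\<bar> * exp (of_int (k v) * z) > 0" using c_nz by simp
  ultimately show "S v z t - N v z t \<le> 1 \<longleftrightarrow> \<sigma> v * G z (\<sigma> v * t) \<le> 0"
    by (simp add: mult_le_0_iff zero_le_mult_iff) (auto simp: algebra_simps)
  show "S v z t - N v z t = 1 \<longleftrightarrow> G z (\<sigma> v * t) = 0"
    unfolding G_eq[OF v] using c_nz by auto
qed

text \<open>The base term \<open>v\<close>, and with it the half-plane, is left free, since the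
  branch crosses the axis and its dominant side term changes with \<open>z\<close>. The bound by
  \<open>K\<close> discards roots of \<open>G z\<close> on other parts of the curve.\<close>

definition curve_pt :: "real \<Rightarrow> real \<Rightarrow> bool" where
  "curve_pt z y \<longleftrightarrow> (\<exists>v t. l v = 0 \<and> t \<ge> 0 \<and> y = \<sigma> v * t \<and> S v z t \<le> K \<and> G z y = 0)"

text \<open>For a side point, this is the size of its term at \<open>y = 0\<close>.\<close>

definition T :: "real \<Rightarrow> 'n \<Rightarrow> real" where
  "T z i = \<bar>c i\<bar> * exp (of_int (k i) * z)"

lemma T_pos: "T z i > 0"
  using c_nz by (simp add: T_def)

lemma rel_0: "rel v i z 0 = (if l i = 0 then T z i / T z v else 0)"
  unfolding rel_def T_def using c_nz by (auto simp: exp_diff left_diff_distrib abs_divide)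

lemma S_0_le:
  assumes "\<And>i. l i = 0 \<Longrightarrow> T z i \<le> M * T z v" "M \<ge> 0"
  shows "S v z 0 \<le> real CARD('n) * M"
proof -
  have "S v z 0 \<le> (\<Sum>i | \<not> cong i v. M)"
    unfolding S_def using assms T_pos by (intro sum_mono) (auto simp: rel_0 pos_divide_le_eq)
  also have "\<dots> \<le> real CARD('n) * M"
    using assms(2) by (auto intro!: mult_right_mono card_mono)
  finally show ?thesis .
qed

lemma ex_dominant: "\<exists>v. l v = 0 \<and> S v z 0 \<le> real CARD('n) \<and> (\<forall>i. l i = 0 \<longrightarrow> T z i \<le> T z v)"
proof -
  have ne: "{i. l i = 0} \<noteq> {}" using ev(2)[of 0] by auto
  then have "Max (T z ` {i. l i = 0}) \<in> T z ` {i. l i = 0}" by (intro Max_in) auto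
  then obtain v where "l v = 0" "T z v = Max (T z ` {i. l i = 0})" by auto
  then have v: "l v = 0" "\<And>i. l i = 0 \<Longrightarrow> T z i \<le> T z v" by auto
  then show ?thesis using S_0_le[of z 1 v] by auto
qed

lemma card_le_K: "real CARD('n) \<le> K"
proof -
  have "real CARD('n) \<le> real CARD('n) ^ 2" using n2 by (intro self_le_power) auto
  then show ?thesis using K_bounds(3) by linarith
qed

lemma \<sigma>_not_cong: "l v = 0 \<Longrightarrow> l u = 0 \<Longrightarrow> \<not> cong u v \<Longrightarrow> \<sigma> u = - \<sigma> v"
  by (auto simp: cong_def \<sigma>_def)

text \<open>If the root is not on the side of the largest side term, it is on the side of a comparable term of
  the other parity.\<close>

lemma ex_curve_pt: "\<exists>y. curve_pt z y"
proof -
  let ?n = "real CARD('n)"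
  have n: "?n > 0" by simp
  obtain v where v: "l v = 0" "S v z 0 \<le> ?n" and Tv: "\<And>i. l i = 0 \<Longrightarrow> T z i \<le> T z v"
    using ex_dominant by blast
  obtain u where u: "l u = 0" "S u z 0 \<le> K" "S u z 0 - N u z 0 \<le> 1"
  proof (cases "S v z 0 - N v z 0 \<le> 1")
    case True
    then show ?thesis using that v card_le_K by (meson order_trans)
  next
    case False
    \<comment> \<open>Failure for \<open>v\<close> means \<open>S v z 0 > 1\<close>, so one of its
      at most \<open>CARD('n)\<close> summands reaches \<open>1 / CARD('n)\<close>. Being nonzero at
      \<open>t = 0\<close>, it belongs to the side.\<close>
    have "\<exists>u. \<not> cong u v \<and> rel v u z 0 \<ge> 1 / ?n"
    proof (rule ccontr)
      assume a: "\<not> ?thesis"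
      have "S v z 0 \<le> (\<Sum>i | \<not> cong i v. 1 / ?n)"
        unfolding S_def using a by (intro sum_mono) (auto simp: not_le intro: less_imp_le)
      also have "\<dots> \<le> 1" by (simp add: card_mono)
      finally show False using False N_nonneg[of 0 v z] by simp
    qed
    then obtain u where u: "\<not> cong u v" "rel v u z 0 \<ge> 1 / ?n" by blast
    have lu: "l u = 0"
    proof (rule ccontr)
      assume "l u \<noteq> 0"
      then show False using u(2) n by (simp add: rel_0)
    qed
    have Tu: "T z v \<le> ?n * T z u"
      using u(2) lu T_pos[of z v] n by (simp add: rel_0 field_simps)
    \<comment> \<open>Every side term is at most the \<open>v\<close>-term, which is at most
      \<open>CARD('n)\<close> times the \<open>u\<close>-term; hence the square in
      \<open>K\<close>.\<close>
    have "S u z 0 \<le> ?n * ?n"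
      by (rule S_0_le) (use Tv Tu in \<open>auto intro: order_trans\<close>)
    then have Su: "S u z 0 \<le> K" using K_bounds(3) by (simp add: power2_eq_square)
    \<comment> \<open>Since \<open>\<sigma> u = - \<sigma> v\<close>, the sign of
      \<open>G z 0\<close> that is wrong for \<open>v\<close> is right for \<open>u\<close>.\<close>
    have "\<sigma> v * G z 0 > 0" using False \<phi>_le_iff(1)[OF v(1), of z 0] by simp
    then have "\<sigma> u * G z 0 \<le> 0" using \<sigma>_not_cong[OF v(1) lu u(1)] by simp
    then have "S u z 0 - N u z 0 \<le> 1" using \<phi>_le_iff(1)[OF lu, of z 0] by simp
    then show ?thesis using that lu Su by blast
  qed
  then obtain t where "t \<ge> 0" "S u z t \<le> K" "S u z t - N u z t = 1"
    using ex_root[OF u] by blast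
  then have "curve_pt z (\<sigma> u * t)" unfolding curve_pt_def using u(1) \<phi>_le_iff(2)[OF u(1), of z t] by blast
  then show ?thesis by blast
qed

lemma curve_pt_zero: "G z 0 = 0 \<Longrightarrow> curve_pt z 0"
proof -
  assume G: "G z 0 = 0"
  obtain v where v: "l v = 0" "S v z 0 \<le> real CARD('n)" using ex_dominant by blast
  then show ?thesis unfolding curve_pt_def using G card_le_K
    by (intro exI[of _ v] exI[of _ 0]) auto
qed

lemma \<phi>_root_unique:
  assumes "l v = 0" "0 \<le> t" "S v z t \<le> K" "S v z t - N v z t = 1"
    and "0 \<le> t'" "S v z t' \<le> K" "S v z t' - N v z t' = 1"
  shows "t = t'"
  using \<phi>_strict_mono[of v t t' z] \<phi>_strict_mono[of v t' t z] assms by (cases t t' rule: linorder_cases) auto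

text \<open>Roots with the same \<open>v\<close> coincide by monotonicity. If \<open>v\<close> and
  \<open>v'\<close> are distinct but congruent, each of their terms would be strictly smaller than
  the other at \<open>y = 0\<close>. If they are not congruent, the roots lie in opposite closed
  half-planes and impose opposite weak signs on \<open>G z 0\<close>; so \<open>G z 0 = 0\<close>
  and both roots are 0.\<close>

lemma curve_pt_unique:
  assumes "curve_pt z y" "curve_pt z y'"
  shows "y = y'"
proof -
  obtain v t where v: "l v = 0" "t \<ge> 0" "y = \<sigma> v * t" "S v z t \<le> K" "G z y = 0"
    using assms(1) unfolding curve_pt_def by blast
  obtain v' t' where v': "l v' = 0" "t' \<ge> 0" "y' = \<sigma> v' * t'" "S v' z t' \<le> K" "G z y' = 0"
    using assms(2) unfolding curve_pt_def by blast
  have \<phi>: "S v z t - N v z t = 1" "S v' z t' - N v' z t' = 1"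
    using \<phi>_le_iff(2) v v' by auto
  have S0: "S v z 0 \<le> K" "S v' z 0 \<le> K"
    using S_mono[of 0 t v z] S_mono[of 0 t' v' z] v v' by auto
  consider "v = v'" | "v \<noteq> v'" "cong v' v" | "\<not> cong v' v" by blast
  then show ?thesis
  proof cases
    case 1
    then show ?thesis using \<phi>_root_unique[of v t z t'] v v' \<phi> by simp
  next
    case 2
    have *: "rel v w z 0 < 1" if "l v = 0" "cong w v" "w \<noteq> v" "S v z 0 \<le> K" for v w
    proof -
      have "rel v w z 0 \<le> real D * K ^ D * \<delta> * S v z 0"
        using rel_cong_le[of v w 0 z] that by simp
      also have "\<dots> \<le> real D * K ^ D * \<delta> * K"
        using that K_bounds \<delta> by (intro mult_left_mono) auto
      finally show ?thesis using \<delta>_small(2) by linarith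
    qed
    have "cong v v'" using 2 v v' by (auto simp: cong_def)
    then have "rel v v' z 0 < 1" "rel v' v z 0 < 1" using * 2 v v' S0 by blast+
    then have "T z v' < T z v" "T z v < T z v'"
      using v v' T_pos[of z v] T_pos[of z v'] by (auto simp: rel_0)
    then show ?thesis by simp
  next
    case 3
    have le: "S w z 0 - N w z 0 \<le> 1" if "l w = 0" "0 \<le> r" "S w z r \<le> K" "S w z r - N w z r = 1" for w r
      using \<phi>_strict_mono[of w 0 r z] that by (cases "r = 0") auto
    have "\<sigma> v * G z 0 \<le> 0" "\<sigma> v' * G z 0 \<le> 0"
      using le[OF v(1,2,4) \<phi>(1)] le[OF v'(1,2,4) \<phi>(2)] \<phi>_le_iff(1)[OF v(1), of z 0]
        \<phi>_le_iff(1)[OF v'(1), of z 0] by auto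
    then have "G z 0 = 0"
      using \<sigma>_not_cong[OF v(1) v'(1) 3] \<sigma>_cases[of v] by auto
    then have "S v z 0 - N v z 0 = 1" "S v' z 0 - N v' z 0 = 1"
      using \<phi>_le_iff(2)[OF v(1), of z 0] \<phi>_le_iff(2)[OF v'(1), of z 0] by auto
    then have "t = 0" "t' = 0"
      using \<phi>_root_unique[of v 0 z t] \<phi>_root_unique[of v' 0 z t'] v v' \<phi> S0 by auto
    then show ?thesis using v v' by simp
  qed
qed

section \<open>The branch as a continuous graph\<close>

definition yf :: "real \<Rightarrow> real" where
  "yf z = (THE y. curve_pt z y)"

lemma yf_eqI: "curve_pt z y \<Longrightarrow> yf z = y"
  unfolding yf_def using curve_pt_unique by blast

lemma curve_pt_yf: "curve_pt z (yf z)"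
  using ex_curve_pt yf_eqI by metis

lemma curve_pt_iff: "curve_pt z y \<longleftrightarrow> y = yf z"
  using yf_eqI curve_pt_yf by blast

lemma G_yf: "G z (yf z) = 0"
  using curve_pt_yf[of z] unfolding curve_pt_def by blast

lemma yf_zero_iff: "yf z = 0 \<longleftrightarrow> G z 0 = 0"
  using curve_pt_zero curve_pt_iff G_yf by metis

lemma yf_eq: "l v = 0 \<Longrightarrow> t \<ge> 0 \<Longrightarrow> S v z t \<le> K \<Longrightarrow> G z (\<sigma> v * t) = 0 \<Longrightarrow> yf z = \<sigma> v * t"
  by (rule yf_eqI) (auto simp: curve_pt_def)

text \<open>There are finitely many base terms and each contributes a closed set, because
  \<open>t\<close> is recovered from \<open>y\<close> as \<open>\<sigma> v * y\<close>. With local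
  boundedness this yields continuity of \<open>yf\<close> by the closed graph theorem.\<close>

lemma closed_curve: "closed {(z, y). curve_pt z y}"
proof -
  have eq: "{(z, y). curve_pt z y} = (\<Union>v\<in>{v. l v = 0}.
      {p. \<sigma> v * snd p \<ge> 0} \<inter> {p. S v (fst p) (\<sigma> v * snd p) \<le> K} \<inter> {p. G (fst p) (snd p) = 0})"
    (is "?L = ?R")
  proof (intro equalityI subsetI)
    fix p assume "p \<in> ?L"
    then obtain v t where v: "l v = 0" "t \<ge> 0" "snd p = \<sigma> v * t" "S v (fst p) t \<le> K" "G (fst p) (snd p) = 0"
      unfolding curve_pt_def by auto
    have "\<sigma> v * snd p = t" using v(3) \<sigma>_cases[of v] by auto
    then have "\<sigma> v * snd p \<ge> 0 \<and> S v (fst p) (\<sigma> v * snd p) \<le> K" using v(2,4) by simp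
    then show "p \<in> ?R" using v(1,5) by blast
  next
    fix p assume "p \<in> ?R"
    then obtain v where v: "l v = 0" "\<sigma> v * snd p \<ge> 0" "S v (fst p) (\<sigma> v * snd p) \<le> K" "G (fst p) (snd p) = 0"
      by auto
    moreover have "snd p = \<sigma> v * (\<sigma> v * snd p)" using \<sigma>_cases[of v] by auto
    ultimately show "p \<in> ?L" unfolding curve_pt_def by force
  qed
  show ?thesis unfolding eq S_def G_def rel_def
    by (intro closed_UN ballI closed_Int closed_Collect_le closed_Collect_eq continuous_intros) auto
qed

text \<open>For \<open>\<bar>z\<bar> \<le> R\<close> some non-congruent off-side term has its factor
  in front of the power of \<open>t\<close> bounded below, so it grows at least linearly for
  \<open>t \<ge> 1\<close>; but it cannot exceed \<open>K\<close>.\<close>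

lemma yf_bounded: "\<exists>M. \<forall>z. \<bar>z\<bar> \<le> R \<longrightarrow> \<bar>yf z\<bar> \<le> M"
proof -
  have "\<exists>M. \<forall>z t. \<bar>z\<bar> \<le> R \<longrightarrow> 0 \<le> t \<longrightarrow> S v z t \<le> K \<longrightarrow> t \<le> M" if v: "l v = 0" for v
  proof -
    obtain u where u: "l u > 0" "\<not> cong u v" using off_side[OF v] unfolding cong_def by blast
    define C where "C = \<bar>c u / c v\<bar> * exp (- (\<bar>of_int (k u - k v)\<bar> * R))"
    have C: "C > 0" unfolding C_def using c_nz by simp
    have "t \<le> max 1 (K / C)" if z: "\<bar>z\<bar> \<le> R" and t: "0 \<le> t" and S: "S v z t \<le> K" for z t
    proof (rule ccontr)
      assume a: "\<not> ?thesis"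
      then have t1: "t \<ge> 1" "K / C < t" by auto
      then have "K < C * t" using C by (simp add: pos_divide_less_eq mult.commute)
      have "\<bar>of_int (k u - k v) * z\<bar> \<le> \<bar>of_int (k u - k v)\<bar> * R"
        unfolding abs_mult using z by (intro mult_left_mono) auto
      then have "C \<le> \<bar>c u / c v\<bar> * exp (of_int (k u - k v) * z)"
        unfolding C_def by (intro mult_left_mono) auto
      moreover have "t \<le> t ^ l u" using t1 u by (intro self_le_power) auto
      ultimately have "C * t \<le> rel v u z t"
        unfolding rel_def using C t1 by (intro mult_mono) auto
      then show False using rel_le_S[OF t u(2), of z] S \<open>K < C * t\<close> by linarith
    qed
    then show ?thesis by blast
  qed
  then obtain M where M: "\<And>v z t. l v = 0 \<Longrightarrow> \<bar>z\<bar> \<le> R \<Longrightarrow> 0 \<le> t \<Longrightarrow> S v z t \<le> K \<Longrightarrow> t \<le> M v"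
    by metis
  have "\<bar>yf z\<bar> \<le> Max (range M)" if z: "\<bar>z\<bar> \<le> R" for z
  proof -
    obtain v t where v: "l v = 0" "t \<ge> 0" "yf z = \<sigma> v * t" "S v z t \<le> K"
      using curve_pt_yf[of z] unfolding curve_pt_def by blast
    then have "\<bar>yf z\<bar> \<le> M v" using M[of v z t] z \<sigma>_cases[of v] by auto
    also have "\<dots> \<le> Max (range M)" by (intro Max_ge) auto
    finally show ?thesis .
  qed
  then show ?thesis by blast
qed

lemma continuous_yf: "continuous_on UNIV yf"
proof -
  have "isCont yf x" for x
  proof -
    define R where "R = \<bar>x\<bar> + 1"
    obtain M where M: "\<And>z. \<bar>z\<bar> \<le> R \<Longrightarrow> \<bar>yf z\<bar> \<le> M" using yf_bounded by blast
    have "continuous_on {-R..R} yf"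
    proof (rule continuous_from_closed_graph[of "{-M..M}"])
      show "yf \<in> {-R..R} \<rightarrow> {-M..M}"
      proof
        fix z assume "z \<in> {-R..R}"
        then have "\<bar>yf z\<bar> \<le> M" by (intro M) auto
        then show "yf z \<in> {-M..M}" by auto
      qed
      have "(\<lambda>x. (x, yf x)) ` {-R..R} = {(z, y). curve_pt z y} \<inter> {-R..R} \<times> UNIV"
        by (auto simp: curve_pt_iff)
      then show "closed ((\<lambda>x. (x, yf x)) ` {-R..R})"
        using closed_curve by (auto intro!: closed_Int closed_Times)
    qed auto
    then have "continuous_on {-R<..<R} yf" by (rule continuous_on_subset) auto
    then show ?thesis by (rule continuous_on_interior) (auto simp: R_def)
  qed
  then show ?thesis by (simp add: continuous_on_eq_continuous_at)
qed

section \<open>Crossings with the axis: roots of the side polynomial\<close>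

lemma edge_sum: "(\<Sum>i | l i = 0. f i) = (\<Sum>j\<le>d. f (ev j))"
proof -
  have "inj_on ev {..d}" using ev(1) by (metis atMost_iff inj_onI of_nat_eq_iff)
  moreover have "{i. l i = 0} = ev ` {..d}" using ev(2,3) by auto
  ultimately show ?thesis by (simp add: sum.reindex)
qed

lemma G_0: "G z 0 = (\<Sum>j\<le>d. c (ev j) * exp z ^ j)"
proof -
  have "G z 0 = (\<Sum>i | l i = 0. c i * exp (of_int (k i) * z))"
    unfolding G_def by (rule sum.mono_neutral_cong_right) auto
  also have "\<dots> = (\<Sum>j\<le>d. c (ev j) * exp z ^ j)"
    unfolding edge_sum using ev(1) by (intro sum.cong) (auto simp: exp_of_nat_mult)
  finally show ?thesis .
qed

text \<open>The coefficients on the side alternate in sign, so for \<open>x \<le> 0\<close> no term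
  is negative and the constant one is not zero: every real root is positive and hence of the form
  \<open>exp z\<close>.\<close>

lemma edge_poly_root:
  assumes "(\<Sum>j\<le>d. c (ev j) * x ^ j) = 0"
  shows "\<exists>z. x = exp z \<and> yf z = 0"
proof -
  have "x > 0"
  proof (rule ccontr)
    assume "\<not> x > 0"
    then have x: "x \<le> 0" by simp
    have "c (ev j) * x ^ j \<ge> 0" if "j \<le> d" for j
    proof (cases "even j")
      case True
      then show ?thesis using c_pos[of "ev j"] ev that by (simp add: zero_le_even_power less_imp_le)
    next
      case False
      then have "c (ev j) < 0" "x ^ j \<le> 0"
        using c_neg[of "ev j"] ev that x by (auto simp: power_le_zero_eq odd_pos)
      then show ?thesis by (simp add: mult_nonpos_nonpos)
    qed
    then have "\<forall>j\<in>{..d}. c (ev j) * x ^ j = 0"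
      using assms by (subst (asm) sum_nonneg_eq_0_iff) auto
    then have "c (ev 0) * x ^ 0 = 0" by blast
    then show False using c_nz by simp
  qed
  then have "x = exp (ln x)" by simp
  then show ?thesis using assms yf_zero_iff G_0 by metis
qed

lemma finite_zeros: "finite {z. yf z = 0}" and card_zeros_le: "card {z. yf z = 0} \<le> d"
proof -
  let ?A = "{x. (\<Sum>j\<le>d. c (ev j) * x ^ j) = 0}"
  have A: "finite ?A" "card ?A \<le> d"
    using polyfun_roots_finite[of "\<lambda>j. c (ev j)" 0 d] polyfun_roots_card[of "\<lambda>j. c (ev j)" 0 d] c_nz by auto
  have inj: "inj_on exp {z. yf z = 0}" by (auto simp: inj_on_def)
  have sub: "exp ` {z. yf z = 0} \<subseteq> ?A" by (auto simp: yf_zero_iff G_0)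
  show "finite {z. yf z = 0}" using inj sub A(1) by (meson finite_subset finite_imageD)
  show "card {z. yf z = 0} \<le> d"
    using card_inj_on_le[OF inj sub A(1)] A(2) by simp
qed

lemma dominating_points:
  obtains zs where "\<And>j. j < d \<Longrightarrow> zs j < zs (Suc j)" "\<And>j. j \<le> d \<Longrightarrow> S (ev j) (zs j) 0 < 1"
proof -
  let ?n = "real CARD('n)"
  have n: "?n > 1" using n2 by simp
  have "sqrt \<delta> < 1 / ?n"
  proof (rule real_less_lsqrt)
    show "\<delta> < (1 / ?n) ^ 2" using \<delta>_small(3) n by (simp add: power_divide field_simps)
  qed (use n in auto)
  \<comment> \<open>\<theta> has to lie above \<open>sqrt \<delta>\<close> for the log-concavity
    hypothesis and below \<open>1 / CARD('n)\<close> for a sum of at most \<open>CARD('n)\<close>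
    such ratios to stay below 1.\<close>
  then obtain \<theta> where \<theta>: "sqrt \<delta> < \<theta>" "\<theta> < 1 / ?n" using dense by blast
  have \<theta>0: "\<theta> > 0" using \<theta>(1) \<delta>(1) real_sqrt_ge_zero by (meson le_less_trans)
  have \<delta>\<theta>: "\<delta> \<le> \<theta> ^ 2" using \<theta>(1) \<theta>0 by (intro sqrt_le_D) auto
  have n\<theta>: "?n * \<theta> < 1" using \<theta>(2) n by (simp add: field_simps)
  moreover have "\<theta> \<le> ?n * \<theta>" using n \<theta>0 by (simp add: mult_le_cancel_right1)
  ultimately have \<theta>1: "\<theta> < 1" by linarith
  obtain x where x: "\<And>j. j \<le> d \<Longrightarrow> x j > 0" "\<And>j. j < d \<Longrightarrow> x j < x (Suc j)"
      "\<And>i j. i \<le> d \<Longrightarrow> j \<le> d \<Longrightarrow> i \<noteq> j \<Longrightarrow> \<bar>c (ev i)\<bar> * x j ^ i \<le> \<theta> * (\<bar>c (ev j)\<bar> * x j ^ j)"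
  proof (rule log_concave_dominating_points[of d "\<lambda>j. \<bar>c (ev j)\<bar>" \<theta>])
    fix j assume j: "j + 2 \<le> d"
    have "\<bar>c (ev j)\<bar> * \<bar>c (ev (j + 2))\<bar> \<le> \<delta> * c (ev (j + 1)) ^ 2" using edge_dominated[OF j] .
    also have "\<dots> \<le> \<theta> ^ 2 * c (ev (j + 1)) ^ 2" using \<delta>\<theta> by (intro mult_right_mono) auto
    finally show "\<bar>c (ev j)\<bar> * \<bar>c (ev (j + 2))\<bar> \<le> \<theta> ^ 2 * \<bar>c (ev (j + 1))\<bar> ^ 2" by simp
  qed (use c_nz d \<theta>0 \<theta>1 in auto)
  define zs where "zs j = ln (x j)" for j
  have ex: "exp (zs j) = x j" if "j \<le> d" for j using x(1) that by (simp add: zs_def)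
  have "S (ev j) (zs j) 0 < 1" if j: "j \<le> d" for j
  proof -
    have T: "T (zs j) (ev i) = \<bar>c (ev i)\<bar> * x j ^ i" if "i \<le> d" for i
      using ev(1) that j by (simp add: T_def exp_of_nat_mult ex)
    have "S (ev j) (zs j) 0 \<le> (\<Sum>i | \<not> cong i (ev j). \<theta>)"
      unfolding S_def
    proof (rule sum_mono)
      fix i assume i: "i \<in> {i. \<not> cong i (ev j)}"
      show "rel (ev j) i (zs j) 0 \<le> \<theta>"
      proof (cases "l i = 0")
        case True
        then obtain m where m: "m \<le> d" "i = ev m" using ev(3) by blast
        then have "m \<noteq> j" using i True by (auto simp: cong_def)
        then have "T (zs j) i \<le> \<theta> * T (zs j) (ev j)" using x(3) m j T by auto
        then show ?thesis using True T_pos[of "zs j" "ev j"] by (simp add: rel_0 pos_divide_le_eq)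
      qed (use \<theta>0 in \<open>simp add: rel_0\<close>)
    qed
    also have "\<dots> \<le> ?n * \<theta>" using \<theta>0 by (auto intro!: mult_right_mono card_mono)
    finally show ?thesis using n\<theta> by linarith
  qed
  moreover have "zs j < zs (Suc j)" if "j < d" for j
    using x(1)[of j] x(1)[of "Suc j"] x(2)[of j] that by (simp add: zs_def)
  ultimately show ?thesis using that by blast
qed

text \<open>Where the \<open>j\<close>-th side term dominates, \<open>G z 0\<close> has the sign of
  \<open>c (ev j)\<close>. These signs alternate, so a zero lies strictly between consecutive
  dominating points, which gives \<open>d\<close> of them; the degree gives the other
  inequality.\<close>

lemma card_zeros: "card {z. yf z = 0} = d"
proof (rule antisym[OF card_zeros_le])
  obtain zs where zs: "\<And>j. j < d \<Longrightarrow> zs j < zs (Suc j)" "\<And>j. j \<le> d \<Longrightarrow> S (ev j) (zs j) 0 < 1"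
    by (rule dominating_points) blast
  have sg: "\<sigma> (ev j) * G (zs j) 0 < 0" if "j \<le> d" for j
  proof -
    have lt: "S (ev j) (zs j) 0 - N (ev j) (zs j) 0 < 1"
      using zs(2)[OF that] N_nonneg[of 0 "ev j" "zs j"] by simp
    then have "\<sigma> (ev j) * G (zs j) 0 \<le> 0"
      using \<phi>_le_iff(1)[of "ev j" "zs j" 0, OF ev(2)[OF that]] by simp
    moreover have "G (zs j) 0 \<noteq> 0"
      using lt \<phi>_le_iff(2)[of "ev j" "zs j" 0, OF ev(2)[OF that]] by simp
    moreover have "\<sigma> (ev j) \<noteq> 0" using \<sigma>_cases[of "ev j"] by auto
    ultimately show ?thesis by (metis less_eq_real_def mult_eq_0_iff)
  qed
  have "\<exists>r. zs j < r \<and> r < zs (Suc j) \<and> G r 0 = 0" if j: "j < d" for j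
  proof -
    have cont: "continuous_on {zs j..zs (Suc j)} (\<lambda>z. G z 0)"
      unfolding G_0 by (intro continuous_intros)
    have opp: "\<sigma> (ev (Suc j)) = - \<sigma> (ev j)"
      unfolding \<sigma>_def ev(1)[OF Suc_leI[OF j]] ev(1)[OF less_imp_le[OF j]] by simp
    have sg1: "\<sigma> (ev j) * G (zs j) 0 < 0" "\<sigma> (ev j) * G (zs (Suc j)) 0 > 0"
      using sg[OF less_imp_le[OF j]] sg[OF Suc_leI[OF j]] opp by simp_all
    have le: "zs j \<le> zs (Suc j)" using zs(1)[OF j] by simp
    have "\<exists>r\<ge>zs j. r \<le> zs (Suc j) \<and> G r 0 = 0"
    proof (cases "\<sigma> (ev j) = 1")
      case True
      then have "G (zs j) 0 \<le> 0" "0 \<le> G (zs (Suc j)) 0" using sg1 by simp_all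
      then show ?thesis using IVT'[OF _ _ le cont] by blast
    next
      case False
      then have "\<sigma> (ev j) = -1" using \<sigma>_cases by blast
      then have "G (zs (Suc j)) 0 \<le> 0" "0 \<le> G (zs j) 0" using sg1 by simp_all
      then show ?thesis using IVT2'[OF _ _ le cont] by blast
    qed
    then obtain r where r: "zs j \<le> r" "r \<le> zs (Suc j)" "G r 0 = 0" by blast
    then have "r \<noteq> zs j" "r \<noteq> zs (Suc j)" using sg1 by auto
    then show ?thesis using r by (intro exI[of _ r]) simp
  qed
  then obtain r where r: "\<And>j. j < d \<Longrightarrow> zs j < r j \<and> r j < zs (Suc j) \<and> G (r j) 0 = 0" by metis
  have mono: "zs i \<le> zs j" if "i \<le> j" "j \<le> d" for i j
    using that
  proof (induction j rule: dec_induct)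
    case (step m)
    then show ?case using zs(1)[of m] by simp
  qed simp
  have "r i < r j" if "i < j" "j < d" for i j
    using r[of i] r[of j] mono[of "Suc i" j] that by simp
  then have "inj_on r {..<d}" by (intro linorder_inj_onI) (metis lessThan_iff less_irrefl, auto)
  moreover have "r ` {..<d} \<subseteq> {z. yf z = 0}" using r yf_zero_iff by auto
  ultimately show "d \<le> card {z. yf z = 0}"
    using card_inj_on_le[of r "{..<d}"] finite_zeros by simp
qed

text \<open>Where the \<open>v\<close>-term dominates, \<open>S - N\<close> is still below 1 at
  \<open>t = 0\<close>, so the root has \<open>t > 0\<close> and lies in the torus. This makes
  \<open>corner v\<close> nonempty later.\<close>

lemma ex_curve_pt_near:
  assumes "l v = 0"
  shows "\<exists>z. \<exists>t>0. S v z t \<le> K \<and> G z (\<sigma> v * t) = 0"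
proof -
  obtain j where j: "j \<le> d" "v = ev j" using ev(3) assms by blast
  obtain zs where "\<And>j. j < d \<Longrightarrow> zs j < zs (Suc j)" and zs: "\<And>j. j \<le> d \<Longrightarrow> S (ev j) (zs j) 0 < 1"
    by (rule dominating_points) blast
  define z where "z = zs j"
  have z: "S v z 0 < 1" unfolding z_def using zs j by blast
  then have \<phi>: "S v z 0 - N v z 0 < 1" using N_nonneg[of 0 v z] by simp
  obtain t where t: "t \<ge> 0" "S v z t \<le> K" "S v z t - N v z t = 1"
    using ex_root[OF assms, of z] z \<phi> K_bounds by auto
  then have "t \<noteq> 0" using \<phi> by auto
  then show ?thesis using t \<phi>_le_iff(2)[OF assms, of z t] by (intro exI[of _ z] exI[of _ t]) auto
qed

end

section \<open>Lattice triangles and the Kaehler condition\<close>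

text \<open>Cramer's rule; a determinant of 1 or -1 is its own inverse, so the coefficients are
  integers.\<close>

lemma abs_det_coefficients:
  fixes u v w z :: "int \<times> int" and \<alpha> \<beta> :: real
  assumes d: "\<bar>det2 u v w\<bar> = 1"
    and z1: "real_of_int (fst z - fst u) = \<alpha> * real_of_int (fst v - fst u) + \<beta> * real_of_int (fst w - fst u)"
    and z2: "real_of_int (snd z - snd u) = \<alpha> * real_of_int (snd v - snd u) + \<beta> * real_of_int (snd w - snd u)"
  obtains m n :: int where "\<alpha> = real_of_int m" "\<beta> = real_of_int n"
    "fst z - fst u = m * (fst v - fst u) + n * (fst w - fst u)"
    "snd z - snd u = m * (snd v - snd u) + n * (snd w - snd u)"
proof -
  define \<Delta> where "\<Delta> = det2 u v w"
  have \<Delta>: "\<Delta> * \<Delta> = 1" using d unfolding \<Delta>_def[symmetric] by (auto simp: abs_if split: if_splits)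
  then have \<Delta>r: "real_of_int \<Delta> * real_of_int \<Delta> = 1" by (metis of_int_1 of_int_mult)
  define m where "m = \<Delta> * det2 u z w"
  define n where "n = \<Delta> * det2 u v z"
  have "real_of_int (det2 u z w) = \<alpha> * real_of_int \<Delta>"
    using z1 z2 unfolding det2_def \<Delta>_def of_int_diff of_int_mult by algebra
  then have m: "\<alpha> = real_of_int m" using \<Delta>r by (simp add: m_def algebra_simps)
  have "real_of_int (det2 u v z) = \<beta> * real_of_int \<Delta>"
    using z1 z2 unfolding det2_def \<Delta>_def of_int_diff of_int_mult by algebra
  then have n: "\<beta> = real_of_int n" using \<Delta>r by (simp add: n_def algebra_simps)
  have "real_of_int (fst z - fst u) = real_of_int (m * (fst v - fst u) + n * (fst w - fst u))"
    "real_of_int (snd z - snd u) = real_of_int (m * (snd v - snd u) + n * (snd w - snd u))"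
    using z1 z2 unfolding m n by simp_all
  then show ?thesis using that m n by (simp only: of_int_eq_iff)
qed

lemma mem_triangle_coefficients:
  assumes "P \<in> convex hull {lpt u, lpt v, lpt w}"
  obtains \<alpha> \<beta> where "\<alpha> \<ge> 0" "\<beta> \<ge> 0" "\<alpha> + \<beta> \<le> 1"
    "fst P - fst u = \<alpha> * real_of_int (fst v - fst u) + \<beta> * real_of_int (fst w - fst u)"
    "snd P - snd u = \<alpha> * real_of_int (snd v - snd u) + \<beta> * real_of_int (snd w - snd u)"
proof -
  obtain \<gamma> \<alpha> \<beta> where *: "P = \<gamma> *\<^sub>R lpt u + \<alpha> *\<^sub>R lpt v + \<beta> *\<^sub>R lpt w" "\<gamma> \<ge> 0" "\<alpha> \<ge> 0" "\<beta> \<ge> 0" "\<gamma> + \<alpha> + \<beta> = 1"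
    using assms unfolding convex_hull_3 by auto
  then have \<gamma>: "\<gamma> = 1 - \<alpha> - \<beta>" by simp
  show ?thesis
    by (rule that[of \<alpha> \<beta>]) (use * in \<open>auto simp: lpt_def \<gamma> algebra_simps\<close>)
qed

text \<open>The coordinates of \<open>z\<close> in the triangle are nonnegative integers of sum at
  most 1, which leaves only the vertices.\<close>

lemma lattice_point_in_unimodular_triangle:
  assumes d: "\<bar>det2 u v w\<bar> = 1" and z: "lpt z \<in> convex hull {lpt u, lpt v, lpt w}"
  shows "z \<in> {u, v, w}"
proof -
  obtain \<alpha> \<beta> where *: "\<alpha> \<ge> 0" "\<beta> \<ge> 0" "\<alpha> + \<beta> \<le> 1"
    "fst (lpt z) - fst u = \<alpha> * real_of_int (fst v - fst u) + \<beta> * real_of_int (fst w - fst u)"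
    "snd (lpt z) - snd u = \<alpha> * real_of_int (snd v - snd u) + \<beta> * real_of_int (snd w - snd u)"
    by (rule mem_triangle_coefficients[OF z])
  obtain m n where mn: "\<alpha> = real_of_int m" "\<beta> = real_of_int n"
    "fst z - fst u = m * (fst v - fst u) + n * (fst w - fst u)"
    "snd z - snd u = m * (snd v - snd u) + n * (snd w - snd u)"
    using abs_det_coefficients[OF d, of z \<alpha> \<beta>] * by (auto simp: lpt_def)
  then have "m \<ge> 0" "n \<ge> 0" "m + n \<le> 1" using * by linarith+
  then consider "m = 0" "n = 0" | "m = 1" "n = 0" | "m = 0" "n = 1" by linarith
  then show ?thesis using mn by cases (auto simp: prod_eq_iff)
qed

lemma unimodular_triangle:
  assumes "unimodular_triangulation b T" "\<sigma> \<in> T"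
  obtains i j k where "\<sigma> = {i, j, k}" "\<bar>det2 (b i) (b j) (b k)\<bar> = 1"
proof -
  have "\<forall>\<sigma>\<in>T. \<exists>i j k. \<sigma> = {i, j, k} \<and> \<bar>det2 (b i) (b j) (b k)\<bar> = 1"
    using assms(1) unfolding unimodular_triangulation_def by (rule conjunct1)
  then show ?thesis using assms(2) that by blast
qed

lemma unimodular_triangle_vertex:
  assumes tri: "unimodular_triangulation b T" and s: "\<sigma> \<in> T" and v: "v \<in> \<sigma>"
  obtains u1 u2 where "\<sigma> = {v, u1, u2}" "\<bar>det2 (b v) (b u1) (b u2)\<bar> = 1"
proof -
  obtain i j k where *: "\<sigma> = {i, j, k}" "\<bar>det2 (b i) (b j) (b k)\<bar> = 1"
    by (rule unimodular_triangle[OF tri s])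
  have rot: "det2 y z x = det2 x y z" for x y z
    by (simp add: det2_def algebra_simps)
  consider "v = i" | "v = j" | "v = k" using v * by blast
  then show ?thesis
  proof cases
    case 1 then show ?thesis using that[of j k] * by simp
  next
    case 2 then show ?thesis using that[of k i] * rot[of "b j" "b k" "b i"] by auto
  next
    case 3 then show ?thesis using that[of i j] * rot[of "b i" "b j" "b k"] by auto
  qed
qed

text \<open>Only the triangles at \<open>v\<close> meet a small initial piece of the segment from \<open>v\<close> to \<open>w\<close>.\<close>

lemma ex_triangle_cone:
  fixes b :: "'n::finite \<Rightarrow> int \<times> int"
  assumes tri: "unimodular_triangulation b T" and inj: "inj b"
  obtains u1 u2 m n where "{v, u1, u2} \<in> T" "\<bar>det2 (b v) (b u1) (b u2)\<bar> = 1"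
    "fst (b w) - fst (b v) = int m * (fst (b u1) - fst (b v)) + int n * (fst (b u2) - fst (b v))"
    "snd (b w) - snd (b v) = int m * (snd (b u1) - snd (b v)) + int n * (snd (b u2) - snd (b v))"
proof -
  define cv where "cv \<sigma> = convex hull ((lpt \<circ> b) ` \<sigma>)" for \<sigma>
  define V where "V = lpt (b v)"
  define W where "W = lpt (b w)"
  define X where "X j = V + inverse (real (Suc j)) *\<^sub>R (W - V)" for j
  \<comment> \<open>The triangles that miss \<open>V\<close> form a closed set, which the points
    \<open>X j\<close> tending to \<open>V\<close> eventually avoid; a triangle containing such an
    \<open>X j\<close> contains \<open>V\<close>.\<close>
  define C where "C = (\<Union>\<sigma>\<in>{\<sigma> \<in> T. V \<notin> cv \<sigma>}. cv \<sigma>)"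
  have closed: "closed (cv \<sigma>)" for \<sigma>
    unfolding cv_def by (intro compact_imp_closed finite_imp_compact_convex_hull) auto
  have "finite T" by (rule finite_subset[OF subset_UNIV]) simp
  then have "closed C" unfolding C_def using closed by (intro closed_UN) auto
  moreover have "V \<in> - C" by (auto simp: C_def)
  moreover have "X \<longlonglongrightarrow> V + 0 *\<^sub>R (W - V)"
    unfolding X_def by (intro tendsto_intros LIMSEQ_inverse_real_of_nat)
  ultimately have "eventually (\<lambda>j. X j \<in> - C) sequentially"
    by (intro topological_tendstoD[of X V]) auto
  then obtain j where j: "X j \<notin> C" by (auto simp: eventually_sequentially)
  define r where "r = inverse (real (Suc j))"
  have r: "0 < r" "r \<le> 1" unfolding r_def by (auto simp: field_simps)
  have X: "X j = (1 - r) *\<^sub>R V + r *\<^sub>R W" unfolding X_def r_def[symmetric] by (simp add: algebra_simps)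
  have "V \<in> polygon b" "W \<in> polygon b" unfolding polygon_def V_def W_def by (auto intro!: hull_inc)
  then have "X j \<in> polygon b" unfolding X polygon_def using r
    by (intro convexD[OF convex_convex_hull]) auto
  then obtain \<sigma> where s: "\<sigma> \<in> T" "X j \<in> cv \<sigma>"
    using tri unfolding unimodular_triangulation_def cv_def by blast
  then have "V \<in> cv \<sigma>" using j unfolding C_def by blast
  obtain i1 i2 i3 where i: "\<sigma> = {i1, i2, i3}" "\<bar>det2 (b i1) (b i2) (b i3)\<bar> = 1"
    by (rule unimodular_triangle[OF tri s(1)])
  have "b v \<in> {b i1, b i2, b i3}"
    using \<open>V \<in> cv \<sigma>\<close> i unfolding cv_def V_def
    by (intro lattice_point_in_unimodular_triangle) auto
  then have "v \<in> \<sigma>" using inj i by (auto dest: injD)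
  then obtain u1 u2 where u: "\<sigma> = {v, u1, u2}" "\<bar>det2 (b v) (b u1) (b u2)\<bar> = 1"
    using unimodular_triangle_vertex[OF tri s(1)] by metis
  have "X j \<in> convex hull {lpt (b v), lpt (b u1), lpt (b u2)}"
    using s(2) u by (simp add: cv_def)
  then obtain \<alpha> \<beta> where ab: "\<alpha> \<ge> 0" "\<beta> \<ge> 0"
    "fst (X j) - fst (b v) = \<alpha> * real_of_int (fst (b u1) - fst (b v)) + \<beta> * real_of_int (fst (b u2) - fst (b v))"
    "snd (X j) - snd (b v) = \<alpha> * real_of_int (snd (b u1) - snd (b v)) + \<beta> * real_of_int (snd (b u2) - snd (b v))"
    by (rule mem_triangle_coefficients) blast
  have f: "fst (X j) - fst (b v) = r * real_of_int (fst (b w) - fst (b v))"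
    "snd (X j) - snd (b v) = r * real_of_int (snd (b w) - snd (b v))"
    unfolding X by (auto simp: V_def W_def lpt_def algebra_simps)
  \<comment> \<open>Dividing by \<open>r\<close> carries the cone coordinates from the nearby point
    \<open>X j\<close> to \<open>w\<close>; unimodularity then makes them integers.\<close>
  have div: "x = (\<alpha> / r) * y + (\<beta> / r) * z" if "r * x = \<alpha> * y + \<beta> * z" for x y z
    using that r by (simp add: field_simps)
  have "real_of_int (fst (b w) - fst (b v)) = (\<alpha> / r) * real_of_int (fst (b u1) - fst (b v)) + (\<beta> / r) * real_of_int (fst (b u2) - fst (b v))"
    "real_of_int (snd (b w) - snd (b v)) = (\<alpha> / r) * real_of_int (snd (b u1) - snd (b v)) + (\<beta> / r) * real_of_int (snd (b u2) - snd (b v))"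
    by (rule div[OF ab(3)[unfolded f(1)]] div[OF ab(4)[unfolded f(2)]])+
  then obtain m n where mn: "\<alpha> / r = real_of_int m" "\<beta> / r = real_of_int n"
    "fst (b w) - fst (b v) = m * (fst (b u1) - fst (b v)) + n * (fst (b u2) - fst (b v))"
    "snd (b w) - snd (b v) = m * (snd (b u1) - snd (b v)) + n * (snd (b u2) - snd (b v))"
    by (rule abs_det_coefficients[OF u(2)]) blast
  have "real_of_int m \<ge> 0" "real_of_int n \<ge> 0"
    using ab(1,2) r unfolding mn(1,2)[symmetric] by simp_all
  then have "m \<ge> 0" "n \<ge> 0" by simp_all
  then show ?thesis using that[of u1 u2 "nat m" "nat n"] u s(1) mn(3,4) by simp
qed

text \<open>Otherwise the \<open>p\<close> independent rows would lie in a space of dimension \<open>p - 1\<close>.\<close>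

lemma kahler_column_nonzero:
  fixes b :: "'n::finite \<Rightarrow> int \<times> int"
  assumes card: "CARD('n) = p + 3" and tri: "unimodular_triangulation b T"
    and kd: "kahler_data b T p h s" and s: "\<sigma> \<in> T" and j: "j \<notin> \<sigma>"
  shows "\<exists>k<p. s \<sigma> k j > 0"
proof (rule ccontr)
  assume a: "\<not> ?thesis"
  have nd: "c k = 0" if "\<And>j. j \<notin> \<sigma> \<Longrightarrow> (\<Sum>k<p. c k * real (s \<sigma> k j)) = 0" "k < p" for c k
    using kd s that unfolding kahler_data_def by blast
  define r :: "nat \<Rightarrow> real ^ 'n" where "r k = (\<chi> i. if i \<notin> \<sigma> then real (s \<sigma> k i) else 0)" for k
  have rows: "c k = 0" if c: "(\<Sum>k<p. c k *\<^sub>R r k) = 0" and k: "k < p" for c k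
  proof (rule nd[OF _ k])
    fix i assume i: "i \<notin> \<sigma>"
    have "(\<Sum>k<p. c k *\<^sub>R r k) $ i = 0" using c by simp
    then show "(\<Sum>k<p. c k * real (s \<sigma> k i)) = 0" using i by (simp add: r_def)
  qed
  have inj: "inj_on r {..<p}"
  proof (rule inj_onI, rule ccontr)
    fix x y assume xy: "x \<in> {..<p}" "y \<in> {..<p}" "r x = r y" "x \<noteq> y"
    define c :: "nat \<Rightarrow> real" where "c k = (if k = x then 1 else if k = y then -1 else 0)" for k
    have "(\<Sum>k<p. c k *\<^sub>R r k) = (\<Sum>k\<in>{x, y}. c k *\<^sub>R r k)"
      using xy by (intro sum.mono_neutral_right) (auto simp: c_def)
    also have "\<dots> = 0" using xy by (simp add: c_def)
    finally have "c x = 0" using rows xy by blast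
    then show False by (simp add: c_def)
  qed
  have ind: "independent (r ` {..<p})"
  proof (rule independent_if_scalars_zero)
    fix f x assume f: "(\<Sum>x\<in>r ` {..<p}. f x *\<^sub>R x) = 0" and x: "x \<in> r ` {..<p}"
    have "(\<Sum>k<p. f (r k) *\<^sub>R r k) = 0" using f by (simp add: sum.reindex[OF inj])
    then show "f x = 0" using rows[of "\<lambda>k. f (r k)"] x by auto
  qed simp
  \<comment> \<open>The rows vanish on \<sigma> and, under the assumption to be refuted, at
    \<open>j\<close>; so they lie in the span of the \<open>p - 1\<close> remaining unit
    vectors.\<close>
  define t where "t = (\<lambda>i. Finite_Cartesian_Product.axis i (1::real)) ` (- \<sigma> - {j})"
  have span: "r ` {..<p} \<subseteq> span t"
  proof
    fix x assume "x \<in> r ` {..<p}"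
    then obtain k where k: "k < p" "x = r k" by auto
    have "x = (\<Sum>i\<in>UNIV. (x $ i) *\<^sub>R Finite_Cartesian_Product.axis i 1)"
      by (simp add: vec_eq_iff Finite_Cartesian_Product.axis_def if_distrib cong: if_cong)
    also have "\<dots> = (\<Sum>i\<in>- \<sigma> - {j}. (x $ i) *\<^sub>R Finite_Cartesian_Product.axis i 1)"
      using a k by (intro sum.mono_neutral_right) (auto simp: r_def)
    also have "\<dots> \<in> span t"
      unfolding t_def by (intro span_sum span_scale span_base) auto
    finally show "x \<in> span t" .
  qed
  obtain i1 i2 i3 where i: "\<sigma> = {i1, i2, i3}" "\<bar>det2 (b i1) (b i2) (b i3)\<bar> = 1"
    by (rule unimodular_triangle[OF tri s])
  then have "i1 \<noteq> i2" "i1 \<noteq> i3" "i2 \<noteq> i3" by (auto simp: det2_def algebra_simps)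
  then have "card \<sigma> = 3" using i by simp
  then have "card (- \<sigma>) = p"
    using card by (simp add: Compl_eq_Diff_UNIV card_Diff_subset)
  then have "card (- \<sigma> - {j}) = p - 1" "p \<ge> 1"
    using j by (auto simp: card_gt_0_iff Suc_le_eq)
  moreover have "card t \<le> card (- \<sigma> - {j})" unfolding t_def by (rule card_image_le) simp
  moreover have "card (r ` {..<p}) \<le> card t"
    using independent_span_bound[OF _ ind span] unfolding t_def by simp
  ultimately show False using card_image[OF inj] by simp
qed

text \<open>The left side is the sum over \<open>k\<close> of \<open>ln \<bar>q k\<bar>\<close>
  times the pairing of \<rho> with \<open>H_k\<close>. The coefficients refer to \<sigma>1, but the
  pairing may be computed in the basis of any triangle. For \<sigma> it is a sum of nonnegative
  integers, and the nonzero column at \<open>j\<close> makes it at least 1 for some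
  \<open>k\<close>.\<close>

lemma mirror_coeff_charge_bound:
  fixes b :: "'n::finite \<Rightarrow> int \<times> int" and \<rho> :: "'n \<Rightarrow> int"
  assumes card: "CARD('n) = p + 3" and tri: "unimodular_triangulation b T"
    and kd: "kahler_data b T p h s" and s1: "\<sigma>1 \<in> T" and s: "\<sigma> \<in> T"
    and q: "\<And>k. k < p \<Longrightarrow> q k \<noteq> 0 \<and> \<bar>q k\<bar> < \<epsilon>" and \<epsilon>: "0 < \<epsilon>" "\<epsilon> \<le> 1"
    and \<rho>: "\<rho> \<in> charge_lattice b" "\<And>j. j \<notin> \<sigma> \<Longrightarrow> \<rho> j \<ge> 0" and j: "j \<notin> \<sigma>" "\<rho> j > 0"
  shows "(\<Sum>i\<in>UNIV. of_int (\<rho> i) * ln \<bar>mirror_coeff \<sigma>1 p s q i\<bar>) \<le> ln \<epsilon>"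
proof -
  define L where "L k = ln \<bar>q k\<bar>" for k
  have L: "L k \<le> ln \<epsilon>" "L k \<le> 0" if "k < p" for k
    using q[OF that] \<epsilon> unfolding L_def by (auto simp: less_imp_le)
  have lnm: "ln \<bar>mirror_coeff \<sigma>1 p s q i\<bar> = (if i \<in> \<sigma>1 then 0 else \<Sum>k<p. real (s \<sigma>1 k i) * L k)" for i
  proof -
    have "ln (\<Prod>k<p. \<bar>q k\<bar> ^ s \<sigma>1 k i) = (\<Sum>k<p. ln (\<bar>q k\<bar> ^ s \<sigma>1 k i))"
      using q by (intro ln_prod) auto
    also have "\<dots> = (\<Sum>k<p. real (s \<sigma>1 k i) * L k)"
      using q by (intro sum.cong) (auto simp: L_def ln_realpow)
    finally show ?thesis by (simp add: mirror_coeff_def abs_prod power_abs)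
  qed
  have sum_eq: "(\<Sum>i\<in>UNIV. h k i * of_int (\<rho> i)) = (\<Sum>j\<in>UNIV - \<tau>. of_nat (s \<tau> k j) * of_int (\<rho> j))"
    if "\<tau> \<in> T" "k < p" for \<tau> k
    using conjunct1[OF kd[unfolded kahler_data_def]] that \<rho>(1) by blast
  have charge: "(\<Sum>i\<in>UNIV - \<sigma>1. int (s \<sigma>1 k i) * \<rho> i) = (\<Sum>i\<in>UNIV - \<sigma>. int (s \<sigma> k i) * \<rho> i)" if "k < p" for k
  proof -
    have "(of_int (\<Sum>i\<in>UNIV - \<sigma>1. int (s \<sigma>1 k i) * \<rho> i) :: rat) = of_int (\<Sum>i\<in>UNIV - \<sigma>. int (s \<sigma> k i) * \<rho> i)"
      using sum_eq[OF s that] sum_eq[OF s1 that] by simp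
    then show ?thesis by (simp only: of_int_eq_iff)
  qed
  define N where "N k = (\<Sum>i\<in>UNIV - \<sigma>. int (s \<sigma> k i) * \<rho> i)" for k
  have N0: "N k \<ge> 0" for k unfolding N_def using \<rho>(2) by (intro sum_nonneg) auto
  have "(\<Sum>i\<in>UNIV. of_int (\<rho> i) * ln \<bar>mirror_coeff \<sigma>1 p s q i\<bar>)
      = (\<Sum>i\<in>UNIV - \<sigma>1. of_int (\<rho> i) * (\<Sum>k<p. real (s \<sigma>1 k i) * L k))"
    unfolding lnm by (rule sum.mono_neutral_cong_right) auto
  also have "\<dots> = (\<Sum>k<p. L k * of_int (\<Sum>i\<in>UNIV - \<sigma>1. int (s \<sigma>1 k i) * \<rho> i))"
    unfolding of_int_sum sum_distrib_left by (subst sum.swap) (simp add: algebra_simps)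
  also have "\<dots> = (\<Sum>k<p. L k * of_int (N k))"
    using charge by (simp add: N_def)
  also have "\<dots> \<le> ln \<epsilon>"
  proof -
    obtain k0 where k0: "k0 < p" "s \<sigma> k0 j > 0"
      using kahler_column_nonzero[OF card tri kd s j(1)] by blast
    have "1 \<le> int (s \<sigma> k0 j) * \<rho> j" using k0 j
      by (metis int_one_le_iff_zero_less mult_pos_pos of_nat_0_less_iff)
    also have "\<dots> \<le> N k0" unfolding N_def using \<rho>(2) j by (intro member_le_sum) auto
    finally have N1: "1 \<le> real_of_int (N k0)" by simp
    have "(\<Sum>k<p. L k * of_int (N k)) = L k0 * of_int (N k0) + (\<Sum>k\<in>{..<p} - {k0}. L k * of_int (N k))"
      using k0 by (subst sum.remove[of _ k0]) auto
    also have "(\<Sum>k\<in>{..<p} - {k0}. L k * of_int (N k)) \<le> 0"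
      using L N0 by (intro sum_nonpos) (auto simp: mult_nonpos_nonneg)
    also have "L k0 * of_int (N k0) \<le> L k0 * 1"
      using L(2)[OF k0(1)] N1 by (intro mult_left_mono_neg) auto
    also have "L k0 * 1 + 0 \<le> ln \<epsilon>" using L(1)[OF k0(1)] by simp
    finally show ?thesis by simp
  qed
  finally show ?thesis .
qed

text \<open>The primitive vector \<open>e\<close> along the side is completed by Bezout to a
  unimodular basis with \<open>f\<close> pointing into the polygon, and \<open>k\<close>,
  \<open>l\<close> are coordinates in it counted from an end of the side. Since \<open>b\<close>
  lists all lattice points of the polygon, \<open>k\<close> takes every value from 0 to
  \<open>d\<close> on the side.\<close>

lemma side_coordinates:
  fixes b :: "'n::finite \<Rightarrow> int \<times> int"
  assumes enum: "lattice_points_enum b" and side: "is_side b E"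
  obtains e f b0 :: "int \<times> int" and k :: "'n \<Rightarrow> int" and l :: "'n \<Rightarrow> nat" and d :: nat and ev :: "nat \<Rightarrow> 'n"
  where "fst e * snd f - snd e * fst f = 1"
    "\<And>i. fst (b i) = fst b0 + k i * fst e + int (l i) * fst f"
    "\<And>i. snd (b i) = snd b0 + k i * snd e + int (l i) * snd f"
    "\<And>i. l i = 0 \<longleftrightarrow> i \<in> E" "d \<ge> 1" "card E = d + 1"
    "\<And>j. j \<le> d \<Longrightarrow> k (ev j) = int j" "\<And>j. j \<le> d \<Longrightarrow> ev j \<in> E" "\<And>i. i \<in> E \<Longrightarrow> \<exists>j\<le>d. i = ev j"
proof -
  have inj: "inj b" using enum by (simp add: lattice_points_enum_def)
  obtain u :: "real \<times> real" and c where u: "u \<noteq> 0" "\<And>i. inner u (lpt (b i)) \<le> c"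
      "E = {i. inner u (lpt (b i)) = c}" "card E \<ge> 2"
    using side unfolding is_side_def by blast
  define u1 u2 where "u1 = fst u" and "u2 = snd u"
  have inn: "inner u (lpt z) = u1 * real_of_int (fst z) + u2 * real_of_int (snd z)" for z
    by (simp add: u1_def u2_def lpt_def inner_prod_def)
  obtain B where "B \<subseteq> E" "card B = 2" by (rule obtain_subset_with_card_n[OF u(4)])
  moreover obtain i0 i1 where "B = {i0, i1}" "i0 \<noteq> i1" using \<open>card B = 2\<close> unfolding card_2_iff by blast
  ultimately have i01: "i0 \<in> E" "i1 \<in> E" "i0 \<noteq> i1" by auto
  define m0 n0 where "m0 = fst (b i0)" and "n0 = snd (b i0)"
  define w1 w2 where "w1 = fst (b i1) - m0" and "w2 = snd (b i1) - n0"
  have "b i1 \<noteq> b i0" using inj i01 by (auto dest: injD)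
  then have g: "gcd w1 w2 \<noteq> 0" by (auto simp: w1_def w2_def m0_def n0_def prod_eq_iff)
  obtain e1 e2 where e12: "w1 = e1 * gcd w1 w2" "w2 = e2 * gcd w1 w2" "coprime e1 e2"
    using gcd_coprime_exists[OF g] by blast
  obtain x y where "x * e1 + y * e2 = gcd e1 e2" using bezout_int by blast
  then have xy: "x * e1 + y * e2 = 1" using e12 by simp
  have "u1 * real_of_int w1 + u2 * real_of_int w2 = 0"
    using i01 unfolding u(3) by (simp add: inn w1_def w2_def m0_def n0_def algebra_simps)
  then have "(u1 * real_of_int e1 + u2 * real_of_int e2) * real_of_int (gcd w1 w2) = 0"
    by (subst (asm) e12(1), subst (asm) e12(2)) (simp add: algebra_simps)
  then have ue0: "u1 * real_of_int e1 + u2 * real_of_int e2 = 0" using g by auto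
  define \<mu>0 where "\<mu>0 = u1 * real_of_int (- y) + u2 * real_of_int x"
  have xyr: "real_of_int x * real_of_int e1 + real_of_int y * real_of_int e2 = 1"
    using xy by (metis of_int_1 of_int_add of_int_mult)
  have \<mu>0: "\<mu>0 \<noteq> 0"
  proof
    assume "\<mu>0 = 0"
    then have "u1 = 0" "u2 = 0" using ue0 xyr unfolding \<mu>0_def of_int_minus by algebra+
    then show False using u(1) by (simp add: u1_def u2_def prod_eq_iff)
  qed
  \<comment> \<open>The sign makes \<open>f\<close> point inward, where the functional
    \<open>u\<close> decreases; \<open>e\<close> changes along with it to keep the determinant
    1.\<close>
  define sg :: int where "sg = (if \<mu>0 < 0 then 1 else -1)"
  have sg: "sg * sg = 1" by (simp add: sg_def)
  define e where "e = (sg * e1, sg * e2)"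
  define f where "f = (- sg * y, sg * x)"
  have det: "fst e * snd f - snd e * fst f = 1"
    using xy sg unfolding e_def f_def fst_conv snd_conv by algebra
  have ue: "u1 * real_of_int (fst e) + u2 * real_of_int (snd e) = 0"
    using ue0 by (simp add: e_def sg_def)
  define \<mu> where "\<mu> = u1 * real_of_int (fst f) + u2 * real_of_int (snd f)"
  have \<mu>: "\<mu> < 0" using \<mu>0 by (auto simp: \<mu>_def \<mu>0_def f_def sg_def split: if_splits)
  define k' where "k' i = (fst (b i) - m0) * snd f - (snd (b i) - n0) * fst f" for i
  define l' where "l' i = fst e * (snd (b i) - n0) - snd e * (fst (b i) - m0)" for i
  have b1: "fst (b i) = m0 + k' i * fst e + l' i * fst f" for i
    using det unfolding k'_def l'_def by algebra
  have b2: "snd (b i) = n0 + k' i * snd e + l' i * snd f" for i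
    using det unfolding k'_def l'_def by algebra
  have c: "c = u1 * real_of_int m0 + u2 * real_of_int n0"
    using i01(1) unfolding u(3) m0_def n0_def by (simp add: inn)
  have inner_eq: "inner u (lpt (b i)) = c + real_of_int (l' i) * \<mu>" for i
  proof -
    have "inner u (lpt (b i)) = u1 * (real_of_int m0 + real_of_int (k' i) * real_of_int (fst e) + real_of_int (l' i) * real_of_int (fst f))
      + u2 * (real_of_int n0 + real_of_int (k' i) * real_of_int (snd e) + real_of_int (l' i) * real_of_int (snd f))"
      unfolding inn b1 b2 by simp
    then show ?thesis using ue unfolding c \<mu>_def by algebra
  qed
  have l'0: "l' i \<ge> 0" for i
    using u(2)[of i] \<mu> unfolding inner_eq by (simp add: mult_le_0_iff)
  have l'E: "l' i = 0 \<longleftrightarrow> i \<in> E" for i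
    unfolding u(3) using \<mu> by (simp add: inner_eq)
  define lo hi where "lo = Min (k' ` E)" and "hi = Max (k' ` E)"
  have neE: "k' ` E \<noteq> {}" "finite (k' ` E)" using i01 by auto
  obtain ilo ihi where ilo: "ilo \<in> E" "k' ilo = lo" and ihi: "ihi \<in> E" "k' ihi = hi"
    using Min_in[OF neE(2,1)] Max_in[OF neE(2,1)] unfolding lo_def hi_def by force
  have bnd: "lo \<le> k' i" "k' i \<le> hi" if "i \<in> E" for i
    using that neE unfolding lo_def hi_def by auto
  have fill: "\<exists>i\<in>E. k' i = m" if m: "lo \<le> m" "m \<le> hi" for m
  proof -
    define z where "z = (m0 + m * fst e, n0 + m * snd e)"
    define t where "t = (if hi = lo then 0 else (real_of_int m - real_of_int lo) / (real_of_int hi - real_of_int lo))"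
    have t: "0 \<le> t" "t \<le> 1" using m by (auto simp: t_def field_simps)
    have mt: "real_of_int m = (1 - t) * real_of_int lo + t * real_of_int hi"
      using m by (auto simp: t_def field_simps)
    have lo1: "lpt (b ilo) = (real_of_int m0 + real_of_int lo * real_of_int (fst e), real_of_int n0 + real_of_int lo * real_of_int (snd e))"
      and hi1: "lpt (b ihi) = (real_of_int m0 + real_of_int hi * real_of_int (fst e), real_of_int n0 + real_of_int hi * real_of_int (snd e))"
      unfolding lpt_def b1 b2 using ilo ihi l'E by auto
    have "lpt z = (1 - t) *\<^sub>R lpt (b ilo) + t *\<^sub>R lpt (b ihi)"
      unfolding lo1 hi1 unfolding z_def lpt_def by (simp add: mt algebra_simps)
    also have "\<dots> \<in> polygon b"
      unfolding polygon_def using t by (intro convexD[OF convex_convex_hull] hull_inc) auto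
    finally obtain i where i: "z = b i" using enum unfolding lattice_points_enum_def by blast
    have "l' i = 0" unfolding l'_def i[symmetric] z_def by simp
    moreover have "k' i = m" using det unfolding k'_def i[symmetric] z_def fst_conv snd_conv by algebra
    ultimately show ?thesis using l'E by blast
  qed
  define d where "d = nat (hi - lo)"
  have hid: "hi = lo + int d" using bnd[OF ilo(1)] by (simp add: d_def ihi ilo)
  have "\<forall>j\<in>{..d}. \<exists>i. i \<in> E \<and> k' i = lo + int j"
  proof
    fix j assume "j \<in> {..d}"
    then show "\<exists>i. i \<in> E \<and> k' i = lo + int j" using fill[of "lo + int j"] hid by auto
  qed
  then obtain ev where ev: "\<And>j. j \<le> d \<Longrightarrow> ev j \<in> E \<and> k' (ev j) = lo + int j"
    using bchoice[of "{..d}" "\<lambda>j i. i \<in> E \<and> k' i = lo + int j"] by auto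
  have inj_k: "i = i'" if "i \<in> E" "i' \<in> E" "k' i = k' i'" for i i'
  proof -
    have "l' i = 0" "l' i' = 0" using that l'E by auto
    then have "b i = b i'" using that b1[of i] b1[of i'] b2[of i] b2[of i'] by (simp add: prod_eq_iff)
    then show ?thesis using inj by (auto dest: injD)
  qed
  have surj: "\<exists>j\<le>d. i = ev j" if "i \<in> E" for i
  proof -
    have "nat (k' i - lo) \<le> d" using bnd[OF that] hid by simp
    moreover have "i = ev (nat (k' i - lo))"
      using inj_k[of i "ev (nat (k' i - lo))"] ev[OF calculation] that bnd[OF that] by simp
    ultimately show ?thesis by blast
  qed
  have "bij_betw ev {..d} E"
    unfolding bij_betw_def
  proof
    show "inj_on ev {..d}" using ev by (metis (no_types, lifting) add_left_cancel atMost_iff inj_onI of_nat_eq_iff)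
    show "ev ` {..d} = E" using ev surj by auto
  qed
  then have card: "card E = d + 1" using bij_betw_same_card by fastforce
  show ?thesis
  proof (rule that[of e f "(m0 + lo * fst e, n0 + lo * snd e)" "\<lambda>i. k' i - lo" "\<lambda>i. nat (l' i)" d ev])
    show "fst (b i) = fst (m0 + lo * fst e, n0 + lo * snd e) + (k' i - lo) * fst e + int (nat (l' i)) * fst f" for i
      using b1[of i] l'0[of i] by (simp add: algebra_simps)
    show "snd (b i) = snd (m0 + lo * fst e, n0 + lo * snd e) + (k' i - lo) * snd e + int (nat (l' i)) * snd f" for i
      using b2[of i] l'0[of i] by (simp add: algebra_simps)
    show "nat (l' i) = 0 \<longleftrightarrow> i \<in> E" for i using l'0[of i] l'E[of i] by auto
    show "d \<ge> 1" using card u(4) by simp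
  qed (use det card ev surj in auto)
qed

text \<open>Modulo 2 squares are linear, and \<open>k * l\<close> has the coefficient
  \<open>e1 * f2 + e2 * f1\<close>, which is odd. So the sign rule keeps its form in every
  unimodular chart, up to signs that the coordinates can absorb.\<close>

lemma odd_product_chart:
  fixes m0 n0 e1 e2 f1 f2 k l :: int
  assumes "e1 * f2 - e2 * f1 = 1"
  shows "odd ((m0 + k * e1 + l * f1) * (n0 + k * e2 + l * f2)) \<longleftrightarrow>
    odd (m0 * n0 + k * (m0 * e2 + n0 * e1 + e1 * e2) + l * (m0 * f2 + n0 * f1 + f1 * f2) + k * l)"
proof -
  have "odd (e1 * f2 - e2 * f1)" using assms by simp
  then show ?thesis
    by (cases "odd k"; cases "odd l"; simp; blast)
qed

section \<open>The branch of the curve along a side\<close>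

definition parity_sign :: "int \<Rightarrow> real" where
  "parity_sign m = (if even m then 1 else - 1)"

text \<open>\<open>D\<close> bounds the cone coordinates for all pairs of lattice points at once, so
  one condition on \<epsilon> serves the charts of all sides.\<close>

locale real_mirror =
  fixes b :: "'n::finite \<Rightarrow> int \<times> int" and p :: nat and T :: "'n set set" and \<sigma>1 :: "'n set"
    and h :: "nat \<Rightarrow> 'n \<Rightarrow> rat" and s :: "'n set \<Rightarrow> nat \<Rightarrow> 'n \<Rightarrow> nat" and q :: "nat \<Rightarrow> real"
    and D :: nat and \<epsilon> :: real and K :: real
  assumes card_n: "CARD('n) = p + 3" and enum: "lattice_points_enum b"
    and tri: "unimodular_triangulation b T" and s1: "\<sigma>1 \<in> T" and kd: "kahler_data b T p h s"
    and q: "\<And>k. k < p \<Longrightarrow> q k \<noteq> 0 \<and> \<bar>q k\<bar> < \<epsilon>"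
    and odd_neg: "\<And>i. odd (fst (b i)) \<Longrightarrow> odd (snd (b i)) \<Longrightarrow> mirror_coeff \<sigma>1 p s q i < 0"
    and even_pos: "\<And>i. even (fst (b i)) \<or> even (snd (b i)) \<Longrightarrow> mirror_coeff \<sigma>1 p s q i > 0"
    and D: "D \<ge> 1"
    and cones: "\<And>v w. \<exists>u1 u2 m n. {v, u1, u2} \<in> T \<and> \<bar>det2 (b v) (b u1) (b u2)\<bar> = 1 \<and> m + n \<le> D \<and>
      fst (b w) - fst (b v) = int m * (fst (b u1) - fst (b v)) + int n * (fst (b u2) - fst (b v)) \<and>
      snd (b w) - snd (b v) = int m * (snd (b u1) - snd (b v)) + int n * (snd (b u2) - snd (b v))"
    and K: "K = real CARD('n) ^ 2 + 2"
    and \<epsilon>: "0 < \<epsilon>" "4 * real CARD('n) * real D * K ^ (D + 1) * \<epsilon> \<le> 1"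
begin

definition a :: "'n \<Rightarrow> real" where
  "a = mirror_coeff \<sigma>1 p s q"

lemma a_nz: "a i \<noteq> 0"
  using odd_neg[of i] even_pos[of i] unfolding a_def by fastforce

lemma inj_b: "inj b"
  using enum by (simp add: lattice_points_enum_def)

lemma \<epsilon>_le_1: "\<epsilon> \<le> 1"
proof -
  have "1 * 1 * 1 * 1 \<le> 4 * real CARD('n) * real D * K ^ (D + 1)"
    using D card_n by (intro mult_mono one_le_power) (auto simp: K)
  then have "1 * \<epsilon> \<le> 4 * real CARD('n) * real D * K ^ (D + 1) * \<epsilon>"
    using \<epsilon>(1) by (intro mult_right_mono) auto
  then show ?thesis using \<epsilon>(2) by linarith
qed

lemma charge_bound:
  assumes "\<sigma> \<in> T" "\<rho> \<in> charge_lattice b" "\<And>j. j \<notin> \<sigma> \<Longrightarrow> \<rho> j \<ge> 0" "j \<notin> \<sigma>" "\<rho> j > 0"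
  shows "(\<Sum>i\<in>UNIV. of_int (\<rho> i) * ln \<bar>a i\<bar>) \<le> ln \<epsilon>"
  unfolding a_def using mirror_coeff_charge_bound[OF card_n tri kd s1 assms(1) q \<epsilon>(1) \<epsilon>_le_1 assms(2-5)] .

text \<open>The relation \<rho> says that \<open>w\<close> plus \<open>m + n - 1\<close> times
  \<open>v\<close> equals \<open>m\<close> times \<open>u1\<close> plus \<open>n\<close> times
  \<open>u2\<close>. Its only nonzero coordinate off the triangle is the 1 at \<open>w\<close>,
  which is not a vertex because \<open>m + n \<ge> 2\<close>. The charge bound for \<rho> is the
  logarithm of the claim.\<close>

lemma coeff_dominated:
  assumes t: "{v, u1, u2} \<in> T" and det: "\<bar>det2 (b v) (b u1) (b u2)\<bar> = 1"
    and w1: "fst (b w) - fst (b v) = int m * (fst (b u1) - fst (b v)) + int n * (fst (b u2) - fst (b v))"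
    and w2: "snd (b w) - snd (b v) = int m * (snd (b u1) - snd (b v)) + int n * (snd (b u2) - snd (b v))"
    and mn: "m + n \<ge> 2"
  shows "\<bar>a w / a v\<bar> \<le> \<epsilon> * \<bar>a u1 / a v\<bar> ^ m * \<bar>a u2 / a v\<bar> ^ n"
proof -
  \<comment> \<open>Cone coordinates are quotients of determinants; for a vertex of the triangle
    they would have sum at most 1.\<close>
  have d1: "det2 (b v) (b w) (b u2) = int m * det2 (b v) (b u1) (b u2)"
    unfolding det2_def w1 w2 by (simp add: algebra_simps)
  have d2: "det2 (b v) (b u1) (b w) = int n * det2 (b v) (b u1) (b u2)"
    unfolding det2_def w1 w2 by (simp add: algebra_simps)
  have dz: "det2 x x y = 0" "det2 x y x = 0" "det2 x y y = 0" for x y by (auto simp: det2_def)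
  have nz: "det2 (b v) (b u1) (b u2) \<noteq> 0" using det by auto
  have w: "w \<notin> {v, u1, u2}"
  proof
    assume "w \<in> {v, u1, u2}"
    then consider "w = v" | "w = u1" | "w = u2" by blast
    then show False
    proof cases
      case 1
      then have "int m * det2 (b v) (b u1) (b u2) = 0" "int n * det2 (b v) (b u1) (b u2) = 0"
        using d1 d2 dz by metis+
      then show False using nz mn by simp
    next
      case 2
      then have "int m * det2 (b v) (b u1) (b u2) = 1 * det2 (b v) (b u1) (b u2)"
        "int n * det2 (b v) (b u1) (b u2) = 0"
        using d1 d2 dz by (metis mult_1)+
      then show False using nz mn unfolding mult_cancel_right by simp
    next
      case 3
      then have "int n * det2 (b v) (b u1) (b u2) = 1 * det2 (b v) (b u1) (b u2)"
        "int m * det2 (b v) (b u1) (b u2) = 0"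
        using d1 d2 dz by (metis mult_1)+
      then show False using nz mn unfolding mult_cancel_right by simp
    qed
  qed
  define \<rho> where "\<rho> i = (if i = w then 1 else 0) + (int m + int n - 1) * (if i = v then 1 else 0)
    - int m * (if i = u1 then 1 else 0) - int n * (if i = u2 then 1 else 0)" for i
  have sum_int: "(\<Sum>i\<in>UNIV. \<rho> i * F i) = F w + (int m + int n - 1) * F v - int m * F u1 - int n * F u2" for F
  proof -
    have "(\<Sum>i\<in>UNIV. \<rho> i * F i) = (\<Sum>i\<in>UNIV. (if i = w then F i else 0) + (int m + int n - 1) * (if i = v then F i else 0)
      - int m * (if i = u1 then F i else 0) - int n * (if i = u2 then F i else 0))"
      by (intro sum.cong) (auto simp: \<rho>_def algebra_simps)
    then show ?thesis by (simp add: sum.distrib sum_subtractf flip: sum_distrib_left)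
  qed
  have sum_real: "(\<Sum>i\<in>UNIV. of_int (\<rho> i) * F i) = F w + (real m + real n - 1) * F v - real m * F u1 - real n * F u2" for F :: "'n \<Rightarrow> real"
  proof -
    have "(\<Sum>i\<in>UNIV. of_int (\<rho> i) * F i) = (\<Sum>i\<in>UNIV. (if i = w then F i else 0) + (real m + real n - 1) * (if i = v then F i else 0)
      - real m * (if i = u1 then F i else 0) - real n * (if i = u2 then F i else 0))"
      by (intro sum.cong) (auto simp: \<rho>_def algebra_simps)
    then show ?thesis by (simp add: sum.distrib sum_subtractf flip: sum_distrib_left)
  qed
  have "(\<Sum>i\<in>UNIV. \<rho> i * fst (b i)) = 0" "(\<Sum>i\<in>UNIV. \<rho> i * snd (b i)) = 0"
    using w1 w2 unfolding sum_int by (simp_all add: algebra_simps)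
  moreover have "(\<Sum>i\<in>UNIV. \<rho> i) = 0"
    using sum_int[of "\<lambda>_. 1"] by simp
  ultimately have ch: "\<rho> \<in> charge_lattice b" by (simp add: charge_lattice_def)
  have "(\<Sum>i\<in>UNIV. of_int (\<rho> i) * ln \<bar>a i\<bar>) \<le> ln \<epsilon>"
    by (rule charge_bound[OF t ch _ w]) (use w in \<open>auto simp: \<rho>_def\<close>)
  then have "ln \<bar>a w\<bar> - ln \<bar>a v\<bar> \<le> ln \<epsilon> + real m * (ln \<bar>a u1\<bar> - ln \<bar>a v\<bar>) + real n * (ln \<bar>a u2\<bar> - ln \<bar>a v\<bar>)"
    unfolding sum_real by (simp add: algebra_simps)
  also have "\<dots> = ln (\<epsilon> * \<bar>a u1 / a v\<bar> ^ m * \<bar>a u2 / a v\<bar> ^ n)"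
    using a_nz \<epsilon>(1) by (simp add: ln_mult ln_div ln_realpow abs_divide)
  also have "ln \<bar>a w\<bar> - ln \<bar>a v\<bar> = ln \<bar>a w / a v\<bar>"
    using a_nz by (simp add: ln_div abs_divide)
  finally show ?thesis using a_nz \<epsilon>(1) by (subst (asm) ln_le_cancel_iff) auto
qed

text \<open>The relation is \<open>v + w - 2 u\<close>, used with a triangle at \<open>u\<close>.
  The points \<open>v\<close> and \<open>w\<close> are collinear with \<open>u\<close>, so they are
  not both vertices of it, and \<rho> is positive somewhere off the triangle. This is the
  log-concavity along a side.\<close>

lemma coeff_edge_dominated:
  assumes w1: "fst (b v) + fst (b w) = 2 * fst (b u)" and w2: "snd (b v) + snd (b w) = 2 * snd (b u)" and "v \<noteq> w"
  shows "\<bar>a v\<bar> * \<bar>a w\<bar> \<le> \<epsilon> * a u ^ 2"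
proof -
  have "b v \<noteq> b w" using inj_b assms(3) by (auto dest: injD)
  then have uv: "u \<noteq> v" "u \<noteq> w" using w1 w2 by (auto simp: prod_eq_iff)
  have "\<Union>T = UNIV" using tri unfolding unimodular_triangulation_def by (elim conjE)
  then obtain \<sigma> where s: "\<sigma> \<in> T" "u \<in> \<sigma>" by (metis UNIV_I UnionE)
  obtain x y where xy: "\<sigma> = {u, x, y}" "\<bar>det2 (b u) (b x) (b y)\<bar> = 1"
    by (rule unimodular_triangle_vertex[OF tri s])
  have det0: "det2 (b u) (b v) (b w) = 0" "det2 (b u) (b w) (b v) = 0"
    using w1 w2 unfolding det2_def by algebra+
  have "\<not> (v \<in> \<sigma> \<and> w \<in> \<sigma>)"
  proof
    assume "v \<in> \<sigma> \<and> w \<in> \<sigma>"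
    then have "x = v \<and> y = w \<or> x = w \<and> y = v" using xy uv assms(3) by auto
    then show False using xy(2) det0 by auto
  qed
  then obtain j where j: "j \<notin> \<sigma>" "j = v \<or> j = w" by blast
  define \<rho> :: "'n \<Rightarrow> int" where "\<rho> i = (if i = v then 1 else 0) + (if i = w then 1 else 0) - 2 * (if i = u then 1 else 0)" for i
  have sum_int: "(\<Sum>i\<in>UNIV. \<rho> i * F i) = F v + F w - 2 * F u" for F
  proof -
    have "(\<Sum>i\<in>UNIV. \<rho> i * F i) = (\<Sum>i\<in>UNIV. (if i = v then F i else 0) + (if i = w then F i else 0) - 2 * (if i = u then F i else 0))"
      by (intro sum.cong) (auto simp: \<rho>_def algebra_simps)
    then show ?thesis by (simp add: sum.distrib sum_subtractf flip: sum_distrib_left)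
  qed
  have sum_real: "(\<Sum>i\<in>UNIV. of_int (\<rho> i) * F i) = F v + F w - 2 * F u" for F :: "'n \<Rightarrow> real"
  proof -
    have "(\<Sum>i\<in>UNIV. of_int (\<rho> i) * F i) = (\<Sum>i\<in>UNIV. (if i = v then F i else 0) + (if i = w then F i else 0) - 2 * (if i = u then F i else 0))"
      by (intro sum.cong) (auto simp: \<rho>_def algebra_simps)
    then show ?thesis by (simp add: sum.distrib sum_subtractf flip: sum_distrib_left)
  qed
  have "(\<Sum>i\<in>UNIV. \<rho> i) = 0" using sum_int[of "\<lambda>_. 1"] by simp
  then have ch: "\<rho> \<in> charge_lattice b" using w1 w2 by (simp add: charge_lattice_def sum_int)
  have "(\<Sum>i\<in>UNIV. of_int (\<rho> i) * ln \<bar>a i\<bar>) \<le> ln \<epsilon>"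
    by (rule charge_bound[OF s(1) ch _ j(1)]) (use s j uv assms(3) in \<open>auto simp: \<rho>_def\<close>)
  then have "ln \<bar>a v\<bar> + ln \<bar>a w\<bar> \<le> ln \<epsilon> + 2 * ln \<bar>a u\<bar>" unfolding sum_real by simp
  have ln_sq: "ln \<epsilon> + 2 * ln x = ln (\<epsilon> * x ^ 2)" if "x > 0" for x
    using that \<epsilon>(1) by (simp add: ln_mult ln_realpow)
  note \<open>ln \<bar>a v\<bar> + ln \<bar>a w\<bar> \<le> ln \<epsilon> + 2 * ln \<bar>a u\<bar>\<close>
  also have "ln \<epsilon> + 2 * ln \<bar>a u\<bar> = ln (\<epsilon> * \<bar>a u\<bar> ^ 2)" using a_nz by (intro ln_sq) simp
  also have "ln \<bar>a v\<bar> + ln \<bar>a w\<bar> = ln (\<bar>a v\<bar> * \<bar>a w\<bar>)"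
    using a_nz by (simp add: ln_mult)
  finally have "ln (\<bar>a v\<bar> * \<bar>a w\<bar>) \<le> ln (\<epsilon> * \<bar>a u\<bar> ^ 2)" .
  then show ?thesis using a_nz \<epsilon>(1) by (subst (asm) ln_le_cancel_iff) auto
qed

end

section \<open>Real projective space\<close>

lemma openin_RP_topology: "openin RP_topology U \<longleftrightarrow> RP_open U"
  unfolding RP_topology_def using topology_inverse'[OF istopology_RP_open] by metis

lemma proj_pt_self: "v \<in> proj_pt v"
  unfolding proj_pt_def by (auto intro: exI[of _ 1])

lemma proj_pt_eq_iff: "proj_pt v = proj_pt w \<longleftrightarrow> (\<exists>c. c \<noteq> 0 \<and> v = c *\<^sub>R w)"
proof
  assume "proj_pt v = proj_pt w"
  then have "v \<in> proj_pt w" using proj_pt_self by blast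
  then show "\<exists>c. c \<noteq> 0 \<and> v = c *\<^sub>R w" by (auto simp: proj_pt_def)
next
  assume "\<exists>c. c \<noteq> 0 \<and> v = c *\<^sub>R w"
  then obtain c where c: "c \<noteq> 0" "v = c *\<^sub>R w" by blast
  show "proj_pt v = proj_pt w"
  proof (intro equalityI subsetI)
    fix x assume "x \<in> proj_pt v"
    then show "x \<in> proj_pt w" using c by (auto simp: proj_pt_def)
  next
    fix x assume "x \<in> proj_pt w"
    then obtain r where "r \<noteq> 0" "x = (r / c) *\<^sub>R v" using c by (auto simp: proj_pt_def)
    then show "x \<in> proj_pt v" using c unfolding proj_pt_def by (auto intro!: exI[of _ "r / c"])
  qed
qed

lemma proj_pt_scaleR: "c \<noteq> 0 \<Longrightarrow> proj_pt (c *\<^sub>R v) = proj_pt v"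
  by (auto simp: proj_pt_eq_iff)

lemma topspace_RP_topology: "topspace RP_topology = proj_pt ` (UNIV - {0})"
proof
  show "topspace RP_topology \<subseteq> proj_pt ` (UNIV - {0})"
    using openin_topspace[of "RP_topology :: (real^'n) set topology"] unfolding openin_RP_topology RP_open_def by blast
  have eq: "{v :: real^'n. v \<noteq> 0 \<and> proj_pt v \<in> proj_pt ` (UNIV - {0})} = - {0}" by auto
  have "open (- {0 :: real^'n})" by auto
  then have "openin RP_topology (proj_pt ` (UNIV - {0 :: real^'n}))"
    unfolding openin_RP_topology RP_open_def eq by blast
  then show "proj_pt ` (UNIV - {0 :: real^'n}) \<subseteq> topspace RP_topology" by (rule openin_subset)
qed

lemma continuous_map_proj_pt:
  fixes g :: "'a::topological_space \<Rightarrow> real^'n"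
  assumes "continuous_on A g" "\<And>x. x \<in> A \<Longrightarrow> g x \<noteq> 0"
  shows "continuous_map (top_of_set A) RP_topology (\<lambda>x. proj_pt (g x))"
  unfolding continuous_map
proof (intro conjI allI impI)
  show "(\<lambda>x. proj_pt (g x)) ` topspace (top_of_set A) \<subseteq> topspace RP_topology"
    using assms(2) by (auto simp: topspace_RP_topology)
  fix U :: "(real^'n) set set"
  assume "openin RP_topology U"
  then have "open {v. v \<noteq> 0 \<and> proj_pt v \<in> U}" by (simp add: openin_RP_topology RP_open_def)
  then have "openin (top_of_set A) (A \<inter> g -` {v. v \<noteq> 0 \<and> proj_pt v \<in> U})"
    by (rule continuous_openin_preimage_gen[OF assms(1)])
  moreover have "A \<inter> g -` {v. v \<noteq> 0 \<and> proj_pt v \<in> U} = {x \<in> topspace (top_of_set A). proj_pt (g x) \<in> U}"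
    using assms(2) by auto
  ultimately show "openin (top_of_set A) {x \<in> topspace (top_of_set A). proj_pt (g x) \<in> U}" by simp
qed

text \<open>A closed cone has a closed image, as the preimage of the complement is the complement of
  the cone. This lets homogeneous equations pass to the closure of the curve.\<close>

lemma closure_of_homogeneous:
  fixes C :: "(real^'n) set"
  assumes C: "closed C" and hom: "\<And>c v. v \<in> C \<Longrightarrow> c *\<^sub>R v \<in> C" and S: "S \<subseteq> proj_pt ` (C - {0})"
  shows "RP_topology closure_of S \<subseteq> proj_pt ` (C - {0})"
proof (rule closure_of_minimal[OF S])
  have inC: "v \<in> C" if "proj_pt v = proj_pt w" "w \<in> C" for v w
    using that hom by (auto simp: proj_pt_eq_iff)
  have eq: "topspace RP_topology - proj_pt ` (C - {0}) = proj_pt ` (- C - {0})"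
  proof (intro equalityI subsetI)
    fix x assume "x \<in> topspace RP_topology - proj_pt ` (C - {0})"
    then show "x \<in> proj_pt ` (- C - {0})" by (auto simp: topspace_RP_topology)
  next
    fix x assume "x \<in> proj_pt ` (- C - {0})"
    then obtain v where v: "x = proj_pt v" "v \<notin> C" "v \<noteq> 0" by auto
    then have "x \<notin> proj_pt ` (C - {0})" using inC by blast
    then show "x \<in> topspace RP_topology - proj_pt ` (C - {0})" using v by (auto simp: topspace_RP_topology)
  qed
  have pre: "{v. v \<noteq> 0 \<and> proj_pt v \<in> proj_pt ` (- C - {0})} = - C - {0}"
  proof (intro equalityI subsetI)
    fix v assume "v \<in> {v. v \<noteq> 0 \<and> proj_pt v \<in> proj_pt ` (- C - {0})}"
    then obtain w where w: "v \<noteq> 0" "proj_pt v = proj_pt w" "w \<notin> C" by auto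
    then have "v \<notin> C" using inC[of w v] by metis
    then show "v \<in> - C - {0}" using w by simp
  qed auto
  have "open (- C - {0})" using C by (intro open_Diff) auto
  moreover have "proj_pt ` (- C - {0}) \<subseteq> proj_pt ` (UNIV - {0})" by (intro image_mono) auto
  ultimately have "openin RP_topology (proj_pt ` (- C - {0}))"
    unfolding openin_RP_topology RP_open_def pre by (intro conjI)
  then show "closedin RP_topology (proj_pt ` (C - {0}))"
    unfolding closedin_def eq using C by (auto simp: topspace_RP_topology)
qed

lemma power_int_affine:
  fixes x :: real
  assumes "x \<noteq> 0"
  shows "x powi (m + k * i + l * j) = x powi m * (x powi i) powi k * (x powi j) powi l"
  using assms by (simp add: power_int_add mult.commute flip: power_int_mult)

lemma odd_if_abs_eq_1: "\<bar>x\<bar> = 1 \<Longrightarrow> odd x" for x :: int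
  by (metis dvd_abs_iff odd_one)

lemma parity_sign_cases: "parity_sign m = 1 \<or> parity_sign m = -1"
  by (simp add: parity_sign_def)

lemma parity_sign_add: "parity_sign m * parity_sign n = parity_sign (m + n)"
  by (auto simp: parity_sign_def)

lemma parity_sign_power: "parity_sign m ^ n = parity_sign (m * int n)"
  by (auto simp: parity_sign_def)

lemma parity_sign_power_int: "parity_sign m powi n = parity_sign (m * n)"
  using power_int_minus_left_even[of n "1::real"] power_int_minus_left_odd[of n "1::real"]
  by (auto simp: parity_sign_def)

lemma parity_sign_eq_iff: "parity_sign m = parity_sign n \<longleftrightarrow> even (m + n)"
  by (auto simp: parity_sign_def)

section \<open>The mirror curve in the chart of a side\<close>

locale real_mirror_side = real_mirror b p T \<sigma>1 h s q D \<epsilon> K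
  for b :: "'n::finite \<Rightarrow> int \<times> int" and p T \<sigma>1 h s q D \<epsilon> K +
  fixes E :: "'n set" and e f b0 :: "int \<times> int" and k :: "'n \<Rightarrow> int" and l :: "'n \<Rightarrow> nat"
    and d :: nat and ev :: "nat \<Rightarrow> 'n"
  assumes side: "is_side b E" and det: "fst e * snd f - snd e * fst f = 1"
    and b_fst: "\<And>i. fst (b i) = fst b0 + k i * fst e + int (l i) * fst f"
    and b_snd: "\<And>i. snd (b i) = snd b0 + k i * snd e + int (l i) * snd f"
    and l_0_iff: "\<And>i. l i = 0 \<longleftrightarrow> i \<in> E" and d: "d \<ge> 1" "card E = d + 1"
    and ev: "\<And>j. j \<le> d \<Longrightarrow> k (ev j) = int j" "\<And>j. j \<le> d \<Longrightarrow> ev j \<in> E"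
      "\<And>i. i \<in> E \<Longrightarrow> \<exists>j\<le>d. i = ev j"
begin

lemma k_diff: "k i - k j = (fst (b i) - fst (b j)) * snd f - (snd (b i) - snd (b j)) * fst f"
  using det unfolding b_fst b_snd by algebra

lemma l_diff: "int (l i) - int (l j) = fst e * (snd (b i) - snd (b j)) - snd e * (fst (b i) - fst (b j))"
  using det unfolding b_fst b_snd by algebra

lemma det2_chart: "l v = 0 \<Longrightarrow> det2 (b v) (b i) (b j) = (k i - k v) * int (l j) - (k j - k v) * int (l i)"
proof -
  assume "l v = 0"
  then have lx: "int (l x) = fst e * (snd (b x) - snd (b v)) - snd e * (fst (b x) - fst (b v))" for x
    using l_diff[of x v] by simp
  then show ?thesis using det unfolding det2_def k_diff lx by algebra
qed

lemma even_chart_iff: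
  "even (fst (b i) - fst (b j)) \<and> even (snd (b i) - snd (b j)) \<longleftrightarrow> even (k i - k j) \<and> even (int (l i) - int (l j))"
proof -
  have "fst (b i) - fst (b j) = (k i - k j) * fst e + (int (l i) - int (l j)) * fst f"
    "snd (b i) - snd (b j) = (k i - k j) * snd e + (int (l i) - int (l j)) * snd f"
    unfolding b_fst b_snd by (simp_all add: algebra_simps)
  then show ?thesis
    using k_diff[of i j] l_diff[of i j] by (metis dvd_add dvd_diff dvd_mult dvd_mult2)
qed

text \<open>By \<open>odd_product_chart\<close> the parity of the product of exponents is a constant
  plus a linear part plus \<open>k * l\<close>. The overall sign \<open>\<kappa>\<close> and the
  signs \<open>sx\<close>, \<open>sy\<close> of the chart coordinates remove the constant and the
  linear part; the extra 1 in \<open>sx\<close> leaves \<open>k * (1 + l)\<close>, odd exactly where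
  \<open>side_chart\<close> wants a negative coefficient.\<close>

definition sx :: real where
  "sx = parity_sign (fst b0 * snd e + snd b0 * fst e + fst e * snd e + 1)"

definition sy :: real where
  "sy = parity_sign (fst b0 * snd f + snd b0 * fst f + fst f * snd f)"

definition \<kappa> :: real where
  "\<kappa> = parity_sign (fst b0 * snd b0)"

definition c :: "'n \<Rightarrow> real" where
  "c i = \<kappa> * a i * sx powi k i * sy ^ l i"

lemma sx_cases: "sx = 1 \<or> sx = -1" and sy_cases: "sy = 1 \<or> sy = -1" and \<kappa>_cases: "\<kappa> = 1 \<or> \<kappa> = -1"
  unfolding sx_def sy_def \<kappa>_def by (rule parity_sign_cases)+

lemma abs_c: "\<bar>c i\<bar> = \<bar>a i\<bar>"
proof -
  have "\<bar>sx powi k i\<bar> = 1" "\<bar>sy ^ l i\<bar> = 1"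
    unfolding sx_def sy_def parity_sign_power_int parity_sign_power by (simp_all add: parity_sign_def)
  then show ?thesis using \<kappa>_cases by (auto simp: c_def abs_mult)
qed

lemma c_sign: "c i = parity_sign (k i * (1 + int (l i))) * \<bar>a i\<bar>"
proof -
  define A where "A = \<bar>a i\<bar>"
  have aA: "a i = parity_sign (fst (b i) * snd (b i)) * A"
    using odd_neg[of i] even_pos[of i] unfolding A_def a_def by (auto simp: parity_sign_def)
  have par: "even (Q + P + (\<alpha> + 1) * m + \<beta> * n + m * (1 + n))"
    if "odd P \<longleftrightarrow> odd (Q + m * \<alpha> + n * \<beta> + m * n)" for P Q \<alpha> \<beta> m n :: int
    using that by (cases "odd m"; cases "odd n") auto
  have "c i = (\<kappa> * parity_sign (fst (b i) * snd (b i)) * sx powi k i * sy ^ l i) * A"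
    by (simp only: c_def aA ac_simps)
  also have "\<kappa> * parity_sign (fst (b i) * snd (b i)) * sx powi k i * sy ^ l i = parity_sign (k i * (1 + int (l i)))"
    unfolding \<kappa>_def sx_def sy_def parity_sign_power parity_sign_power_int parity_sign_add parity_sign_eq_iff
    by (rule par) (simp only: b_fst b_snd odd_product_chart[OF det])
  finally show ?thesis by (simp only: A_def)
qed

sublocale chart: side_chart k l c d ev D \<epsilon> K
proof
  show "CARD('n) \<ge> 2" using card_n by simp
  show "K = real CARD('n) ^ 2 + 2" by (rule K)
  show "0 \<le> \<epsilon>" "4 * real CARD('n) * real D * K ^ (D + 1) * \<epsilon> \<le> 1" "D \<ge> 1" "d \<ge> 1"
    using \<epsilon> D d by auto
  show "k (ev j) = int j" if "j \<le> d" for j using ev(1)[OF that] .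
  show "l (ev j) = 0" if "j \<le> d" for j using ev(2)[OF that] by (simp add: l_0_iff)
  show "\<exists>j\<le>d. i = ev j" if "l i = 0" for i using ev(3) that by (simp add: l_0_iff)
  show "c i < 0" if "odd (k i)" "even (l i)" for i
    unfolding c_sign using that a_nz by (simp add: parity_sign_def)
  show "c i > 0" if "even (k i) \<or> odd (l i)" for i
    unfolding c_sign using that a_nz by (auto simp: parity_sign_def)
  \<comment> \<open>A triangle at \<open>v\<close> has odd determinant, so another of its vertices
    has odd height over the side.\<close>
  show "\<exists>u. l u > 0 \<and> (odd (k u - k v) \<or> odd (l u))" if v: "l v = 0" for v
  proof -
    obtain u1 u2 where "\<bar>det2 (b v) (b u1) (b u2)\<bar> = 1" using cones[of v v] by blast
    then have "odd ((k u1 - k v) * int (l u2) - (k u2 - k v) * int (l u1))"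
      unfolding det2_chart[OF v] by (rule odd_if_abs_eq_1)
    then have "odd (l u1) \<or> odd (l u2)" by auto
    then show ?thesis by (metis odd_pos)
  qed
  show "\<bar>c (ev j)\<bar> * \<bar>c (ev (j + 2))\<bar> \<le> \<epsilon> * c (ev (j + 1)) ^ 2" if j: "j + 2 \<le> d" for j
  proof -
    have "l (ev j) = 0" "l (ev (j + 1)) = 0" "l (ev (j + 2)) = 0" using ev(2) j by (simp_all add: l_0_iff)
    moreover have "k (ev j) = int j" "k (ev (j + 1)) = int j + 1" "k (ev (j + 2)) = int j + 2" using ev(1) j by simp_all
    ultimately have "\<bar>a (ev j)\<bar> * \<bar>a (ev (j + 2))\<bar> \<le> \<epsilon> * a (ev (j + 1)) ^ 2"
      by (intro coeff_edge_dominated) (auto simp: b_fst b_snd algebra_simps)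
    then show ?thesis unfolding abs_c using abs_c[of "ev (j + 1)"] by (metis power2_abs)
  qed
  show "\<exists>u1 u2 m n. (odd (k u1 - k v) \<or> odd (l u1)) \<and> (odd (k u2 - k v) \<or> odd (l u2)) \<and> 1 \<le> m + n \<and> m + n \<le> D
      \<and> k w - k v = int m * (k u1 - k v) + int n * (k u2 - k v) \<and> l w = m * l u1 + n * l u2
      \<and> \<bar>c w / c v\<bar> \<le> \<epsilon> * \<bar>c u1 / c v\<bar> ^ m * \<bar>c u2 / c v\<bar> ^ n"
    if v: "l v = 0" and ev: "even (k w - k v)" "even (l w)" and "w \<noteq> v" for v w
  proof -
    obtain u1 u2 m n where t: "{v, u1, u2} \<in> T" and dt: "\<bar>det2 (b v) (b u1) (b u2)\<bar> = 1" and D: "m + n \<le> D"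
      and w1: "fst (b w) - fst (b v) = int m * (fst (b u1) - fst (b v)) + int n * (fst (b u2) - fst (b v))"
      and w2: "snd (b w) - snd (b v) = int m * (snd (b u1) - snd (b v)) + int n * (snd (b u2) - snd (b v))"
      using cones[of v w] by blast
    have kw: "k w - k v = int m * (k u1 - k v) + int n * (k u2 - k v)"
      unfolding k_diff w1 w2 by (simp add: algebra_simps)
    have "int (l w) - int (l v) = int m * (int (l u1) - int (l v)) + int n * (int (l u2) - int (l v))"
      unfolding l_diff w1 w2 by (simp add: algebra_simps)
    then have "int (l w) = int (m * l u1 + n * l u2)" using v by simp
    then have lw: "l w = m * l u1 + n * l u2" by (simp only: of_nat_eq_iff)
    have od: "odd ((k u1 - k v) * int (l u2) - (k u2 - k v) * int (l u1))"
      using dt unfolding det2_chart[OF v] by (rule odd_if_abs_eq_1)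
    have evm: "even (int m * (k u1 - k v) + int n * (k u2 - k v))" "even (m * l u1 + n * l u2)"
      using ev unfolding kw lw by auto
    \<comment> \<open>A matrix with odd determinant is invertible modulo 2.\<close>
    have "even m \<and> even n"
      using od evm by auto
    moreover have "m + n \<noteq> 0"
    proof
      assume "m + n = 0"
      then have "b w = b v" using w1 w2 by (simp add: prod_eq_iff)
      then show False using inj_b \<open>w \<noteq> v\<close> by (auto dest: injD)
    qed
    ultimately have mn: "m + n \<ge> 2" by presburger
    have "\<bar>c w / c v\<bar> \<le> \<epsilon> * \<bar>c u1 / c v\<bar> ^ m * \<bar>c u2 / c v\<bar> ^ n"
      using coeff_dominated[OF t dt w1 w2 mn] unfolding abs_divide abs_c .
    moreover have "odd (k u1 - k v) \<or> odd (l u1)" "odd (k u2 - k v) \<or> odd (l u2)"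
      using od by auto
    moreover have "1 \<le> m + n" using mn by simp
    ultimately show ?thesis using kw lw D
      by (intro exI[of _ u1] exI[of _ u2] exI[of _ m] exI[of _ n] conjI)
  qed
qed

end

context real_mirror
begin

text \<open>The points of the curve in the quadrant whose terms congruent to \<open>v\<close> modulo 2 have the sign of
  the \<open>v\<close>-term, while all others have the opposite sign, and where the \<open>v\<close>-term is not too small.
  They lie on the branch of every side through \<open>v\<close>, which makes the branches of all sides connected.\<close>

definition corner :: "'n \<Rightarrow> (real^'n) set set" where
  "corner v = {toric_map b (X, Y) | X Y. X \<noteq> 0 \<and> Y \<noteq> 0 \<and> mirror_poly b \<sigma>1 p s X Y q = 0
    \<and> sgn X = parity_sign (snd (b v) + 1) \<and> sgn Y = parity_sign (fst (b v) + 1)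
    \<and> (\<Sum>i | \<not> (even (fst (b i) - fst (b v)) \<and> even (snd (b i) - snd (b v))).
        \<bar>a i * X powi fst (b i) * Y powi snd (b i)\<bar> / \<bar>a v * X powi fst (b v) * Y powi snd (b v)\<bar>) \<le> K}"

end

context real_mirror_side
begin

text \<open>Homogeneous coordinates with the common monomial at \<open>b0\<close> divided out. As
  the exponents \<open>l i\<close> are natural numbers, they extend to \<open>y = 0\<close>, that
  is, to the axis of the side.\<close>

definition branch_vec :: "real \<Rightarrow> real \<Rightarrow> real^'n" where
  "branch_vec z y = (\<chi> i. (sx * exp z) powi k i * (sy * y) ^ l i)"

lemma torus_chart:
  fixes X Y x y :: real
  assumes "X \<noteq> 0" "Y \<noteq> 0" "x = X powi fst e * Y powi snd e" "y = X powi fst f * Y powi snd f"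
  shows "X powi fst (b i) * Y powi snd (b i) = (X powi fst b0 * Y powi snd b0) * (x powi k i * y ^ l i)"
proof -
  have "X powi fst (b i) = X powi fst b0 * (X powi fst e) powi k i * (X powi fst f) powi int (l i)"
    unfolding b_fst by (rule power_int_affine[OF assms(1)])
  moreover have "Y powi snd (b i) = Y powi snd b0 * (Y powi snd e) powi k i * (Y powi snd f) powi int (l i)"
    unfolding b_snd by (rule power_int_affine[OF assms(2)])
  ultimately show ?thesis
    unfolding assms(3,4) by (simp only: power_int_mult_distrib power_mult_distrib power_int_of_nat ac_simps)
qed

lemma chart_inverse:
  fixes X Y x y :: real
  assumes "x \<noteq> 0" "y \<noteq> 0" "X = x powi snd f * y powi (- snd e)" "Y = x powi (- fst f) * y powi fst e"
  shows "X \<noteq> 0" "Y \<noteq> 0" "x = X powi fst e * Y powi snd e" "y = X powi fst f * Y powi snd f"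
proof -
  show "X \<noteq> 0" "Y \<noteq> 0" using assms by simp_all
  have *: "X powi i * Y powi j = x powi (snd f * i - fst f * j) * y powi (- snd e * i + fst e * j)" for i j
  proof -
    have "x powi (snd f * i - fst f * j) = x powi (snd f * i) * x powi (- fst f * j)"
      using assms(1) power_int_add[of x "snd f * i" "- fst f * j"] by simp
    moreover have "y powi (- snd e * i + fst e * j) = y powi (- snd e * i) * y powi (fst e * j)"
      using assms(2) by (intro power_int_add) simp
    ultimately show ?thesis
      unfolding assms(3,4) by (simp only: power_int_mult_distrib power_int_mult[symmetric] ac_simps)
  qed
  have "snd f * fst e - fst f * snd e = 1" "- snd e * fst e + fst e * snd e = 0"
    "snd f * fst f - fst f * snd f = 0" "- snd e * fst f + fst e * snd f = 1"
    using det by (simp_all add: mult.commute)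
  then show "x = X powi fst e * Y powi snd e" "y = X powi fst f * Y powi snd f"
    unfolding * by simp_all
qed

lemma sx_powi: "(sx * exp z) powi n = sx powi n * exp (of_int n * z)"
  by (simp add: power_int_mult_distrib exp_power_int)

lemma toric_map_chart:
  assumes X: "X \<noteq> 0" "Y \<noteq> 0" and x: "sx * exp z = X powi fst e * Y powi snd e" and y: "sy * y = X powi fst f * Y powi snd f"
  shows "toric_map b (X, Y) = proj_pt (branch_vec z y)"
proof -
  have "(\<chi> i. fst (X, Y) powi fst (b i) * snd (X, Y) powi snd (b i)) = (X powi fst b0 * Y powi snd b0) *\<^sub>R branch_vec z y"
    using torus_chart[OF X x y] by (simp add: vec_eq_iff branch_vec_def)
  then show ?thesis unfolding toric_map_def using X by (simp add: proj_pt_scaleR)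
qed

lemma mirror_poly_chart:
  assumes X: "X \<noteq> 0" "Y \<noteq> 0" and x: "sx * exp z = X powi fst e * Y powi snd e" and y: "sy * y = X powi fst f * Y powi snd f"
  shows "mirror_poly b \<sigma>1 p s X Y q = 0 \<longleftrightarrow> chart.G z y = 0"
proof -
  define M where "M = X powi fst b0 * Y powi snd b0"
  have M: "M \<noteq> 0" using X by (simp add: M_def)
  have "a i * X powi fst (b i) * Y powi snd (b i) = (M * \<kappa>) * (c i * exp (of_int (k i) * z) * y ^ l i)" for i
  proof -
    have "a i * X powi fst (b i) * Y powi snd (b i) = a i * (M * ((sx powi k i * exp (of_int (k i) * z)) * (sy * y) ^ l i))"
      using torus_chart[OF X x y, of i] by (simp add: M_def sx_powi mult.assoc)
    moreover have "\<kappa> * \<kappa> = 1" using \<kappa>_cases by auto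
    moreover have "(M * \<kappa>) * (\<kappa> * A * B * C * F * G) = (\<kappa> * \<kappa>) * (A * (M * ((B * F) * (C * G))))" for A B C F G
      by (simp only: ac_simps)
    ultimately show ?thesis unfolding c_def power_mult_distrib by (simp only: mult_1)
  qed
  then have "mirror_poly b \<sigma>1 p s X Y q = (M * \<kappa>) * chart.G z y"
    unfolding mirror_poly_def chart.G_def a_def[symmetric] sum_distrib_left by simp
  then show ?thesis using M \<kappa>_cases by auto
qed

lemma rel_chart:
  assumes X: "X \<noteq> 0" "Y \<noteq> 0" and x: "\<bar>X powi fst e * Y powi snd e\<bar> = exp z" and y: "\<bar>X powi fst f * Y powi snd f\<bar> = t"
    and v: "l v = 0"
  shows "\<bar>a i * X powi fst (b i) * Y powi snd (b i)\<bar> / \<bar>a v * X powi fst (b v) * Y powi snd (b v)\<bar> = chart.rel v i z t"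
proof -
  define M where "M = \<bar>X powi fst b0 * Y powi snd b0\<bar>"
  have M: "M > 0" using X by (simp add: M_def)
  have "\<bar>X powi fst (b i) * Y powi snd (b i)\<bar> = M * (exp (of_int (k i) * z) * t ^ l i)" for i
    unfolding torus_chart[OF X refl refl] using x y
    by (simp add: abs_mult M_def power_int_abs power_abs exp_power_int)
  then have *: "\<bar>a i * X powi fst (b i) * Y powi snd (b i)\<bar> = \<bar>a i\<bar> * (M * (exp (of_int (k i) * z) * t ^ l i))" for i
    by (simp add: abs_mult mult.assoc)
  show ?thesis
    unfolding * chart.rel_def abs_divide abs_c using M v a_nz by (simp add: left_diff_distrib exp_diff field_simps)
qed

text \<open>With \<open>sign_y\<close>, this shows that the quadrant prescribed by
  \<open>corner v\<close> is, in the chart of any side through \<open>v\<close>, the half-plane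
  \<open>\<sigma> v\<close>. The parity to check is that of
  \<open>(fst e + 1) * (snd e + 1)\<close>, even because the entries of \<open>e\<close> are not
  both even.\<close>

lemma sign_x:
  assumes "l v = 0"
  shows "parity_sign ((snd (b v) + 1) * fst e + (fst (b v) + 1) * snd e) = sx"
proof -
  have "even ((n + k * e2 + 1) * e1 + (m + k * e1 + 1) * e2 + (m * e2 + n * e1 + e1 * e2 + 1))"
    if "e1 * f2 - e2 * f1 = 1" for m n k e1 e2 f1 f2 :: int
  proof -
    have "odd (e1 * f2 - e2 * f1)" using that by simp
    then show ?thesis by (cases "odd e1"; cases "odd e2") auto
  qed
  from this[OF det] show ?thesis
    unfolding sx_def parity_sign_eq_iff b_fst b_snd using assms by simp
qed

lemma sign_y:
  assumes "l v = 0"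
  shows "parity_sign ((snd (b v) + 1) * fst f + (fst (b v) + 1) * snd f) = sy * chart.\<sigma> v"
proof -
  have \<sigma>: "chart.\<sigma> v = parity_sign (k v + 1)" by (simp add: chart.\<sigma>_def parity_sign_def)
  have "even ((n + k * e2 + 1) * f1 + (m + k * e1 + 1) * f2 + (m * f2 + n * f1 + f1 * f2 + (k + 1)))"
    if "e1 * f2 - e2 * f1 = 1" for m n k e1 e2 f1 f2 :: int
  proof -
    have "odd (e1 * f2 - e2 * f1)" using that by simp
    then show ?thesis by (cases "odd f1"; cases "odd f2"; cases "odd k") auto
  qed
  from this[OF det] show ?thesis
    unfolding sy_def \<sigma> parity_sign_add parity_sign_eq_iff b_fst b_snd using assms by simp
qed

lemma cong_chart_iff:
  "l v = 0 \<Longrightarrow> even (fst (b i) - fst (b v)) \<and> even (snd (b i) - snd (b v)) \<longleftrightarrow> chart.cong i v"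
  unfolding even_chart_iff chart.cong_def by simp

definition branch :: "(real^'n) set set" where
  "branch = range (\<lambda>z. proj_pt (branch_vec z (chart.yf z)))"

text \<open>\<open>corner v\<close> is described in the torus coordinates alone, and in the chart of
  any side through \<open>v\<close> its conditions say that the point is a bounded root. So the
  branches of sides with the common point \<open>v\<close> share it.\<close>

lemma corner_subset_branch:
  assumes v: "v \<in> E"
  shows "corner v \<subseteq> branch"
proof
  fix w assume "w \<in> corner v"
  then obtain X Y where w: "w = toric_map b (X, Y)" and X: "X \<noteq> 0" "Y \<noteq> 0"
    and H: "mirror_poly b \<sigma>1 p s X Y q = 0"
    and sg: "sgn X = parity_sign (snd (b v) + 1)" "sgn Y = parity_sign (fst (b v) + 1)"
    and S: "(\<Sum>i | \<not> (even (fst (b i) - fst (b v)) \<and> even (snd (b i) - snd (b v))).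
        \<bar>a i * X powi fst (b i) * Y powi snd (b i)\<bar> / \<bar>a v * X powi fst (b v) * Y powi snd (b v)\<bar>) \<le> K"
    unfolding corner_def by blast
  have lv: "l v = 0" using v by (simp add: l_0_iff)
  define x where "x = X powi fst e * Y powi snd e"
  define y where "y = X powi fst f * Y powi snd f"
  define z where "z = ln \<bar>x\<bar>"
  define t where "t = \<bar>y\<bar>"
  have nz: "x \<noteq> 0" "y \<noteq> 0" using X by (simp_all add: x_def y_def)
  have ez: "exp z = \<bar>x\<bar>" using nz by (simp add: z_def)
  have "sgn x = sx" "sgn y = sy * chart.\<sigma> v"
    unfolding x_def y_def sgn_mult power_int_sgn sg parity_sign_power_int parity_sign_add
    using sign_x[OF lv] sign_y[OF lv] by simp_all
  then have x: "sx * exp z = x" and y: "sy * (chart.\<sigma> v * t) = y"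
    using mult_sgn_abs[of x] mult_sgn_abs[of y] unfolding ez t_def by (simp_all add: mult.assoc)
  have "chart.S v z t \<le> K"
    using S unfolding chart.S_def cong_chart_iff[OF lv]
    using rel_chart[OF X _ _ lv, of z t] by (simp add: ez t_def x_def y_def)
  moreover have "chart.G z (chart.\<sigma> v * t) = 0"
    using H mirror_poly_chart[OF X, of z "chart.\<sigma> v * t"] x y unfolding x_def y_def by simp
  ultimately have "chart.yf z = chart.\<sigma> v * t"
    using lv by (intro chart.yf_eq) (auto simp: t_def)
  then have "w = proj_pt (branch_vec z (chart.yf z))"
    unfolding w using toric_map_chart[OF X, of z "chart.\<sigma> v * t"] x y unfolding x_def y_def by simp
  then show "w \<in> branch" by (auto simp: branch_def)
qed

lemma corner_nonempty:
  assumes v: "v \<in> E"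
  shows "corner v \<noteq> {}"
proof -
  have lv: "l v = 0" using v by (simp add: l_0_iff)
  obtain z t where t: "t > 0" "chart.S v z t \<le> K" "chart.G z (chart.\<sigma> v * t) = 0"
    using chart.ex_curve_pt_near[OF lv] by blast
  define x where "x = sx * exp z"
  define y where "y = sy * (chart.\<sigma> v * t)"
  have xy: "x \<noteq> 0" "y \<noteq> 0"
    using sx_cases sy_cases chart.\<sigma>_cases[of v] t by (auto simp: x_def y_def)
  have ab: "\<bar>x\<bar> = exp z" "\<bar>y\<bar> = t"
    using sx_cases sy_cases chart.\<sigma>_cases[of v] t by (auto simp: x_def y_def)
  have sg: "sgn x = parity_sign ((snd (b v) + 1) * fst e + (fst (b v) + 1) * snd e)"
    "sgn y = parity_sign ((snd (b v) + 1) * fst f + (fst (b v) + 1) * snd f)"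
    unfolding sign_x[OF lv] sign_y[OF lv]
    using sx_cases sy_cases chart.\<sigma>_cases[of v] t by (auto simp: x_def y_def)
  define X where "X = x powi snd f * y powi (- snd e)"
  define Y where "Y = x powi (- fst f) * y powi fst e"
  note XY = chart_inverse[OF xy X_def Y_def]
  have "sgn X = parity_sign (snd (b v) + 1)" "sgn Y = parity_sign (fst (b v) + 1)"
  proof -
    have "((snd (b v) + 1) * fst e + (fst (b v) + 1) * snd e) * snd f +
      ((snd (b v) + 1) * fst f + (fst (b v) + 1) * snd f) * (- snd e) = snd (b v) + 1"
      "((snd (b v) + 1) * fst e + (fst (b v) + 1) * snd e) * (- fst f) +
      ((snd (b v) + 1) * fst f + (fst (b v) + 1) * snd f) * fst e = fst (b v) + 1"
      using det by algebra+
    then show "sgn X = parity_sign (snd (b v) + 1)" "sgn Y = parity_sign (fst (b v) + 1)"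
      unfolding X_def Y_def sgn_mult power_int_sgn sg parity_sign_power_int parity_sign_add by simp_all
  qed
  moreover have "mirror_poly b \<sigma>1 p s X Y q = 0"
    using mirror_poly_chart[OF XY(1,2), of z "chart.\<sigma> v * t"] XY(3,4) t(3) by (simp add: x_def y_def)
  moreover have "(\<Sum>i | \<not> (even (fst (b i) - fst (b v)) \<and> even (snd (b i) - snd (b v))).
        \<bar>a i * X powi fst (b i) * Y powi snd (b i)\<bar> / \<bar>a v * X powi fst (b v) * Y powi snd (b v)\<bar>) \<le> K"
    using t(2) unfolding chart.S_def cong_chart_iff[OF lv]
    using rel_chart[OF XY(1,2) _ _ lv, of z t] ab XY(3,4) by simp
  ultimately have "toric_map b (X, Y) \<in> corner v" using XY(1,2) unfolding corner_def by blast
  then show ?thesis by blast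
qed

end

context real_mirror_side
begin

lemma branch_vec_ev: "j \<le> d \<Longrightarrow> branch_vec z y $ ev j = (sx * exp z) ^ j"
  using ev(1)[of j] ev(2)[of j] l_0_iff[of "ev j"] by (simp add: branch_vec_def)

lemma branch_vec_ev_0: "branch_vec z y $ ev 0 = 1"
  by (simp add: branch_vec_ev)

lemma branch_vec_nonzero: "branch_vec z y \<noteq> 0"
  using branch_vec_ev_0[of z y] by auto

lemma continuous_branch_vec: "continuous_on A (\<lambda>z. branch_vec z (chart.yf z))"
  unfolding branch_vec_def sx_powi
  by (intro continuous_on_vec_lambda continuous_intros continuous_on_subset[OF chart.continuous_yf]) auto

lemma continuous_map_branch:
  "continuous_map (top_of_set A) RP_topology (\<lambda>z. proj_pt (branch_vec z (chart.yf z)))"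
  by (rule continuous_map_proj_pt[OF continuous_branch_vec branch_vec_nonzero])

lemma connectedin_branch: "connectedin RP_topology branch"
  unfolding branch_def using continuous_map_branch[of UNIV]
  by (intro connectedin_continuous_map_image[of euclideanreal]) (auto simp: subtopology_UNIV)

lemma branch_off_axis_in_curve:
  assumes "chart.yf z \<noteq> 0"
  shows "proj_pt (branch_vec z (chart.yf z)) \<in> toric_map b ` {(x, y) \<in> real_torus. mirror_poly b \<sigma>1 p s x y q = 0}"
proof -
  define x where "x = sx * exp z"
  define y where "y = sy * chart.yf z"
  have xy: "x \<noteq> 0" "y \<noteq> 0" using sx_cases sy_cases assms by (auto simp: x_def y_def)
  define X where "X = x powi snd f * y powi (- snd e)"
  define Y where "Y = x powi (- fst f) * y powi fst e"
  note XY = chart_inverse[OF xy X_def Y_def]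
  have "toric_map b (X, Y) = proj_pt (branch_vec z (chart.yf z))"
    using toric_map_chart[OF XY(1,2), of z "chart.yf z"] XY(3,4) by (simp add: x_def y_def)
  moreover have "mirror_poly b \<sigma>1 p s X Y q = 0"
    using mirror_poly_chart[OF XY(1,2), of z "chart.yf z"] XY(3,4) chart.G_yf by (simp add: x_def y_def)
  moreover have "(X, Y) \<in> real_torus" using XY(1,2) by (simp add: real_torus_def)
  ultimately show ?thesis by (auto intro!: image_eqI[of _ _ "(X, Y)"])
qed

text \<open>Only finitely many parameters give points on the axis; the others give points of the
  curve in the torus and are dense.\<close>

lemma branch_subset: "branch \<subseteq> mirror_curve_closure b \<sigma>1 p s q"
proof -
  let ?g = "\<lambda>z. proj_pt (branch_vec z (chart.yf z))" and ?U = "- {z. chart.yf z = 0}"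
  have "closure ?U = UNIV"
    unfolding closure_complement using chart.finite_zeros by (simp add: empty_interior_finite)
  then have "branch = ?g ` (euclidean closure_of ?U)" by (simp add: branch_def)
  also have "\<dots> \<subseteq> RP_topology closure_of (?g ` ?U)"
    using continuous_map_branch[of UNIV] by (intro continuous_map_image_closure_subset) (simp add: subtopology_UNIV)
  also have "\<dots> \<subseteq> mirror_curve_closure b \<sigma>1 p s q"
    unfolding mirror_curve_closure_def using branch_off_axis_in_curve by (intro closure_of_mono) auto
  finally show ?thesis .
qed

lemma curve_closure_subset_surface: "mirror_curve_closure b \<sigma>1 p s q \<subseteq> real_toric_surface b"
  unfolding mirror_curve_closure_def real_toric_surface_def by (intro closure_of_mono) auto

lemma branch_axis_iff: "proj_pt (branch_vec z (chart.yf z)) \<in> axis b E \<longleftrightarrow> chart.yf z = 0"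
proof
  assume "proj_pt (branch_vec z (chart.yf z)) \<in> axis b E"
  then have 0: "branch_vec z (chart.yf z) $ i = 0" if "i \<notin> E" for i
    using that proj_pt_self unfolding axis_def by blast
  obtain u where u: "l u > 0" using chart.off_side[of "ev 0"] chart.ev(2)[of 0] by auto
  then have "u \<notin> E" using l_0_iff[of u] by simp
  then have "(sx * exp z) powi k u * (sy * chart.yf z) ^ l u = 0" using 0[of u] by (simp add: branch_vec_def)
  then show "chart.yf z = 0" using sx_cases sy_cases u by auto
next
  assume y: "chart.yf z = 0"
  have "proj_pt (branch_vec z (chart.yf z)) \<in> real_toric_surface b"
    using branch_subset curve_closure_subset_surface by (auto simp: branch_def)
  moreover have "v $ i = 0" if "v \<in> proj_pt (branch_vec z (chart.yf z))" "i \<notin> E" for v i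
    using that y l_0_iff[of i] by (auto simp: proj_pt_def branch_vec_def)
  ultimately show "proj_pt (branch_vec z (chart.yf z)) \<in> axis b E" unfolding axis_def by blast
qed

text \<open>The coordinates at \<open>ev 0\<close> and \<open>ev 1\<close> are 1 and
  \<open>sx * exp z\<close>, so the projective point determines \<open>z\<close>; there is an
  \<open>ev 1\<close> on the side because \<open>d \<ge> 1\<close>.\<close>

lemma branch_inj: "proj_pt (branch_vec z y) = proj_pt (branch_vec z' y') \<Longrightarrow> z = z'"
proof -
  assume "proj_pt (branch_vec z y) = proj_pt (branch_vec z' y')"
  then obtain r where r: "branch_vec z y = r *\<^sub>R branch_vec z' y'" by (auto simp: proj_pt_eq_iff)
  then have "branch_vec z y $ ev 0 = r * branch_vec z' y' $ ev 0" "branch_vec z y $ ev 1 = r * branch_vec z' y' $ ev 1"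
    by simp_all
  then have "sx * exp z = sx * exp z'" using d by (simp add: branch_vec_ev)
  then show "z = z'" using sx_cases by auto
qed

text \<open>All side coordinates are nonzero on the branch, so an axis meeting it belongs to a side
  containing \<open>E\<close>. A nonzero functional constant on \<open>E\<close> vanishes on
  \<open>e\<close>, hence not on \<open>f\<close>, and takes its value on \<open>E\<close> at no
  further lattice point.\<close>

lemma branch_other_axis:
  assumes "is_side b E'" "E' \<noteq> E"
  shows "proj_pt (branch_vec z y) \<notin> axis b E'"
proof
  assume ax: "proj_pt (branch_vec z y) \<in> axis b E'"
  have "branch_vec z y $ i \<noteq> 0" if "i \<in> E" for i
  proof -
    obtain j where j: "j \<le> d" "i = ev j" using ev(3)[OF \<open>i \<in> E\<close>] by blast
    moreover have "sx \<noteq> 0" using sx_cases by auto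
    ultimately show ?thesis by (simp add: branch_vec_ev)
  qed
  then have sub: "E \<subseteq> E'" using ax proj_pt_self unfolding axis_def by blast
  obtain u :: "real \<times> real" and c' where u: "u \<noteq> 0" "E' = {i. inner u (lpt (b i)) = c'}"
    using assms(1) unfolding is_side_def by blast
  define u1 u2 where "u1 = fst u" and "u2 = snd u"
  define A where "A = u1 * real_of_int (fst e) + u2 * real_of_int (snd e)"
  define B where "B = u1 * real_of_int (fst f) + u2 * real_of_int (snd f)"
  define C where "C = u1 * real_of_int (fst b0) + u2 * real_of_int (snd b0)"
  have inn: "inner u (lpt (b i)) = C + real_of_int (k i) * A + real (l i) * B" for i
  proof -
    have "inner u (lpt (b i)) = u1 * real_of_int (fst (b i)) + u2 * real_of_int (snd (b i))"
      by (simp add: u1_def u2_def lpt_def inner_prod_def)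
    then show ?thesis unfolding b_fst b_snd A_def B_def C_def by (simp add: algebra_simps)
  qed
  have "ev 0 \<in> E'" "ev 1 \<in> E'" using ev(2) d sub by auto
  then have "C = c'" "C + A = c'" unfolding u(2) using inn chart.ev(1,2)[of 0] chart.ev(1,2)[of 1] d by auto
  then have A0: "A = 0" by simp
  have detr: "real_of_int (fst e) * real_of_int (snd f) - real_of_int (snd e) * real_of_int (fst f) = 1"
    using det by (metis of_int_1 of_int_diff of_int_mult)
  have "B \<noteq> 0"
  proof
    assume "B = 0"
    then have "u1 = 0" "u2 = 0" using A0 detr unfolding A_def B_def by algebra+
    then show False using u(1) by (simp add: u1_def u2_def prod_eq_iff)
  qed
  then have "i \<in> E' \<longleftrightarrow> l i = 0" for i
    unfolding u(2) using inn[of i] A0 \<open>C = c'\<close> by simp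
  then show False using assms(2) l_0_iff by blast
qed

lemma ex_arc:
  obtains A where "A \<subseteq> branch" "is_arc RP_topology A" "finite (A \<inter> axis b E)"
    "card (A \<inter> axis b E) = int_length E" "\<And>E'. is_side b E' \<Longrightarrow> E' \<noteq> E \<Longrightarrow> A \<inter> axis b E' = {}"
proof -
  let ?g = "\<lambda>z. proj_pt (branch_vec z (chart.yf z))" and ?Z = "{z. chart.yf z = 0}"
  have "bounded ?Z" using chart.finite_zeros by (rule finite_imp_bounded)
  then obtain M0 where M0: "\<And>z. z \<in> ?Z \<Longrightarrow> \<bar>z\<bar> \<le> M0" by (auto simp: bounded_iff)
  \<comment> \<open>At least 1, so that the interval has positive length and its parametrization by
    [0, 1] is injective.\<close>
  define M where "M = max M0 1"
  have M: "M > 0" "\<And>z. z \<in> ?Z \<Longrightarrow> \<bar>z\<bar> \<le> M" using M0 by (force simp: M_def)+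
  define r where "r t = - M + 2 * M * t" for t :: real
  have r: "r ` {0..1} = {-M..M}"
  proof (intro equalityI subsetI)
    fix z assume "z \<in> {-M..M}"
    then show "z \<in> r ` {0..1}" using M(1)
      by (intro image_eqI[of _ _ "(z + M) / (2 * M)"]) (auto simp: r_def field_simps)
  qed (use M(1) in \<open>auto simp: r_def mult_left_le\<close>)
  have inj: "inj_on ?g B" for B using branch_inj by (auto simp: inj_on_def)
  define A where "A = ?g ` {-M..M}"
  have "continuous_on {0..1} r" unfolding r_def by (intro continuous_intros)
  moreover have "r \<in> {0..1} \<rightarrow> {-M..M}" using r by blast
  ultimately have "continuous_map (top_of_set {0..1}) (top_of_set {-M..M}) r"
    by (simp add: continuous_map_in_subtopology)
  then have "pathin RP_topology (?g \<circ> r)"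
    unfolding pathin_def by (rule continuous_map_compose[OF _ continuous_map_branch])
  moreover have "inj_on (?g \<circ> r) {0..1}"
    using M(1) inj by (intro comp_inj_on) (auto simp: r_def inj_on_def)
  moreover have "(?g \<circ> r) ` {0..1} = A" unfolding image_comp[symmetric] r A_def ..
  ultimately have arc: "is_arc RP_topology A" unfolding is_arc_def by blast
  have AE: "A \<inter> axis b E = ?g ` ?Z"
  proof (intro equalityI subsetI)
    fix w assume "w \<in> A \<inter> axis b E"
    then obtain z where "w = ?g z" "?g z \<in> axis b E" unfolding A_def by blast
    then show "w \<in> ?g ` ?Z" unfolding branch_axis_iff by blast
  next
    fix w assume "w \<in> ?g ` ?Z"
    then obtain z where z: "z \<in> ?Z" "w = ?g z" by blast
    then have "z \<in> {-M..M}" using M(2)[of z] by auto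
    moreover have "?g z \<in> axis b E" unfolding branch_axis_iff using z by simp
    ultimately show "w \<in> A \<inter> axis b E" unfolding A_def z(2) by blast
  qed
  have "finite (A \<inter> axis b E)" unfolding AE using chart.finite_zeros by simp
  moreover have "card (A \<inter> axis b E) = int_length E"
    unfolding AE card_image[OF inj] chart.card_zeros int_length_def d(2) by simp
  moreover have "A \<inter> axis b E' = {}" if "is_side b E'" "E' \<noteq> E" for E'
    using branch_other_axis[OF that] by (auto simp: A_def)
  moreover have "A \<subseteq> branch" by (auto simp: A_def branch_def)
  ultimately show ?thesis using that arc by blast
qed

text \<open>The closure of the curve satisfies the binomial equations of the toric surface and the linear
  equation of \<open>H\<close>, which on the axis of \<open>E\<close> leave only the roots of the side polynomial.\<close>

lemma curve_closure_axis_subset: "mirror_curve_closure b \<sigma>1 p s q \<inter> axis b E \<subseteq> branch"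
proof
  \<comment> \<open>Quadratic binomials are enough: they already force a geometric progression along
    the side.\<close>
  define C where "C = {V :: real^'n. (\<Sum>i\<in>UNIV. a i * V $ i) = 0} \<inter>
    {V. \<forall>i1 i2 i3 i4. fst (b i1) + fst (b i2) = fst (b i3) + fst (b i4) \<and>
      snd (b i1) + snd (b i2) = snd (b i3) + snd (b i4) \<longrightarrow> V $ i1 * V $ i2 = V $ i3 * V $ i4}"
  have "closed {V :: real^'n. Q \<longrightarrow> V $ i1 * V $ i2 = V $ i3 * V $ i4}" for Q i1 i2 i3 i4
    by (cases Q) (auto intro!: closed_Collect_eq continuous_intros)
  then have "closed C"
    unfolding C_def by (intro closed_Int closed_Collect_all) (auto intro!: closed_Collect_eq continuous_intros)
  have C_lin: "(\<Sum>i\<in>UNIV. a i * V $ i) = 0" if "V \<in> C" for V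
    using that unfolding C_def by (elim IntE CollectE)
  have C_bin: "V $ i1 * V $ i2 = V $ i3 * V $ i4"
    if "V \<in> C" "fst (b i1) + fst (b i2) = fst (b i3) + fst (b i4)"
      "snd (b i1) + snd (b i2) = snd (b i3) + snd (b i4)" for V i1 i2 i3 i4
    using that(1) unfolding C_def by (elim IntE CollectE) (use that(2,3) in blast)
  have C_I: "V \<in> C" if "(\<Sum>i\<in>UNIV. a i * V $ i) = 0"
    "\<And>i1 i2 i3 i4. fst (b i1) + fst (b i2) = fst (b i3) + fst (b i4) \<Longrightarrow>
      snd (b i1) + snd (b i2) = snd (b i3) + snd (b i4) \<Longrightarrow> V $ i1 * V $ i2 = V $ i3 * V $ i4" for V
    unfolding C_def by (intro IntI CollectI allI impI) (rule that(1), elim conjE, rule that(2))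
  note \<open>closed C\<close>
  moreover have "r *\<^sub>R V \<in> C" if "V \<in> C" for r V
  proof -
    have "(\<Sum>i\<in>UNIV. a i * (r *\<^sub>R V) $ i) = r * (\<Sum>i\<in>UNIV. a i * V $ i)"
      by (simp add: sum_distrib_left algebra_simps)
    moreover have "(r *\<^sub>R V) $ i1 * (r *\<^sub>R V) $ i2 = (r * r) * (V $ i1 * V $ i2)" for i1 i2 by simp
    ultimately show ?thesis
      using C_lin[OF that] by (intro C_I) (metis mult_zero_right, metis C_bin[OF that])
  qed
  moreover have "toric_map b ` {(x, y) \<in> real_torus. mirror_poly b \<sigma>1 p s x y q = 0} \<subseteq> proj_pt ` (C - {0})"
  proof
    fix w assume "w \<in> toric_map b ` {(x, y) \<in> real_torus. mirror_poly b \<sigma>1 p s x y q = 0}"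
    then obtain X Y where w: "w = toric_map b (X, Y)" and X: "X \<noteq> 0" "Y \<noteq> 0" and H: "mirror_poly b \<sigma>1 p s X Y q = 0"
      by (auto simp: real_torus_def)
    define V :: "real^'n" where "V = (\<chi> i. X powi fst (b i) * Y powi snd (b i))"
    have w: "w = proj_pt V" by (simp add: w toric_map_def V_def)
    have "V $ ev 0 \<noteq> 0" using X by (simp add: V_def)
    then have "V \<noteq> 0" by auto
    moreover have "(\<Sum>i\<in>UNIV. a i * V $ i) = 0"
      using H by (simp add: mirror_poly_def V_def a_def mult.assoc)
    moreover have "V $ i1 * V $ i2 = V $ i3 * V $ i4"
      if "fst (b i1) + fst (b i2) = fst (b i3) + fst (b i4)" "snd (b i1) + snd (b i2) = snd (b i3) + snd (b i4)" for i1 i2 i3 i4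
    proof -
      have "V $ i * V $ j = X powi (fst (b i) + fst (b j)) * Y powi (snd (b i) + snd (b j))" for i j
        using X by (simp add: V_def power_int_add)
      then show ?thesis using that by simp
    qed
    ultimately have "V \<noteq> 0 \<and> V \<in> C" by (intro conjI C_I)
    then show "w \<in> proj_pt ` (C - {0})" unfolding w by blast
  qed
  ultimately have CC: "mirror_curve_closure b \<sigma>1 p s q \<subseteq> proj_pt ` (C - {0})"
    unfolding mirror_curve_closure_def by (rule closure_of_homogeneous)
  fix w assume w: "w \<in> mirror_curve_closure b \<sigma>1 p s q \<inter> axis b E"
  then obtain V where V: "w = proj_pt V" "V \<in> C" "V \<noteq> 0" using CC by blast
  have off: "V $ i = 0" if "i \<notin> E" for i
    using w that proj_pt_self[of V] unfolding V(1) axis_def by blast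
  have lin: "(\<Sum>j\<le>d. a (ev j) * V $ ev j) = 0"
  proof -
    have "(\<Sum>i\<in>UNIV. a i * V $ i) = (\<Sum>i | l i = 0. a i * V $ i)"
      using off l_0_iff by (intro sum.mono_neutral_right) auto
    then show ?thesis using C_lin[OF V(2)] unfolding chart.edge_sum by simp
  qed
  have bev: "fst (b (ev j)) = fst b0 + int j * fst e" "snd (b (ev j)) = snd b0 + int j * snd e" if "j \<le> d" for j
    unfolding b_fst b_snd using chart.ev(1,2)[OF that] by simp_all
  have bin: "V $ ev i1 * V $ ev i2 = V $ ev i3 * V $ ev i4"
    if "i1 \<le> d" "i2 \<le> d" "i3 \<le> d" "i4 \<le> d" "i1 + i2 = i3 + i4" for i1 i2 i3 i4
  proof -
    have "int i1 + int i2 = int i3 + int i4" using that(5) by linarith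
    then have "fst (b (ev i1)) + fst (b (ev i2)) = fst (b (ev i3)) + fst (b (ev i4))"
      "snd (b (ev i1)) + snd (b (ev i2)) = snd (b (ev i3)) + snd (b (ev i4))"
      unfolding bev[OF that(1)] bev[OF that(2)] bev[OF that(3)] bev[OF that(4)] by algebra+
    then show ?thesis by (rule C_bin[OF V(2)])
  qed
  \<comment> \<open>If the first side coordinate vanished, the binomials for three consecutive
    points would kill all but the last, and the linear equation would kill the last one too, since
    its coefficient is nonzero.\<close>
  have V0: "V $ ev 0 \<noteq> 0"
  proof
    assume 0: "V $ ev 0 = 0"
    have z: "V $ ev j = 0" if "j < d" for j
      using that
    proof (induction j)
      case (Suc j)
      have "V $ ev (Suc j) * V $ ev (Suc j) = V $ ev j * V $ ev (Suc (Suc j))"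
        using Suc.prems by (intro bin) auto
      then show ?case using Suc by simp
    qed (use 0 in simp)
    have "(\<Sum>j\<le>d. a (ev j) * V $ ev j) = (\<Sum>j\<in>{d}. a (ev j) * V $ ev j)"
      using z by (intro sum.mono_neutral_right) auto
    then have "V $ ev d = 0" using lin a_nz by simp
    then have "V $ i = 0" for i
      using off[of i] ev(3)[of i] z by (metis le_neq_implies_less)
    then show False using V(3) by (simp add: vec_eq_iff)
  qed
  \<comment> \<open>The ratio of the progression; the linear equation makes \<open>sx * x\<close> a
    root of the side polynomial, hence some \<open>exp z\<close> with
    \<open>yf z = 0\<close>.\<close>
  define x where "x = V $ ev 1 / V $ ev 0"
  have Vx: "V $ ev j = V $ ev 0 * x ^ j" if "j \<le> d" for j
    using that
  proof (induction j)
    case (Suc j)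
    have "V $ ev 0 * V $ ev (Suc j) = V $ ev 1 * V $ ev j"
      using Suc.prems d by (intro bin) auto
    also have "\<dots> = V $ ev 1 * (V $ ev 0 * x ^ j)" using Suc by simp
    finally have "V $ ev (Suc j) = V $ ev 1 * x ^ j" using V0 by simp
    then show ?case using V0 by (simp add: x_def)
  qed simp
  have sx2: "sx * sx = 1" using sx_cases by auto
  have "(\<Sum>j\<le>d. c (ev j) * (sx * x) ^ j) = (\<kappa> / V $ ev 0) * (\<Sum>j\<le>d. a (ev j) * V $ ev j)"
    unfolding sum_distrib_left
  proof (rule sum.cong[OF refl])
    fix j assume "j \<in> {..d}"
    then have j: "j \<le> d" by simp
    have "sx ^ j * sx ^ j = 1" using sx2 by (simp flip: power_mult_distrib)
    moreover have "(\<kappa> * A * B) * (B * X) = (B * B) * (\<kappa> * A * X)" for A B X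
      by (simp only: ac_simps)
    ultimately have "(\<kappa> * a (ev j) * sx ^ j) * (sx ^ j * x ^ j) = \<kappa> * a (ev j) * x ^ j"
      by (simp only: mult_1)
    then show "c (ev j) * (sx * x) ^ j = (\<kappa> / V $ ev 0) * (a (ev j) * V $ ev j)"
      unfolding c_def Vx[OF j] power_mult_distrib using chart.ev(1,2)[OF j] V0 by simp
  qed
  also have "\<dots> = 0" by (simp add: lin)
  finally obtain z where z: "sx * x = exp z" "chart.yf z = 0" using chart.edge_poly_root by blast
  then have x: "x = sx * exp z" using sx2 using sx_cases by auto
  have "V = V $ ev 0 *\<^sub>R branch_vec z 0"
  proof (unfold vec_eq_iff, rule allI)
    fix i
    show "V $ i = (V $ ev 0 *\<^sub>R branch_vec z 0) $ i"
    proof (cases "i \<in> E")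
      case True
      obtain j where j: "j \<le> d" "i = ev j" using ev(3)[OF True] by blast
      show ?thesis
        by (simp only: j(2) vector_scaleR_component branch_vec_ev[OF j(1)] Vx[OF j(1)] x real_scaleR_def)
    next
      case False
      then show ?thesis using off l_0_iff[of i] by (simp add: branch_vec_def)
    qed
  qed
  then have "w = proj_pt (branch_vec z (chart.yf z))"
    unfolding V(1) z(2) using proj_pt_scaleR[OF V0, of "branch_vec z 0"] by simp
  then show "w \<in> branch" by (auto simp: branch_def)
qed

end

section \<open>All sides lie on one component\<close>

text \<open>For \<open>u \<noteq> 0\<close>, the indices of the lattice points on the face of the
  polygon exposed by \<open>u\<close>: a single vertex or a side.\<close>

definition face :: "('n \<Rightarrow> int \<times> int) \<Rightarrow> real \<times> real \<Rightarrow> 'n set" where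
  "face b u = {i. \<forall>j. inner u (lpt (b j)) \<le> inner u (lpt (b i))}"

lemma face_nonempty: "face (b :: 'n::finite \<Rightarrow> int \<times> int) u \<noteq> {}"
proof -
  have "Max (range (\<lambda>i. inner u (lpt (b i)))) \<in> range (\<lambda>i. inner u (lpt (b i)))" by (intro Max_in) auto
  then obtain i where i: "Max (range (\<lambda>i. inner u (lpt (b i)))) = inner u (lpt (b i))" by (rule rangeE)
  have "inner u (lpt (b j)) \<le> inner u (lpt (b i))" for j unfolding i[symmetric] by (intro Max_ge) auto
  then show ?thesis by (auto simp: face_def)
qed

lemma side_is_face:
  assumes "is_side b E"
  obtains u where "u \<noteq> 0" "E = face b u"
proof -
  obtain u c where u: "u \<noteq> 0" "\<And>i. inner u (lpt (b i)) \<le> c" "E = {i. inner u (lpt (b i)) = c}" "card E \<ge> 2"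
    using assms unfolding is_side_def by blast
  have "E \<noteq> {}" using u(4) by auto
  then obtain i0 where i0: "inner u (lpt (b i0)) = c" unfolding u(3) by blast
  have "E = face b u"
    unfolding u(3) face_def using u(2) i0 by (auto intro: antisym)
  then show ?thesis using that u(1) by blast
qed

lemma face_is_side:
  assumes "u \<noteq> 0" "card (face b u) \<ge> 2"
  shows "is_side b (face b u)"
proof -
  have "face b u \<noteq> {}" using assms(2) by auto
  then obtain i0 where i0: "i0 \<in> face b u" by blast
  have "face b u = {i. inner u (lpt (b i)) = inner u (lpt (b i0))}"
    using i0 by (auto simp: face_def intro: antisym)
  then show ?thesis
    unfolding is_side_def using assms i0
    by (intro exI[of _ u] exI[of _ "inner u (lpt (b i0))"]) (auto simp: face_def)
qed

text \<open>Each index outside the face loses by a strict inequality, which persists under small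
  changes of \<open>u\<close>; there are finitely many indices.\<close>

lemma eventually_face_subset:
  fixes b :: "'n::finite \<Rightarrow> int \<times> int"
  shows "eventually (\<lambda>u'. face b u' \<subseteq> face b u) (at u)"
proof -
  have "eventually (\<lambda>u'. j \<notin> face b u') (at u)" if "j \<notin> face b u" for j
  proof -
    obtain i where "inner u (lpt (b j)) < inner u (lpt (b i))" using \<open>j \<notin> face b u\<close> unfolding face_def mem_Collect_eq not_all not_le by blast
    then have "0 < inner u (lpt (b i)) - inner u (lpt (b j))" by simp
    moreover have "((\<lambda>u'. inner u' (lpt (b i)) - inner u' (lpt (b j))) \<longlongrightarrow> inner u (lpt (b i)) - inner u (lpt (b j))) (at u)"
      by (intro tendsto_intros)
    ultimately have "eventually (\<lambda>u'. 0 < inner u' (lpt (b i)) - inner u' (lpt (b j))) (at u)"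
      by (rule order_tendstoD(1)[rotated])
    then show ?thesis by (rule eventually_mono) (auto simp: face_def not_le)
  qed
  then have "eventually (\<lambda>u'. \<forall>j\<in>- face b u. j \<notin> face b u') (at u)"
    by (intro eventually_ball_finite) auto
  then show ?thesis by (rule eventually_mono) auto
qed

text \<open>Consecutive sides share a vertex: rotating the normal \<open>u\<close>, the sides that meet the face of \<open>u\<close>
  only change at a side, which meets its neighbours.\<close>

lemma side_connected_induct:
  fixes b :: "'n::finite \<Rightarrow> int \<times> int"
  assumes P: "is_side b E0" "P E0"
    and step: "\<And>E E'. is_side b E \<Longrightarrow> is_side b E' \<Longrightarrow> E \<inter> E' \<noteq> {} \<Longrightarrow> P E \<Longrightarrow> P E'"
    and E: "is_side b E"
  shows "P E"
proof -
  \<comment> \<open>\<open>Q\<close> is unaffected when the face shrinks, so by semicontinuity of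
    faces it is locally constant in \<open>u\<close>.\<close>
  define Q where "Q u \<longleftrightarrow> (\<exists>E. is_side b E \<and> E \<inter> face b u \<noteq> {} \<and> P E)" for u
  have Q_eq: "Q u = Q u'" if u: "u \<noteq> 0" and sub: "face b u' \<subseteq> face b u" for u u'
  proof
    assume "Q u'"
    then show "Q u" using sub unfolding Q_def by blast
  next
    assume "Q u"
    then obtain E1 where E1: "is_side b E1" "E1 \<inter> face b u \<noteq> {}" "P E1" unfolding Q_def by blast
    show "Q u'"
    proof (cases "card (face b u) \<ge> 2")
      case True
      then have side: "is_side b (face b u)" using face_is_side[OF u] by blast
      then have "P (face b u)" using step E1 by blast
      moreover have "face b u \<inter> face b u' \<noteq> {}" using sub face_nonempty[of b u'] by blast
      ultimately show ?thesis using side unfolding Q_def by blast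
    next
      case False
      moreover have "card (face b u') > 0" using face_nonempty[of b u'] by (simp add: card_gt_0_iff)
      \<comment> \<open>A face with fewer than two points is a vertex and equals every nonempty face
        inside it.\<close>
      ultimately have "face b u' = face b u" using sub by (intro card_seteq) auto
      then show ?thesis using \<open>Q u\<close> unfolding Q_def by simp
    qed
  qed
  \<comment> \<open>The punctured plane is connected, so \<open>Q\<close> takes the same value at
    the normals of all sides.\<close>
  have conn: "connected (- {0 :: real \<times> real})"
    by (rule connected_punctured_universe) simp
  have loc: "\<forall>u\<in>- {0}. eventually (\<lambda>u'. Q u = Q u') (at u within - {0})"
  proof
    fix u :: "real \<times> real" assume "u \<in> - {0}"
    then have "eventually (\<lambda>u'. Q u = Q u') (at u)"
      using eventually_face_subset[of b u] by (elim eventually_mono) (use Q_eq in auto)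
    then show "eventually (\<lambda>u'. Q u = Q u') (at u within - {0})"
      by (rule filter_leD[OF at_le, rotated]) simp
  qed
  have const: "Q u = Q u'" if "u \<noteq> 0" "u' \<noteq> 0" for u u'
    using connected_local_const[OF conn _ _ loc, of u u'] that by simp
  obtain u0 where u0: "u0 \<noteq> 0" "E0 = face b u0" by (rule side_is_face[OF P(1)])
  obtain u where u: "u \<noteq> 0" "E = face b u" by (rule side_is_face[OF E])
  have "Q u0" using P u0 face_nonempty[of b u0] unfolding Q_def by blast
  then have "Q u" using const u0(1) u(1) by blast
  then show "P E" using step E u(2) unfolding Q_def by blast
qed

context real_mirror
begin

text \<open>Only chart-free properties of a branch are kept, so that branches of different sides can
  be put together.\<close>

lemma side_branch:
  assumes "is_side b E"
  obtains B where "B \<subseteq> mirror_curve_closure b \<sigma>1 p s q" "connectedin RP_topology B"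
    "\<And>v. v \<in> E \<Longrightarrow> corner v \<subseteq> B" "\<And>v. v \<in> E \<Longrightarrow> corner v \<noteq> {}"
    "mirror_curve_closure b \<sigma>1 p s q \<inter> axis b E \<subseteq> B"
    "\<exists>A. A \<subseteq> B \<and> is_arc RP_topology A \<and> finite (A \<inter> axis b E) \<and> card (A \<inter> axis b E) = int_length E
       \<and> (\<forall>E'. is_side b E' \<and> E' \<noteq> E \<longrightarrow> A \<inter> axis b E' = {})"
proof -
  obtain e f b0 k l d ev where
    "fst e * snd f - snd e * fst f = 1"
    "\<And>i. fst (b i) = fst b0 + k i * fst e + int (l i) * fst f"
    "\<And>i. snd (b i) = snd b0 + k i * snd e + int (l i) * snd f"
    "\<And>i. l i = 0 \<longleftrightarrow> i \<in> E" "d \<ge> 1" "card E = d + 1"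
    "\<And>j. j \<le> d \<Longrightarrow> k (ev j) = int j" "\<And>j. j \<le> d \<Longrightarrow> ev j \<in> E" "\<And>i. i \<in> E \<Longrightarrow> \<exists>j\<le>d. i = ev j"
    by (rule side_coordinates[OF enum assms]) blast
  then interpret real_mirror_side b p T \<sigma>1 h s q D \<epsilon> K E e f b0 k l d ev
    using assms by unfold_locales
  obtain A where A: "A \<subseteq> branch" "is_arc RP_topology A" "finite (A \<inter> axis b E)"
    "card (A \<inter> axis b E) = int_length E" "\<And>E'. is_side b E' \<Longrightarrow> E' \<noteq> E \<Longrightarrow> A \<inter> axis b E' = {}"
    by (rule ex_arc) blast
  show ?thesis
  proof (rule that[OF branch_subset connectedin_branch _ _ curve_closure_axis_subset])
    show "corner v \<subseteq> branch" "corner v \<noteq> {}" if "v \<in> E" for v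
      by (rule corner_subset_branch[OF that], rule corner_nonempty[OF that])
    show "\<exists>A. A \<subseteq> branch \<and> is_arc RP_topology A \<and> finite (A \<inter> axis b E) \<and> card (A \<inter> axis b E) = int_length E
       \<and> (\<forall>E'. is_side b E' \<and> E' \<noteq> E \<longrightarrow> A \<inter> axis b E' = {})"
    proof (intro exI[of _ A] conjI allI impI)
      show "A \<inter> axis b E' = {}" if "is_side b E' \<and> E' \<noteq> E" for E' using A(5) that by blast
    qed (rule A)+
  qed
qed

text \<open>A point of \<open>W\<close> on an axis lies on the branch of that side, so
  \<open>W\<close> contains this connected branch; shared corners then bring the branches of all
  other sides into \<open>W\<close>.\<close>

lemma arc_in_unbounded_component:
  assumes W: "W \<in> connected_components_of (subtopology RP_topology (mirror_curve_closure b \<sigma>1 p s q))"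
    and ax: "W \<inter> \<Union>{axis b E | E. is_side b E} \<noteq> {}" and E: "is_side b E"
  shows "\<exists>A. A \<subseteq> W \<and> is_arc RP_topology A \<and> finite (A \<inter> axis b E) \<and> card (A \<inter> axis b E) = int_length E
       \<and> (\<forall>E'. is_side b E' \<and> E' \<noteq> E \<longrightarrow> A \<inter> axis b E' = {})"
proof -
  define CC where "CC = mirror_curve_closure b \<sigma>1 p s q"
  define good where "good E B \<longleftrightarrow> B \<subseteq> CC \<and> connectedin RP_topology B \<and>
    (\<forall>v\<in>E. corner v \<subseteq> B \<and> corner v \<noteq> {}) \<and> CC \<inter> axis b E \<subseteq> B \<and>
    (\<exists>A. A \<subseteq> B \<and> is_arc RP_topology A \<and> finite (A \<inter> axis b E) \<and> card (A \<inter> axis b E) = int_length E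
       \<and> (\<forall>E'. is_side b E' \<and> E' \<noteq> E \<longrightarrow> A \<inter> axis b E' = {}))" for E B
  have ex: "\<exists>B. good E B" if "is_side b E" for E
  proof (rule side_branch[OF that])
    fix B
    assume B: "B \<subseteq> mirror_curve_closure b \<sigma>1 p s q" "connectedin RP_topology B"
      "\<And>v. v \<in> E \<Longrightarrow> corner v \<subseteq> B" "\<And>v. v \<in> E \<Longrightarrow> corner v \<noteq> {}"
      "mirror_curve_closure b \<sigma>1 p s q \<inter> axis b E \<subseteq> B"
      "\<exists>A. A \<subseteq> B \<and> is_arc RP_topology A \<and> finite (A \<inter> axis b E) \<and> card (A \<inter> axis b E) = int_length E
       \<and> (\<forall>E'. is_side b E' \<and> E' \<noteq> E \<longrightarrow> A \<inter> axis b E' = {})"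
    have "good E B" unfolding good_def CC_def using B(1,2,5,6) by (intro conjI ballI B(3,4))
    then show ?thesis by blast
  qed
  have good_D: "B \<subseteq> CC \<and> connectedin RP_topology B \<and> CC \<inter> axis b E \<subseteq> B
      \<and> (\<forall>v\<in>E. corner v \<subseteq> B \<and> corner v \<noteq> {})" if "good E B" for E B
    using that unfolding good_def by (elim conjE) (intro conjI)
  have in_W: "B \<subseteq> W" if "good E B" "x \<in> B" "x \<in> W" for E B x
  proof (rule connected_components_of_maximal[OF W[folded CC_def]])
    show "connectedin (subtopology RP_topology CC) B"
      unfolding connectedin_subtopology using good_D[OF that(1)] by (elim conjE) (intro conjI)
    show "\<not> disjnt W B" using that by (auto simp: disjnt_def)
  qed
  have W_sub: "W \<subseteq> CC"
    using connected_components_of_subset[OF W[folded CC_def]] by simp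
  obtain E0 x where E0: "is_side b E0" "x \<in> W" "x \<in> axis b E0" using ax by blast
  obtain B0 where B0: "good E0 B0" using ex E0 by blast
  then have "x \<in> B0" using good_D[OF B0] E0 W_sub by blast
  then have "B0 \<subseteq> W" using in_W[OF B0 _ E0(2)] by blast
  have "\<exists>B. good E B \<and> B \<subseteq> W"
  proof (rule side_connected_induct[where P = "\<lambda>E. \<exists>B. good E B \<and> B \<subseteq> W", OF E0(1) _ _ E])
    show "\<exists>B. good E0 B \<and> B \<subseteq> W" using B0 \<open>B0 \<subseteq> W\<close> by (intro exI conjI)
    fix E1 E2 assume E12: "is_side b E1" "is_side b E2" "E1 \<inter> E2 \<noteq> {}" "\<exists>B. good E1 B \<and> B \<subseteq> W"
    then obtain v where v: "v \<in> E1" "v \<in> E2" by blast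
    obtain B1 where B1: "good E1 B1" "B1 \<subseteq> W" using E12(4) by blast
    obtain B2 where B2: "good E2 B2" using ex E12(2) by blast
    have c: "corner v \<noteq> {}" "corner v \<subseteq> B1" "corner v \<subseteq> B2"
      using good_D[OF B1(1)] good_D[OF B2] v by blast+
    then obtain y where "y \<in> corner v" by blast
    then have "B2 \<subseteq> W" using in_W[OF B2, of y] c B1(2) by blast
    then show "\<exists>B. good E2 B \<and> B \<subseteq> W" using B2 by blast
  qed
  then obtain B where B: "good E B" "B \<subseteq> W" by blast
  then obtain A where "A \<subseteq> B" "is_arc RP_topology A" "finite (A \<inter> axis b E)" "card (A \<inter> axis b E) = int_length E"
      "\<forall>E'. is_side b E' \<and> E' \<noteq> E \<longrightarrow> A \<inter> axis b E' = {}" unfolding good_def by (elim conjE exE)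
  then show ?thesis using B(2) by (intro exI[of _ A] conjI) (rule order_trans)
qed

end

lemma ex_cone_bound:
  fixes b :: "'n::finite \<Rightarrow> int \<times> int"
  assumes tri: "unimodular_triangulation b T" and enum: "lattice_points_enum b"
  obtains D :: nat where "D \<ge> 1"
    "\<And>v w. \<exists>u1 u2 m n. {v, u1, u2} \<in> T \<and> \<bar>det2 (b v) (b u1) (b u2)\<bar> = 1 \<and> m + n \<le> D \<and>
      fst (b w) - fst (b v) = int m * (fst (b u1) - fst (b v)) + int n * (fst (b u2) - fst (b v)) \<and>
      snd (b w) - snd (b v) = int m * (snd (b u1) - snd (b v)) + int n * (snd (b u2) - snd (b v))"
proof -
  define R where "R v w D \<longleftrightarrow> (\<exists>u1 u2 m n. {v, u1, u2} \<in> T \<and> \<bar>det2 (b v) (b u1) (b u2)\<bar> = 1 \<and> m + n \<le> D \<and>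
      fst (b w) - fst (b v) = int m * (fst (b u1) - fst (b v)) + int n * (fst (b u2) - fst (b v)) \<and>
      snd (b w) - snd (b v) = int m * (snd (b u1) - snd (b v)) + int n * (snd (b u2) - snd (b v)))" for v w D
  have inj: "inj b" using enum by (simp add: lattice_points_enum_def)
  have "\<exists>D. R v w D" for v w
    by (rule ex_triangle_cone[OF tri inj, of v w]) (unfold R_def, blast)
  then obtain F where F: "\<And>v w. R v w (F v w)" by metis
  define D where "D = Max (range (\<lambda>(v, w). F v w)) + 1"
  have "F v w \<le> D" for v w
  proof -
    have "F v w \<le> Max (range (\<lambda>(v, w). F v w))" by (intro Max_ge) auto
    then show ?thesis by (simp add: D_def)
  qed
  then have "R v w D" for v w using F[of v w] unfolding R_def by (meson order_trans)
  then show ?thesis using that[of D] unfolding R_def D_def by simp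
qed

theorem theorem5p3p2:
  fixes b :: "'n::finite \<Rightarrow> int \<times> int"
    and p :: nat
    and T :: "'n set set"
    and i1 i2 i3 :: 'n
    and h :: "nat \<Rightarrow> 'n \<Rightarrow> rat"
    and s :: "'n set \<Rightarrow> nat \<Rightarrow> 'n \<Rightarrow> nat"
  assumes card_n: "CARD('n) = p + 3"
    and enum: "lattice_points_enum b"
    and b1: "b i1 = (1, 0)" and b2: "b i2 = (0, 1)" and b3: "b i3 = (0, 0)"
    and tri: "unimodular_triangulation b T"
    and sigma1: "{i1, i2, i3} \<in> T"
    and kd: "kahler_data b T p h s"
  shows "\<exists>\<epsilon>>0. \<forall>q :: nat \<Rightarrow> real.
           (\<forall>k<p. q k \<noteq> 0 \<and> \<bar>q k\<bar> < \<epsilon>)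
         \<and> (\<forall>i. odd (fst (b i)) \<and> odd (snd (b i)) \<longrightarrow> mirror_coeff {i1, i2, i3} p s q i < 0)
         \<and> (\<forall>i. even (fst (b i)) \<or> even (snd (b i)) \<longrightarrow> mirror_coeff {i1, i2, i3} p s q i > 0)
         \<longrightarrow> (\<forall>W. W \<in> connected_components_of
                        (subtopology RP_topology (mirror_curve_closure b {i1, i2, i3} p s q))
                   \<and> W \<inter> \<Union>{axis b E | E. is_side b E} \<noteq> {}
                 \<longrightarrow> (\<forall>E. is_side b E \<longrightarrow>
                        (\<exists>A. A \<subseteq> W \<and> is_arc RP_topology A
                           \<and> finite (A \<inter> axis b E) \<and> card (A \<inter> axis b E) = int_length E
                           \<and> (\<forall>E'. is_side b E' \<and> E' \<noteq> E \<longrightarrow> A \<inter> axis b E' = {}))))"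
proof -
  obtain D where D: "D \<ge> 1"
    "\<And>v w. \<exists>u1 u2 m n. {v, u1, u2} \<in> T \<and> \<bar>det2 (b v) (b u1) (b u2)\<bar> = 1 \<and> m + n \<le> D \<and>
      fst (b w) - fst (b v) = int m * (fst (b u1) - fst (b v)) + int n * (fst (b u2) - fst (b v)) \<and>
      snd (b w) - snd (b v) = int m * (snd (b u1) - snd (b v)) + int n * (snd (b u2) - snd (b v))"
    by (rule ex_cone_bound[OF tri enum]) blast
  define K where "K = real CARD('n) ^ 2 + 2"
  define M where "M = 4 * real CARD('n) * real D * K ^ (D + 1)"
  have "K > 0" unfolding K_def by (simp add: add_nonneg_pos)
  then have M: "M > 0" using D(1) by (simp add: M_def)
  show ?thesis
  \<comment> \<open>With this value the smallness condition of \<open>real_mirror\<close> is an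
    equality; it is fixed before \<open>q\<close>, \<open>W\<close> and \<open>E\<close>.\<close>
  proof (intro exI[of _ "1 / M"] conjI allI impI)
    show "0 < 1 / M" using M by simp
    fix q :: "nat \<Rightarrow> real" and W E
    assume q: "(\<forall>k<p. q k \<noteq> 0 \<and> \<bar>q k\<bar> < 1 / M)
         \<and> (\<forall>i. odd (fst (b i)) \<and> odd (snd (b i)) \<longrightarrow> mirror_coeff {i1, i2, i3} p s q i < 0)
         \<and> (\<forall>i. even (fst (b i)) \<or> even (snd (b i)) \<longrightarrow> mirror_coeff {i1, i2, i3} p s q i > 0)"
      and W: "W \<in> connected_components_of
                        (subtopology RP_topology (mirror_curve_closure b {i1, i2, i3} p s q))
                   \<and> W \<inter> \<Union>{axis b E | E. is_side b E} \<noteq> {}"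
      and E: "is_side b E"
    interpret real_mirror b p T "{i1, i2, i3}" h s q D "1 / M" K
    proof
      show "4 * real CARD('n) * real D * K ^ (D + 1) * (1 / M) \<le> 1"
        unfolding M_def[symmetric] using M by simp
      show "mirror_coeff {i1, i2, i3} p s q i > 0" if "even (fst (b i)) \<or> even (snd (b i))" for i
        using q that by blast
    qed (use card_n enum tri sigma1 kd q D M in \<open>simp_all add: K_def\<close>)
    show "\<exists>A. A \<subseteq> W \<and> is_arc RP_topology A
                           \<and> finite (A \<inter> axis b E) \<and> card (A \<inter> axis b E) = int_length E
                           \<and> (\<forall>E'. is_side b E' \<and> E' \<noteq> E \<longrightarrow> A \<inter> axis b E' = {})"
      using arc_in_unbounded_component[OF _ _ E] W by blast
  qed
qed

end
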